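(* Let $H$ be a finite simple graph with $\Delta(H)\le 2$, and let $G$ be obtained from $H$ by gluing in vertex-disjoint copies of $K_4$, i.e. there are pairwise disjoint $4$-element subsets $Y_1,\dots,Y_q\subseteq V(H)$ and $G$ has vertex set $V(H)$ and edge set $E(H)\cup\{uv: u\neq v,\ u,v\in Y_j \text{ for some } j\}$. Then there is a set of vertices $Z\subseteq V(G)$ with $|Z|\le |V(G)|/22$ such that $\chi(G-Z)\le 4$.
   Context: All graphs are finite and simple. *)

theory Defs
  imports Complex_Main
begin

definition simple_graph :: "'a set \<Rightarrow> ('a \<Rightarrow> 'a \<Rightarrow> bool) \<Rightarrow> bool" where
  "simple_graph V E \<longleftrightarrow> finite V \<and> (\<forall>u v. E u v \<longrightarrow> u \<in> V \<and> v \<in> V)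
     \<and> (\<forall>u v. E u v \<longrightarrow> E v u) \<and> (\<forall>v. \<not> E v v)"

definition degree :: "'a set \<Rightarrow> ('a \<Rightarrow> 'a \<Rightarrow> bool) \<Rightarrow> 'a \<Rightarrow> nat" where
  "degree V E v = card {u \<in> V. E v u}"

definition max_degree_le :: "'a set \<Rightarrow> ('a \<Rightarrow> 'a \<Rightarrow> bool) \<Rightarrow> nat \<Rightarrow> bool" where
  "max_degree_le V E d \<longleftrightarrow> (\<forall>v\<in>V. degree V E v \<le> d)"

definition glue_cliques ::
  "('a \<Rightarrow> 'a \<Rightarrow> bool) \<Rightarrow> nat \<Rightarrow> (nat \<Rightarrow> 'a set) \<Rightarrow> 'a \<Rightarrow> 'a \<Rightarrow> bool" where
  "glue_cliques E q Y u v \<longleftrightarrow> E u v \<or> (u \<noteq> v \<and> (\<exists>j<q. u \<in> Y j \<and> v \<in> Y j))"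

definition colorable :: "'a set \<Rightarrow> ('a \<Rightarrow> 'a \<Rightarrow> bool) \<Rightarrow> nat \<Rightarrow> bool" where
  "colorable S E k \<longleftrightarrow> (\<exists>c :: 'a \<Rightarrow> nat. (\<forall>v\<in>S. c v < k)
      \<and> (\<forall>u\<in>S. \<forall>v\<in>S. E u v \<longrightarrow> c u \<noteq> c v))"

definition chromatic_number :: "'a set \<Rightarrow> ('a \<Rightarrow> 'a \<Rightarrow> bool) \<Rightarrow> nat" where
  "chromatic_number S E = (LEAST k. colorable S E k)"

end

theory Submission
  imports Defs "HOL-Library.FuncSet" "HOL-Library.Z2" "HOL-Combinatorics.Orbits"
begin

text \<open>
  Since \<open>\<Delta>(H) \<le> 2\<close>, the edges of \<open>H\<close> join points \<open>v\<close> and \<open>s v\<close> for a permutation \<open>s\<close> of \<open>V\<close>. Let \<open>t\<close> be the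
  number of cycles of length 3 of \<open>s\<close>, and \<open>a\<close> the number of cycles of length at least 5. Deleting
  \<open>t/4\<close> points suffices, and so does deleting \<open>a/2\<close> points; as \<open>5a + 3t \<le> |V|\<close>, one of these numbers is at
  most \<open>|V|/22\<close>.

  For \<open>t/4\<close>: splitting twice along unions of two matchings, one finds a set \<open>S\<close> with at most one
  point in each clique and in each cycle that misses at most \<open>t/4\<close> cycles of length \<open>\<ge> 3\<close>;
  delete a point of each of these. The theorem of Fleischner and Stiebitz for a path plus triangles,
  applied off \<open>S\<close>, gives an independent transversal of the cliques. One that meets \<open>S\<close> in as many
  points as possible hits every cycle, since a missed cycle would allow an exchange. Its complement is again
  a linear forest plus triangles, hence 3-colourable.

  For \<open>a/2\<close>: pair up the points in each clique by \<open>\<pi>\<close> and match each cycle, up to one point if it is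
  odd, by \<open>\<beta>\<close>. A 2-colouring that splits all pairs of \<open>\<pi>\<close> and \<open>\<beta>\<close> leaves a graph that is again a union
  of two matchings, apart from unmatched points that have the colour of both their neighbours. If \<open>\<beta>\<close> maximises
  the number of 2-colourings, and then minimises the number of points whose status is forced, no
  point is forced, and a random 2-colouring is bad at an unmatched point with probability at most 1/2.
\<close>

section \<open>Unions of two matchings\<close>

text \<open>The two deletions pay for complementary cycles. A cycle with at least four points can be
  made to meet all four classes of the double splitting, while a triangle misses exactly one, so
  only triangles cost there. In the matching argument the neighbours of the unmatched point of a
  triangle are matched to each other and get different colours, so only odd cycles of length at
  least 5 cost. Hence \<open>10 * card Z1 + 12 * card Z2 \<le> 5a + 3t \<le> card V\<close>, and 22
  = 10 + 12. This is why every cycle of length at least 3 has to lose a point twice over: before the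
  transversal is found (through \<open>S\<close>) and once the transversal is removed (through the
  exchange).\<close>

definition pairing :: "'a set \<Rightarrow> ('a \<Rightarrow> 'a) \<Rightarrow> bool" where
  "pairing A \<alpha> \<longleftrightarrow> (\<forall>x\<in>A. \<alpha> x \<in> A \<and> \<alpha> (\<alpha> x) = x)"

lemma pairingD: "pairing A \<alpha> \<Longrightarrow> x \<in> A \<Longrightarrow> \<alpha> x \<in> A" "pairing A \<alpha> \<Longrightarrow> x \<in> A \<Longrightarrow> \<alpha> (\<alpha> x) = x"
  by (auto simp: pairing_def)

definition separates :: "'a set \<Rightarrow> ('a \<Rightarrow> bool) \<Rightarrow> ('a \<Rightarrow> 'a) \<Rightarrow> bool" where
  "separates A \<sigma> \<alpha> \<longleftrightarrow> (\<forall>x\<in>A. \<alpha> x \<noteq> x \<longrightarrow> \<sigma> (\<alpha> x) \<noteq> \<sigma> x)"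

text \<open>Two matchings alternate along every cycle of their union, so all its cycles are even.
  The induction removes a \<beta>-pair \<open>x\<close>, \<open>y\<close> and repairs
  \<open>\<alpha>\<close> on the rest. The claim \<open>red\<close> is stated for arbitrary
  \<open>\<alpha>\<close> and \<open>\<beta>\<close>, so that the two can trade places when
  \<open>\<beta>\<close> moves nothing.\<close>

lemma two_pairings_separable:
  assumes "finite A" "pairing A \<alpha>" "pairing A \<beta>"
  shows "\<exists>\<sigma>. separates A \<sigma> \<alpha> \<and> separates A \<sigma> \<beta>"
  using assms
proof (induction "card A" arbitrary: A \<alpha> \<beta> rule: less_induct)
  case less
  note fin = less.prems(1) and pa = less.prems(2) and pb = less.prems(3)
  have red: "\<exists>\<sigma>. separates A \<sigma> \<alpha> \<and> separates A \<sigma> \<beta>"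
    if pa: "pairing A \<alpha>" and pb: "pairing A \<beta>" and x: "x \<in> A" "\<beta> x \<noteq> x" for x \<alpha> \<beta>
  proof -
    define y where "y = \<beta> x"
    have y: "y \<in> A" "\<beta> y = x" "y \<noteq> x" using x pb by (auto simp: y_def pairing_def)
    define B where "B = A - {x, y}"
    have B: "card B < card A" "finite B"
      using fin x by (auto simp: B_def intro!: psubset_card_mono)
    have pbB: "pairing B \<beta>" using pb y unfolding pairing_def B_def y_def by (metis DiffE DiffI insertE insertI1 insert_commute singletonD)
    show ?thesis
    proof (cases "\<alpha> x = y")
      case True
      have "pairing B \<alpha>" using pa True y x unfolding pairing_def B_def by (metis DiffE DiffI insertE insertI1 insert_commute singletonD)
      then obtain \<sigma> where s: "separates B \<sigma> \<alpha>" "separates B \<sigma> \<beta>" using less.hyps[OF B] pbB by blast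
      have ay: "\<alpha> y = x" using pa x True by (auto simp: pairing_def)
      have "separates A (\<sigma>(x := True, y := False)) \<gamma>"
        if g: "pairing A \<gamma>" "\<gamma> x = y" "\<gamma> y = x" "separates B \<sigma> \<gamma>" for \<gamma>
        unfolding separates_def
      proof (intro ballI impI)
        fix z assume z: "z \<in> A" "\<gamma> z \<noteq> z"
        show "(\<sigma>(x := True, y := False)) (\<gamma> z) \<noteq> (\<sigma>(x := True, y := False)) z"
        proof (cases "z \<in> B")
          case True
          then have "\<gamma> z \<noteq> x" "\<gamma> z \<noteq> y" using g z by (auto simp: B_def pairing_def)
          then show ?thesis using True g(4) z by (auto simp: B_def separates_def)
        next
          case False then show ?thesis using z y g by (auto simp: B_def)
        qed
      qed
      from this[OF pa True ay s(1)] this[OF pb y_def[symmetric] y(2) s(2)] show ?thesis by blast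
    next
      case False
      \<comment> \<open>The path from \<open>\<alpha> x\<close> through \<open>x\<close> and
        \<open>y\<close> to \<open>\<alpha> y\<close> shrinks to one edge. Its ends then get
        opposite colours, which leaves room for opposite colours at \<open>x\<close> and
        \<open>y\<close>. If one end is missing, the other becomes a fixed point.\<close>
      define \<alpha>' where "\<alpha>' z = (if \<alpha> z = x then (if \<alpha> y = y then z else \<alpha> y)
           else if \<alpha> z = y then (if \<alpha> x = x then z else \<alpha> x) else \<alpha> z)" for z
      have pa': "pairing B \<alpha>'"
        using pa x y False unfolding pairing_def B_def \<alpha>'_def by auto
      obtain \<sigma> where s: "separates B \<sigma> \<alpha>'" "separates B \<sigma> \<beta>" using less.hyps[OF B(1,2) pa' pbB] by blast
      define v where "v = (if \<alpha> x \<noteq> x then \<not> \<sigma> (\<alpha> x) else if \<alpha> y \<noteq> y then \<sigma> (\<alpha> y) else True)"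
      have inj: "\<alpha> u = \<alpha> w \<Longrightarrow> u \<in> A \<Longrightarrow> w \<in> A \<Longrightarrow> u = w" for u w using pa by (metis pairingD(2))
      have key: "\<sigma> (\<alpha> x) \<noteq> \<sigma> (\<alpha> y)" if "\<alpha> x \<noteq> x" "\<alpha> y \<noteq> y"
      proof -
        have "\<alpha> x \<in> B" using that False x pa by (auto simp: B_def pairing_def)
        moreover have "\<alpha>' (\<alpha> x) = \<alpha> y" using that pairingD[OF pa x(1)] by (auto simp: \<alpha>'_def)
        moreover have "\<alpha> y \<noteq> \<alpha> x" using inj x y by metis
        ultimately show ?thesis using s(1) by (metis separates_def)
      qed
      have "separates A (\<sigma>(x := v, y := \<not> v)) \<alpha>"
        unfolding separates_def
      proof (intro ballI impI)
        fix z assume z: "z \<in> A" "\<alpha> z \<noteq> z"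
        have az: "\<alpha> z \<in> A" "\<alpha> (\<alpha> z) = z" using pa z by (auto simp: pairing_def)
        have ayx: "\<alpha> y \<noteq> x" using False pa y by (metis pairingD(2))
        consider "z = x" | "z = y" | "z \<noteq> x" "z \<noteq> y" "\<alpha> z = x" | "z \<noteq> x" "z \<noteq> y" "\<alpha> z = y"
          | "z \<in> B" "\<alpha> z \<noteq> x" "\<alpha> z \<noteq> y" using z by (auto simp: B_def)
        then show "(\<sigma>(x := v, y := \<not> v)) (\<alpha> z) \<noteq> (\<sigma>(x := v, y := \<not> v)) z"
        proof cases
          case 5
          then have "\<sigma> (\<alpha> z) \<noteq> \<sigma> z" using s(1) z by (auto simp: separates_def \<alpha>'_def)
          then show ?thesis using 5 by (auto simp: B_def)
        next
          case 3 then show ?thesis using az False y by (auto simp: v_def)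
        next
          case 4 then show ?thesis using az key by (auto simp: v_def)
        qed (use z False y ayx key in \<open>auto simp: v_def\<close>)
      qed
      moreover have "separates A (\<sigma>(x := v, y := \<not> v)) \<beta>"
        unfolding separates_def
      proof (intro ballI impI)
        fix z assume z: "z \<in> A" "\<beta> z \<noteq> z"
        show "(\<sigma>(x := v, y := \<not> v)) (\<beta> z) \<noteq> (\<sigma>(x := v, y := \<not> v)) z"
        proof (cases "z \<in> B")
          case True
          then have "\<beta> z \<in> B" "\<sigma> (\<beta> z) \<noteq> \<sigma> z" using s(2) z pbB by (auto simp: separates_def pairing_def)
          then show ?thesis using True by (auto simp: B_def)
        next
          case False then show ?thesis using z y y_def by (auto simp: B_def)
        qed
      qed
      ultimately show ?thesis by blast
    qed
  qed
  show ?case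
  proof (cases "\<exists>x\<in>A. \<beta> x \<noteq> x")
    case True then show ?thesis using red pa pb by blast
  next
    case nb: False
    show ?thesis
    proof (cases "\<exists>x\<in>A. \<alpha> x \<noteq> x")
      case True then show ?thesis using red[OF pb pa] by blast
    next
      case False then show ?thesis using nb by (auto simp: separates_def)
    qed
  qed
qed

lemma pairing_id: "pairing A (\<lambda>x. x)"
  by (simp add: pairing_def)

text \<open>A separating colouring makes \<open>\<alpha>\<close> a bijection between the moved
  points of one colour and those of the other.\<close>

lemma pairing_parity:
  assumes "finite A" "pairing A \<alpha>"
  shows "even (card A) \<longleftrightarrow> even (card {x \<in> A. \<alpha> x = x})"
proof -
  obtain \<sigma> where s: "separates A \<sigma> \<alpha>" using two_pairings_separable[OF assms assms(2)] by blast
  let ?T = "{x\<in>A. \<alpha> x \<noteq> x \<and> \<sigma> x}" and ?F = "{x\<in>A. \<alpha> x \<noteq> x \<and> \<not> \<sigma> x}"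
  have "bij_betw \<alpha> ?T ?F"
    by (rule bij_betw_byWitness[where f' = \<alpha>])
      (use s assms(2) in \<open>auto simp: separates_def pairing_def\<close>)
  then have "card ?T = card ?F" by (rule bij_betw_same_card)
  moreover have "card (?T \<union> ?F) = card ?T + card ?F"
    using assms(1) by (intro card_Un_disjoint) auto
  moreover have "card ({x \<in> A. \<alpha> x = x} \<union> (?T \<union> ?F)) = card {x \<in> A. \<alpha> x = x} + card (?T \<union> ?F)"
    using assms(1) by (intro card_Un_disjoint) auto
  moreover have "{x \<in> A. \<alpha> x = x} \<union> (?T \<union> ?F) = A" by auto
  ultimately have "card A = card {x \<in> A. \<alpha> x = x} + 2 * card ?F" by simp
  then show ?thesis by presburger
qed

text \<open>Pair off points with equal values as long as possible. This is how cliques and cycles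
  are turned into matchings.\<close>

lemma fiber_pairing:
  assumes "finite U"
  shows "\<exists>\<alpha>. pairing U \<alpha> \<and> (\<forall>x\<in>U. f (\<alpha> x) = f x) \<and> inj_on f {x\<in>U. \<alpha> x = x}"
  using assms
proof (induction "card U" arbitrary: U rule: less_induct)
  case less
  show ?case
  proof (cases "inj_on f U")
    case True
    then show ?thesis by (intro exI[of _ "\<lambda>x. x"]) (auto simp: pairing_id)
  next
    case False
    then obtain x y where xy: "x \<in> U" "y \<in> U" "f x = f y" "x \<noteq> y" by (auto simp: inj_on_def)
    let ?U = "U - {x, y}"
    have lt: "card ?U < card U" using less.prems xy by (intro psubset_card_mono) auto
    obtain \<alpha> where a: "pairing ?U \<alpha>" "\<forall>x\<in>?U. f (\<alpha> x) = f x"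
      "inj_on f {x\<in>?U. \<alpha> x = x}"
      using less.hyps[OF lt finite_Diff[OF less.prems]] by (elim exE conjE) (rule that)
    have "\<alpha> z \<in> ?U" "\<alpha> (\<alpha> z) = z" if "z \<in> ?U" for z using a(1) that by (auto simp: pairing_def)
    then have "pairing U (\<alpha>(x := y, y := x))" 
      using xy unfolding pairing_def by (simp add: Ball_def) blast
    then show ?thesis
    proof (intro exI[of _ "\<alpha>(x := y, y := x)"] conjI ballI impI)
      fix z assume "z \<in> U"
      then show "f ((\<alpha>(x := y, y := x)) z) = f z" using a(2) xy(3) by (cases "z = x"; cases "z = y") simp_all
    next
      have "{z\<in>U. (\<alpha>(x := y, y := x)) z = z} \<subseteq> {z\<in>?U. \<alpha> z = z}" using xy(4) by (auto simp: fun_upd_def split: if_splits)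
      then show "inj_on f {z\<in>U. (\<alpha>(x := y, y := x)) z = z}" using a(3) inj_on_subset by blast
    qed
  qed
qed

text \<open>The pairs inside a fibre are split evenly by \<open>\<sigma>\<close>; the
  \<open>+ 1\<close> covers the one point of the fibre that may be unpaired.\<close>

lemma separated_fiber_card:
  assumes "finite U" "pairing U \<alpha>" "separates U \<sigma> \<alpha>" "\<forall>x\<in>U. f (\<alpha> x) = f x"
    "inj_on f {x\<in>U. \<alpha> x = x}"
  shows "2 * card {x\<in>U. f x = y \<and> \<sigma> x = b} \<le> card {x\<in>U. f x = y} + 1"
proof -
  let ?T = "{x\<in>U. f x = y \<and> \<sigma> x = b}" and ?F = "{x\<in>U. f x = y}"
  have fin: "finite ?T" "finite ?F" using assms(1) by auto
  have "finite {x\<in>?T. \<alpha> x = x}" using assms(1) by auto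
  then have "card {x\<in>?T. \<alpha> x = x} \<le> 1"
    using assms(5) card_le_Suc0_iff_eq[of "{x\<in>?T. \<alpha> x = x}"] by (auto simp: inj_on_def)
  moreover have "card {x\<in>?T. \<alpha> x \<noteq> x} \<le> card (?F - ?T)"
  proof (rule card_inj_on_le[of \<alpha>])
    show "inj_on \<alpha> {x\<in>?T. \<alpha> x \<noteq> x}" 
      by (rule inj_on_inverseI[of _ \<alpha>]) (use assms(2) in \<open>simp add: pairing_def\<close>)
    show "\<alpha> ` {x\<in>?T. \<alpha> x \<noteq> x} \<subseteq> ?F - ?T" using assms(2-4) by (auto simp: pairing_def separates_def)
  qed (use fin in auto)
  moreover have "card ?T = card {x\<in>?T. \<alpha> x = x} + card {x\<in>?T. \<alpha> x \<noteq> x}"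
  proof -
    have "card ({x\<in>?T. \<alpha> x = x} \<union> {x\<in>?T. \<alpha> x \<noteq> x}) = card {x\<in>?T. \<alpha> x = x} + card {x\<in>?T. \<alpha> x \<noteq> x}"
      using assms(1) by (intro card_Un_disjoint) auto
    moreover have "{x\<in>?T. \<alpha> x = x} \<union> {x\<in>?T. \<alpha> x \<noteq> x} = ?T" by blast
    ultimately show ?thesis by (simp only:)
  qed
  moreover have "card (?F - ?T) = card ?F - card ?T" using fin by (intro card_Diff_subset) auto
  moreover have "card ?T \<le> card ?F" using fin by (intro card_mono) auto
  ultimately show ?thesis by linarith
qed

lemma halving:
  fixes U :: "'a set"
  assumes "finite U"
  shows "\<exists>\<sigma> :: 'a \<Rightarrow> bool. \<forall>b. (\<forall>y. 2 * card {x\<in>U. f x = y \<and> \<sigma> x = b} \<le> card {x\<in>U. f x = y} + 1)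
           \<and> (\<forall>y. 2 * card {x\<in>U. g x = y \<and> \<sigma> x = b} \<le> card {x\<in>U. g x = y} + 1)"
proof -
  obtain \<alpha> where a: "pairing U \<alpha>" "\<forall>x\<in>U. f (\<alpha> x) = f x"
      "inj_on f {x\<in>U. \<alpha> x = x}"
    using fiber_pairing[OF assms, of f] by blast
  obtain \<beta> where b: "pairing U \<beta>" "\<forall>x\<in>U. g (\<beta> x) = g x"
      "inj_on g {x\<in>U. \<beta> x = x}"
    using fiber_pairing[OF assms, of g] by blast
  obtain \<sigma> where s: "separates U \<sigma> \<alpha>" "separates U \<sigma> \<beta>"
    using two_pairings_separable[OF assms a(1) b(1)] by blast
  show ?thesis
    by (intro exI[of _ \<sigma>] allI conjI separated_fiber_card[OF assms a(1) s(1) a(2,3)]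
        separated_fiber_card[OF assms b(1) s(2) b(2,3)])
qed

text \<open>The second halving is applied to the parts left by the first, hence the values
  \<open>(f x, \<sigma> x)\<close>. Rounding is harmless: \<open>2 * n \<le> 4 + 1\<close> leaves at
  most 2 points of a part, and then \<open>2 * n \<le> 2 + 1\<close> at most 1.\<close>

lemma common_four_colouring:
  fixes U :: "'a set"
  assumes fin: "finite U" and "\<And>y. card {x\<in>U. f x = y} \<le> 4" and "\<And>y. card {x\<in>U. g x = y} \<le> 4"
  shows "\<exists>\<kappa> :: 'a \<Rightarrow> nat. (\<forall>x. \<kappa> x < 4) \<and>
           (\<forall>x\<in>U. \<forall>y\<in>U. x \<noteq> y \<longrightarrow> f x = f y \<or> g x = g y \<longrightarrow> \<kappa> x \<noteq> \<kappa> y)"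
proof -
  obtain \<sigma> :: "'a \<Rightarrow> bool" where "\<forall>b. (\<forall>y. 2 * card {x\<in>U. f x = y \<and> \<sigma> x = b} \<le> card {x\<in>U. f x = y} + 1)
      \<and> (\<forall>z. 2 * card {x\<in>U. g x = z \<and> \<sigma> x = b} \<le> card {x\<in>U. g x = z} + 1)"
    using halving[OF fin, of f g] by (elim exE)
  note s = this[rule_format, THEN conjunct1, rule_format] this[rule_format, THEN conjunct2, rule_format]
  obtain \<tau> :: "'a \<Rightarrow> bool" where
    "\<forall>b. (\<forall>y. 2 * card {x\<in>U. (f x, \<sigma> x) = y \<and> \<tau> x = b} \<le> card {x\<in>U. (f x, \<sigma> x) = y} + 1)
      \<and> (\<forall>z. 2 * card {x\<in>U. (g x, \<sigma> x) = z \<and> \<tau> x = b} \<le> card {x\<in>U. (g x, \<sigma> x) = z} + 1)"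
    using halving[OF fin, of "\<lambda>x. (f x, \<sigma> x)" "\<lambda>x. (g x, \<sigma> x)"] by (elim exE)
  note t = this[rule_format, THEN conjunct1, rule_format] this[rule_format, THEN conjunct2, rule_format]
  have one: "card {x\<in>U. f x = y \<and> \<sigma> x = b \<and> \<tau> x = b'} \<le> 1" for y b b'
  proof -
    have "2 * card {x\<in>U. f x = y \<and> \<sigma> x = b \<and> \<tau> x = b'} \<le> card {x\<in>U. f x = y \<and> \<sigma> x = b} + 1"
      using t(1)[of "(y, b)" b'] by (simp add: conj_assoc)
    moreover have "2 * card {x\<in>U. f x = y \<and> \<sigma> x = b} \<le> 4 + 1"
      using s(1)[of y b] assms(2)[of y] by linarith
    ultimately show ?thesis by linarith
  qed
  have two: "card {x\<in>U. g x = y \<and> \<sigma> x = b \<and> \<tau> x = b'} \<le> 1" for y b b'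
  proof -
    have "2 * card {x\<in>U. g x = y \<and> \<sigma> x = b \<and> \<tau> x = b'} \<le> card {x\<in>U. g x = y \<and> \<sigma> x = b} + 1"
      using t(2)[of "(y, b)" b'] by (simp add: conj_assoc)
    moreover have "2 * card {x\<in>U. g x = y \<and> \<sigma> x = b} \<le> 4 + 1"
      using s(2)[of y b] assms(3)[of y] by linarith
    ultimately show ?thesis by linarith
  qed
  have eq: "x = y" if xy: "x \<in> U" "y \<in> U" and fg: "f x = f y \<or> g x = g y" and st: "\<sigma> x = \<sigma> y" "\<tau> x = \<tau> y" for x y
    using fg
  proof
    assume "f x = f y"
    then have "{x, y} \<subseteq> {z\<in>U. f z = f y \<and> \<sigma> z = \<sigma> y \<and> \<tau> z = \<tau> y}" using xy st by auto
    then have "card {x, y} \<le> card {z\<in>U. f z = f y \<and> \<sigma> z = \<sigma> y \<and> \<tau> z = \<tau> y}"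
      using fin by (intro card_mono) auto
    then have "card {x, y} \<le> 1" using one[of "f y" "\<sigma> y" "\<tau> y"] by linarith
    then show ?thesis by (cases "x = y") auto
  next
    assume "g x = g y"
    then have "{x, y} \<subseteq> {z\<in>U. g z = g y \<and> \<sigma> z = \<sigma> y \<and> \<tau> z = \<tau> y}" using xy st by auto
    then have "card {x, y} \<le> card {z\<in>U. g z = g y \<and> \<sigma> z = \<sigma> y \<and> \<tau> z = \<tau> y}"
      using fin by (intro card_mono) auto
    then have "card {x, y} \<le> 1" using two[of "g y" "\<sigma> y" "\<tau> y"] by linarith
    then show ?thesis by (cases "x = y") auto
  qed
  show ?thesis
  proof (intro exI[of _ "\<lambda>x. (if \<sigma> x then 2 else 0) + (if \<tau> x then 1 else 0)"] conjI ballI allI impI)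
    fix x y assume "x \<in> U" "y \<in> U" "x \<noteq> y" "f x = f y \<or> g x = g y"
    then have "\<not> (\<sigma> x = \<sigma> y \<and> \<tau> x = \<tau> y)" using eq by blast
    then show "(if \<sigma> x then 2 else 0) + (if \<tau> x then 1 else 0) \<noteq> (if \<sigma> y then 2 else 0) + (if \<tau> y then 1 else (0::nat))" by auto
  qed simp
qed

section \<open>Orienting graphs of maximum degree two\<close>

text \<open>In cycle notation, \<open>v\<close> is written directly after \<open>a\<close>;
  composing with a transposition does this.\<close>

lemma permutes_insert_after:
  assumes s: "s permutes V" and v: "v \<notin> V" and a: "a \<in> V"
  shows "s(a := v, v := s a) permutes insert v V"
proof -
  have "s(a := v, v := s a) = s \<circ> transpose a v"
    using permutes_not_in[OF s v] by (auto simp: fun_eq_iff transpose_def)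
  moreover have "transpose a v permutes insert v V" using a by (intro permutes_swap_id) auto
  moreover have "s permutes insert v V" using s by (rule permutes_subset) auto
  ultimately show ?thesis using permutes_compose by metis
qed

text \<open>Only one implication is asked for, so \<open>s\<close> may have links that are no edges;
  a path, for instance, is closed up. This freedom lets a removed vertex be spliced back in.\<close>

lemma degree_two_permutation:
  assumes "finite V" "\<And>u v. E u v \<Longrightarrow> E v u" "\<And>v. \<not> E v v" "\<And>v. v \<in> V \<Longrightarrow> card {u\<in>V. E v u} \<le> 2"
  shows "\<exists>s. s permutes V \<and> (\<forall>u\<in>V. \<forall>v\<in>V. E u v \<longrightarrow> v = s u \<or> u = s v)"
  using assms
proof (induction "card V" arbitrary: V E rule: less_induct)
  case less
  note fin = less.prems(1) and sym = less.prems(2) and irr = less.prems(3) and deg = less.prems(4)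
  show ?case
  proof (cases "V = {}")
    case True then show ?thesis by (auto intro: permutes_id)
  next
    case False
    then obtain v where v: "v \<in> V" by blast
    let ?V = "V - {v}"
    have fin': "finite ?V" and V: "insert v ?V = V" and lt: "card ?V < card V"
      using fin v card_Diff1_less[OF fin v] by auto
    have mono: "card {w\<in>W. E u w} \<le> card {w\<in>V. E u w}" if "W \<subseteq> V" for u W
      using fin that by (intro card_mono) auto
    have sub: "\<exists>s. s permutes W \<and> (\<forall>u\<in>W. \<forall>w\<in>W. E u w \<longrightarrow> w = s u \<or> u = s w)" if "W \<subset> V" for W
    proof (rule less.hyps)
      show "card W < card V" using fin that by (rule psubset_card_mono)
      show "finite W" using fin that by (meson finite_subset psubset_imp_subset)
      show "card {w\<in>W. E u w} \<le> 2" if "u \<in> W" for u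
      proof -
        have "u \<in> V" "W \<subseteq> V" using \<open>W \<subset> V\<close> that by auto
        then show ?thesis using mono[of W u] deg[of u] by linarith
      qed
    qed (use sym irr in auto)
    define N where "N = {u\<in>V. E v u}"
    have N: "card N \<le> 2" "finite N" "v \<notin> N" using deg[OF v] fin irr by (auto simp: N_def)
    \<comment> \<open>Splicing \<open>v\<close> in destroys the link from \<open>a\<close> to
      \<open>s a\<close>, so every old edge needs a witness other than this link.\<close>
    have insert_after: "\<exists>s. s permutes V \<and> (\<forall>u\<in>V. \<forall>w\<in>V. E u w \<longrightarrow> w = s u \<or> u = s w)"
      if s: "s permutes ?V" and a: "a \<in> ?V" and N': "N \<subseteq> {a, s a}"
        and E: "\<And>u w. u \<in> ?V \<Longrightarrow> w \<in> ?V \<Longrightarrow> E u w \<Longrightarrow> (w = s u \<and> u \<noteq> a) \<or> (u = s w \<and> w \<noteq> a)" for s a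
    proof (intro exI conjI ballI impI)
      let ?s = "s(a := v, v := s a)"
      show "?s permutes V" using permutes_insert_after[OF s _ a, of v] V by simp
      fix u w assume uw: "u \<in> V" "w \<in> V" "E u w"
      consider "u = v" "w \<in> N" | "w = v" "u \<in> N" | "u \<in> ?V" "w \<in> ?V"
        using uw sym irr by (auto simp: N_def)
      then show "w = ?s u \<or> u = ?s w"
      proof cases
        case 3 then show ?thesis using E[of u w] uw by auto
      qed (use N' a in auto)
    qed
    consider (zero) "N = {}" | (one) a where "N = {a}" | (two) a b where "N = {a, b}" "a \<noteq> b"
    proof -
      have "card N = 0 \<or> card N = 1 \<or> card N = 2" using N(1) by linarith
      then show ?thesis using N(2) zero one two by (auto simp: card_1_singleton_iff card_2_iff)
    qed
    then show ?thesis
    proof cases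
      case zero
      obtain s where s: "s permutes ?V" "\<forall>u\<in>?V. \<forall>w\<in>?V. E u w \<longrightarrow> w = s u \<or> u = s w"
        using sub[of ?V] v by blast
      have "\<not> E v w" "\<not> E w v" if "w \<in> V" for w using zero sym that by (auto simp: N_def)
      then have "\<forall>u\<in>V. \<forall>w\<in>V. E u w \<longrightarrow> w = s u \<or> u = s w" using s(2) by blast
      moreover have "s permutes V" using s(1) by (rule permutes_subset) auto
      ultimately show ?thesis by blast
    next
      case (one a)
      then have a: "a \<in> ?V" "E v a" using N by (auto simp: N_def)
      obtain s where s: "s permutes ?V" "\<forall>u\<in>?V. \<forall>w\<in>?V. E u w \<longrightarrow> w = s u \<or> u = s w"
        using sub[of ?V] v by blast
      \<comment> \<open>\<open>a\<close> has at most one further neighbour, so one of the two links of \<open>s\<close> at \<open>a\<close> can be cut.\<close>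
      have "card {w\<in>?V. E a w} \<le> 1"
      proof -
        have "{w\<in>V. E a w} = insert v {w\<in>?V. E a w}" using v a sym by auto
        then show ?thesis using deg[of a] a fin by simp
      qed
      then have uniq: "w = w'" if "w \<in> ?V" "w' \<in> ?V" "E a w" "E a w'" for w w'
        using that fin by (auto simp: card_le_Suc0_iff_eq)
      define p where "p = inv s a"
      have p: "s p = a" "p \<in> ?V" using s(1) a by (auto simp: p_def permutes_inverses permutes_in_image[OF permutes_inv[OF s(1)]] simp del: Diff_iff)
      have sa: "s a \<in> ?V" using permutes_in_image[OF s(1)] a by blast
      have inj: "s x = s y \<longleftrightarrow> x = y" for x y using permutes_inj[OF s(1)] by (auto simp: inj_eq)
      show ?thesis
      \<comment> \<open>If \<open>s a = p\<close>, an edge between \<open>a\<close> and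
        \<open>p\<close> is still witnessed by \<open>s p = a\<close> after the link out of
        \<open>a\<close> is cut. So the link into \<open>a\<close> has to be cut only if
        \<open>s a\<close> is a neighbour of \<open>a\<close> different from
        \<open>p\<close>.\<close>
      proof (cases "E a (s a) \<and> s a \<noteq> p")
        case False
        show ?thesis
        proof (rule insert_after[OF s(1) a(1)])
          show "N \<subseteq> {a, s a}" using one by simp
          fix u w assume uw: "u \<in> ?V" "w \<in> ?V" "E u w"
          have "E w u" using sym uw by blast
          have "w = s u \<or> u = s w" using s(2) uw by blast
          then show "(w = s u \<and> u \<noteq> a) \<or> (u = s w \<and> w \<noteq> a)"
          proof
            assume w: "w = s u"
            show ?thesis
            proof (cases "u = a")
              case True
              then have "w = p" using False uw w by auto
              then have "u = s w" using True p by simp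
              moreover have "w \<noteq> a" using irr uw True by auto
              ultimately show ?thesis by blast
            qed (use w in blast)
          next
            assume u: "u = s w"
            show ?thesis
            proof (cases "w = a")
              case True
              then have "u = p" using False \<open>E w u\<close> u by auto
              then have "w = s u" using True p by simp
              moreover have "u \<noteq> a" using irr uw True by auto
              ultimately show ?thesis by blast
            qed (use u in blast)
          qed
        qed
      next
        case True
        have np: "\<not> E a p" using uniq[OF p(2) sa] True by blast
        show ?thesis
        proof (rule insert_after[OF s(1) p(2)])
          show "N \<subseteq> {p, s p}" using one p by simp
          fix u w assume uw: "u \<in> ?V" "w \<in> ?V" "E u w"
          have "E w u" using sym uw by blast
          have "w = s u \<or> u = s w" using s(2) uw by blast
          then show "(w = s u \<and> u \<noteq> p) \<or> (u = s w \<and> w \<noteq> p)"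
            using np p \<open>E w u\<close> uw(3) by auto
        qed
      qed
    next
      case (two a b)
      have ab: "a \<in> ?V" "b \<in> ?V" "E v a" "E v b" "E a v" "E b v" using two N sym by (auto simp: N_def)
      show ?thesis
      proof (cases "E a b")
        case True
        let ?W = "V - {v, a, b}"
        obtain s where s: "s permutes ?W" "\<forall>u\<in>?W. \<forall>w\<in>?W. E u w \<longrightarrow> w = s u \<or> u = s w"
          using sub[of ?W] v by blast
        \<comment> \<open>Each of the three points already has two neighbours among the others, so
          they form a whole component, a triangle.\<close>
        have closed: "w \<in> {v, a, b}" if "u \<in> {v, a, b}" "w \<in> V" "E u w" for u w
        proof -
          have eq: "{w\<in>V. E x w} = {y, z}" if "x \<in> V" "y \<in> V" "z \<in> V" "E x y" "E x z" "y \<noteq> z" for x y z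
            using that fin deg[OF that(1)] by (intro card_seteq[symmetric]) auto
          have "{w\<in>V. E v w} = {a, b}" by (rule eq[OF v _ _ ab(3,4) two(2)]) (use ab in auto)
          moreover have "{w\<in>V. E a w} = {v, b}" by (rule eq[OF _ v _ ab(5) True]) (use ab in auto)
          moreover have "{w\<in>V. E b w} = {v, a}" by (rule eq[OF _ v _ ab(6) sym[OF True]]) (use ab in auto)
          ultimately show ?thesis using that by blast
        qed
        \<comment> \<open>Two insertions turn the fixed point \<open>v\<close> into the 3-cycle
          \<open>v\<close>, \<open>a\<close>, \<open>b\<close>.\<close>
        have "s permutes insert v ?W" using s(1) by (rule permutes_subset) auto
        from permutes_insert_after[OF this, of a v] have 1: "s(v := a, a := v) permutes insert a (insert v ?W)"
          using permutes_not_in[OF s(1), of v] ab by auto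
        from permutes_insert_after[OF this, of b a] have 2: "(s(v := a, a := v))(a := b, b := v) permutes insert b (insert a (insert v ?W))"
          using two ab by auto
        have 3: "insert b (insert a (insert v ?W)) = V" using ab v by auto
        have 4: "(s(v := a, a := v))(a := b, b := v) = s(v := a, a := b, b := v)" by auto
        have "w = (s(v := a, a := b, b := v)) u \<or> u = (s(v := a, a := b, b := v)) w" if uw: "u \<in> V" "w \<in> V" "E u w" for u w
        proof (cases "u \<in> {v, a, b}")
          case True
          then have "w \<in> {v, a, b}" "u \<noteq> w" using closed uw irr by auto
          then show ?thesis using True two ab by auto
        next
          case False
          moreover have "w \<notin> {v, a, b}" using closed[of w u] sym uw False by blast
          ultimately show ?thesis using s(2) uw by auto
        qed
        then show ?thesis using 2 unfolding 3 4 by blast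
      next
        case nE: False
        \<comment> \<open>Contract the path \<open>a\<close>, \<open>v\<close>, \<open>b\<close> to an edge.\<close>
        define E' where "E' u w \<longleftrightarrow> E u w \<or> (u = a \<and> w = b) \<or> (u = b \<and> w = a)" for u w
        have "\<exists>s. s permutes ?V \<and> (\<forall>u\<in>?V. \<forall>w\<in>?V. E' u w \<longrightarrow> w = s u \<or> u = s w)"
        proof (rule less.hyps[OF lt fin'])
          show "E' u w \<Longrightarrow> E' w u" for u w using sym by (auto simp: E'_def)
          show "\<not> E' u u" for u using irr two by (auto simp: E'_def)
          fix u assume u: "u \<in> ?V"
          show "card {w\<in>?V. E' u w} \<le> 2"
          proof (cases "u = a \<or> u = b")
            case False
            then have "{w\<in>?V. E' u w} \<subseteq> {w\<in>V. E u w}" by (auto simp: E'_def)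
            then have "card {w\<in>?V. E' u w} \<le> card {w\<in>V. E u w}" using fin by (intro card_mono) auto
            then show ?thesis using deg[of u] u by simp
          next
            case True
            define b' where "b' = (if u = a then b else a)"
            have "{w\<in>?V. E' u w} \<subseteq> insert b' ({w\<in>V. E u w} - {v})" using True two by (auto simp: E'_def b'_def)
            then have "card {w\<in>?V. E' u w} \<le> card (insert b' ({w\<in>V. E u w} - {v}))" using fin by (intro card_mono) auto
            also have "\<dots> \<le> Suc (card ({w\<in>V. E u w} - {v}))" by (rule card_insert_le_m1) auto
            also have "card ({w\<in>V. E u w} - {v}) = card {w\<in>V. E u w} - 1"
              using True ab v by (intro card_Diff_singleton) auto
            finally show ?thesis using deg[of u] u by simp
          qed
        qed
        then obtain s where s: "s permutes ?V" "\<forall>u\<in>?V. \<forall>w\<in>?V. E' u w \<longrightarrow> w = s u \<or> u = s w" by blast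
        have E: "w = s u \<or> u = s w" if "u \<in> ?V" "w \<in> ?V" "E u w" for u w using s(2) that by (auto simp: E'_def)
        have "b = s a \<or> a = s b" using s(2) ab by (auto simp: E'_def)
        then show ?thesis
        proof
          assume b: "b = s a"
          show ?thesis
          proof (rule insert_after[OF s(1) ab(1)])
            show "N \<subseteq> {a, s a}" using two b by auto
            fix u w assume uw: "u \<in> ?V" "w \<in> ?V" "E u w"
            have "\<not> E b a" using nE sym by blast
            then show "(w = s u \<and> u \<noteq> a) \<or> (u = s w \<and> w \<noteq> a)"
              using E[OF uw] uw(3) nE b by auto
          qed
        next
          assume a: "a = s b"
          show ?thesis
          proof (rule insert_after[OF s(1) ab(2)])
            show "N \<subseteq> {b, s b}" using two a by auto
            fix u w assume uw: "u \<in> ?V" "w \<in> ?V" "E u w"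
            have "\<not> E b a" using nE sym by blast
            then show "(w = s u \<and> u \<noteq> b) \<or> (u = s w \<and> w \<noteq> b)"
              using E[OF uw] uw(3) nE a by auto
          qed
        qed
      qed
    qed
  qed
qed

section \<open>A path plus disjoint triangles is 3-colourable\<close>

declare add_bit_eq_xor [simp del] mult_bit_eq_and [simp del]

lemma bit_double [simp]: "x + x = (0 :: bit)"
  by (cases x) (auto simp: add_bit_eq_xor)

lemma bit_mult_idem [simp]: "x * x = (x :: bit)"
  by (cases x) auto

lemma sum_bit_involution:
  fixes F :: "'a \<Rightarrow> bit"
  assumes "finite S" "\<And>x. x \<in> S \<Longrightarrow> \<iota> x \<in> S" "\<And>x. x \<in> S \<Longrightarrow> \<iota> (\<iota> x) = x" "\<And>x. x \<in> S \<Longrightarrow> F (\<iota> x) = F x"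
  shows "sum F S = sum F {x\<in>S. \<iota> x = x}"
  using assms
proof (induction "card S" arbitrary: S rule: less_induct)
  case less
  show ?case
  proof (cases "\<exists>x\<in>S. \<iota> x \<noteq> x")
    case True
    then obtain x where x: "x \<in> S" "\<iota> x \<noteq> x" by blast
    let ?S = "S - {x, \<iota> x}"
    have lt: "card ?S < card S" using less.prems(1) x by (intro psubset_card_mono) auto
    have cl: "\<iota> z \<in> ?S" if "z \<in> ?S" for z
      using that less.prems(2,3) x by (metis Diff_iff insertE insertI1 insertI2 singletonD)
    have "sum F ?S = sum F {x\<in>?S. \<iota> x = x}"
      using less.hyps[OF lt] less.prems cl by simp
    moreover have "{x\<in>?S. \<iota> x = x} = {x\<in>S. \<iota> x = x}" using x less.prems(3) by auto
    moreover have "sum F S = sum F ?S + sum F {x, \<iota> x}"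
      using less.prems(1,2) x by (intro sum.subset_diff) auto
    moreover have "sum F {x, \<iota> x} = 0" using x less.prems(4) by simp
    ultimately show ?thesis by simp
  next
    case False
    then have "{x\<in>S. \<iota> x = x} = S" by auto
    then show ?thesis by simp
  qed
qed

lemma sum_PiE_split:
  assumes "finite L" "y \<in> L" "\<And>x. x \<in> L \<Longrightarrow> finite (B x)"
  shows "sum F (PiE L B) = (\<Sum>M\<in>PiE (L - {y}) B. \<Sum>i\<in>B y. F (M(y := i)))"
proof -
  have "PiE L B = (\<lambda>(i, M). M(y := i)) ` (B y \<times> PiE (L - {y}) B)"
    using PiE_insert_eq[of y "L - {y}" B] assms(2) by (simp add: insert_absorb)
  moreover have "inj_on (\<lambda>(i, M). M(y := i)) (B y \<times> PiE (L - {y}) B)"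
    by (rule inj_combinator) auto
  ultimately have "sum F (PiE L B) = (\<Sum>(i, M)\<in>B y \<times> PiE (L - {y}) B. F (M(y := i)))"
    by (simp add: sum.reindex case_prod_unfold comp_def)
  also have "\<dots> = (\<Sum>i\<in>B y. \<Sum>M\<in>PiE (L - {y}) B. F (M(y := i)))"
    by (simp add: sum.cartesian_product)
  also have "\<dots> = (\<Sum>M\<in>PiE (L - {y}) B. \<Sum>i\<in>B y. F (M(y := i)))"
    by (rule sum.swap)
  finally show ?thesis .
qed

text \<open>Expand the product into a sum over maps \<open>h : L \<rightarrow> L\<close>, where \<open>h y = y\<close> selects the summand 1.
  A map that is not surjective or has a 2-cycle contributes 0 because of the vanishing sums, and
  by symmetry \<open>h\<close> and its inverse contribute the same, so only the identity remains.\<close>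

lemma transversal_parity:
  fixes k :: "'b \<Rightarrow> 'b \<Rightarrow> nat \<Rightarrow> nat \<Rightarrow> bit"
  assumes fin: "finite L"
    and sym: "\<And>y z i j. y \<in> L \<Longrightarrow> z \<in> L \<Longrightarrow> y \<noteq> z \<Longrightarrow> i < 3 \<Longrightarrow> j < 3 \<Longrightarrow> k y z i j = k z y j i"
    and zero: "\<And>y z j. y \<in> L \<Longrightarrow> z \<in> L \<Longrightarrow> y \<noteq> z \<Longrightarrow> j < 3 \<Longrightarrow> (\<Sum>i<3. k y z i j) = 0"
  shows "(\<Sum>M\<in>PiE L (\<lambda>_. {..<3}). \<Prod>y\<in>L. (1 + (\<Sum>z\<in>L - {y}. k y z (M y) (M z)))) = 1"
proof -
  define K where "K y z i j = (if y = z then 1 else k y z i j)" for y z i j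
  have Ksym: "K y z i j = K z y j i" if "y \<in> L" "z \<in> L" "i < 3" "j < 3" for y z i j
    using sym that by (simp add: K_def)
  define \<Phi> where "\<Phi> h = (\<Sum>M\<in>PiE L (\<lambda>_. {..<3}). \<Prod>y\<in>L. K y (h y) (M y) (M (h y)))" for h
  have vanish: "\<Phi> h = 0" if y0: "y0 \<in> L"
    and *: "\<And>M. M \<in> PiE (L - {y0}) (\<lambda>_. {..<3}) \<Longrightarrow>
          (\<Sum>i<3. \<Prod>y\<in>L. K y (h y) ((M(y0 := i)) y) ((M(y0 := i)) (h y))) = 0" for h y0
    unfolding \<Phi>_def by (subst sum_PiE_split[OF fin y0]) (use * in \<open>auto intro!: sum.neutral\<close>)
  \<comment> \<open>A factor \<open>K y (h y)\<close> contains \<open>M y0\<close> only if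
    \<open>y = y0\<close> or \<open>h y = y0\<close>, and the latter never happens here. Summing
    over \<open>M y0\<close> therefore affects a single factor and gives 0.\<close>
  have nonsurj: "\<Phi> h = 0" if h: "h \<in> PiE L (\<lambda>_. L)" and ns: "y0 \<in> L" "y0 \<notin> h ` L" for h y0
  proof (rule vanish[OF ns(1)])
    fix M assume M: "M \<in> PiE (L - {y0}) (\<lambda>_. {..<3::nat})"
    have hy: "h y0 \<in> L" using h ns by auto
    have hy0: "h y0 \<noteq> y0" using ns by (metis imageI)
    note hy = hy hy0
    have "(\<Prod>y\<in>L. K y (h y) ((M(y0 := i)) y) ((M(y0 := i)) (h y))) =
        K y0 (h y0) i (M (h y0)) * (\<Prod>y\<in>L - {y0}. K y (h y) (M y) (M (h y)))" for i
    proof -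
      have "(\<Prod>y\<in>L - {y0}. K y (h y) ((M(y0 := i)) y) ((M(y0 := i)) (h y))) = (\<Prod>y\<in>L - {y0}. K y (h y) (M y) (M (h y)))"
        using ns by (intro prod.cong) auto
      then show ?thesis using hy by (simp add: prod.remove[OF fin ns(1)])
    qed
    moreover have "(\<Sum>i<3. K y0 (h y0) i (M (h y0))) = 0"
      using zero[OF ns(1) hy(1), of "M (h y0)"] hy M by (auto simp: K_def PiE_def Pi_def)
    ultimately show "(\<Sum>i<3. \<Prod>y\<in>L. K y (h y) ((M(y0 := i)) y) ((M(y0 := i)) (h y))) = 0"
      by (simp add: sum_distrib_right[symmetric])
  qed
  \<comment> \<open>\<open>M y0\<close> occurs in two factors, those of \<open>y0\<close> and of
    \<open>h y0\<close>. They are equal by symmetry, and in the two-element field every element is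
    its own square, so they merge into one factor, whose sum vanishes.\<close>
  have twocycle: "\<Phi> h = 0" if h: "h \<in> PiE L (\<lambda>_. L)" and inj: "inj_on h L"
    and y0: "y0 \<in> L" "h y0 \<noteq> y0" "h (h y0) = y0" for h y0
  proof (rule vanish[OF y0(1)])
    fix M assume M: "M \<in> PiE (L - {y0}) (\<lambda>_. {..<3::nat})"
    define y1 where "y1 = h y0"
    have y1: "y1 \<in> L" "y1 \<noteq> y0" "h y1 = y0" using h y0 by (auto simp: y1_def)
    have "(\<Prod>y\<in>L. K y (h y) ((M(y0 := i)) y) ((M(y0 := i)) (h y))) =
        K y0 y1 i (M y1) * (\<Prod>y\<in>L - {y0} - {y1}. K y (h y) (M y) (M (h y)))" if "i < 3" for i
    proof -
      have "(\<Prod>y\<in>L - {y0} - {y1}. K y (h y) ((M(y0 := i)) y) ((M(y0 := i)) (h y))) =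
            (\<Prod>y\<in>L - {y0} - {y1}. K y (h y) (M y) (M (h y)))"
      proof (intro prod.cong refl)
        fix y assume "y \<in> L - {y0} - {y1}"
        then have "h y \<noteq> y0" using inj y1 unfolding inj_on_def by auto
        then show "K y (h y) ((M(y0 := i)) y) ((M(y0 := i)) (h y)) = K y (h y) (M y) (M (h y))"
          using \<open>y \<in> L - {y0} - {y1}\<close> by auto
      qed
      moreover have "K y1 y0 (M y1) i = K y0 y1 i (M y1)"
        using Ksym y0 y1 M that by (auto simp: PiE_def Pi_def)
      moreover have "y1 \<in> L - {y0}" "finite (L - {y0})" using y1 fin by auto
      ultimately show ?thesis using y1
        by (simp add: prod.remove[OF fin y0(1)] prod.remove[of "L - {y0}" y1] y1_def[symmetric] mult.assoc[symmetric])
    qed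
    moreover have "(\<Sum>i<3. K y0 y1 i (M y1)) = 0"
      using zero[OF y0(1) y1(1), of "M y1"] y1 M by (auto simp: K_def PiE_def Pi_def)
    ultimately show "(\<Sum>i<3. \<Prod>y\<in>L. K y (h y) ((M(y0 := i)) y) ((M(y0 := i)) (h y))) = 0"
      by (simp add: sum_distrib_right[symmetric])
  qed
  define Q where "Q = {h \<in> PiE L (\<lambda>_. L). h ` L = L}"
  have finQ: "finite (PiE L (\<lambda>_. L))" using fin by (intro finite_PiE) auto
  define \<iota> where "\<iota> h = restrict (inv_into L h) L" for h :: "'b \<Rightarrow> 'b"
  have Qinj: "inj_on h L" if "h \<in> Q" for h using that fin by (auto simp: Q_def intro: eq_card_imp_inj_on)
  have \<iota>1: "\<iota> h y \<in> L" "h (\<iota> h y) = y" "\<iota> h (h y) = y" "h y \<in> L" if "h \<in> Q" "y \<in> L" for h y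
    using that Qinj[OF that(1)] by (auto simp: Q_def \<iota>_def inv_into_into f_inv_into_f)
  have \<iota>Q: "\<iota> h \<in> Q" if "h \<in> Q" for h
  proof -
    have "\<iota> h \<in> PiE L (\<lambda>_. L)" using \<iota>1[OF that] by (auto simp: \<iota>_def)
    moreover have "y \<in> \<iota> h ` L" if "y \<in> L" for y using \<iota>1[OF \<open>h \<in> Q\<close> that] by (metis imageI)
    ultimately show ?thesis by (auto simp: Q_def)
  qed
  have \<iota>\<iota>: "\<iota> (\<iota> h) = h" if "h \<in> Q" for h
  proof (rule PiE_ext)
    show "\<iota> (\<iota> h) \<in> PiE L (\<lambda>_. L)" "h \<in> PiE L (\<lambda>_. L)" using \<iota>Q that by (auto simp: Q_def)
    show "\<iota> (\<iota> h) y = h y" if "y \<in> L" for y using \<iota>1 \<iota>Q that \<open>h \<in> Q\<close> by metis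
  qed
  have \<Phi>\<iota>: "\<Phi> (\<iota> h) = \<Phi> h" if "h \<in> Q" for h
    unfolding \<Phi>_def
  proof (intro sum.cong refl)
    fix M assume M: "M \<in> PiE L (\<lambda>_. {..<3::nat})"
    have "(\<Prod>y\<in>L. K y (h y) (M y) (M (h y))) = (\<Prod>y\<in>L. K (h y) y (M (h y)) (M y))"
      using \<iota>1[OF that] M by (intro prod.cong refl Ksym) (auto simp: PiE_def Pi_def)
    also have "\<dots> = (\<Prod>z\<in>h ` L. K z (\<iota> h z) (M z) (M (\<iota> h z)))"
      using \<iota>1[OF that] by (subst prod.reindex[OF Qinj[OF that]]) (auto intro!: prod.cong)
    finally show "(\<Prod>y\<in>L. K y (\<iota> h y) (M y) (M (\<iota> h y))) = (\<Prod>y\<in>L. K y (h y) (M y) (M (h y)))"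
      using that by (simp add: Q_def)
  qed
  have idQ: "restrict id L \<in> Q" by (auto simp: Q_def)
  have "(\<Sum>M\<in>PiE L (\<lambda>_. {..<3}). \<Prod>y\<in>L. (1 + (\<Sum>z\<in>L - {y}. k y z (M y) (M z))))
      = (\<Sum>M\<in>PiE L (\<lambda>_. {..<3}). \<Prod>y\<in>L. \<Sum>z\<in>L. K y z (M y) (M z))"
  proof (intro sum.cong prod.cong refl)
    fix M y assume y: "y \<in> L"
    have "(\<Sum>z\<in>L - {y}. K y z (M y) (M z)) = (\<Sum>z\<in>L - {y}. k y z (M y) (M z))"
      by (intro sum.cong) (auto simp: K_def)
    then show "1 + (\<Sum>z\<in>L - {y}. k y z (M y) (M z)) = (\<Sum>z\<in>L. K y z (M y) (M z))"
      using sum.remove[OF fin y, of "\<lambda>z. K y z (M y) (M z)"] by (simp add: K_def)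
  qed
  also have "\<dots> = (\<Sum>M\<in>PiE L (\<lambda>_. {..<3}). \<Sum>h\<in>PiE L (\<lambda>_. L). \<Prod>y\<in>L. K y (h y) (M y) (M (h y)))"
    using fin by (intro sum.cong refl prod_sum_PiE) auto
  also have "\<dots> = (\<Sum>h\<in>PiE L (\<lambda>_. L). \<Phi> h)"
    unfolding \<Phi>_def by (rule sum.swap)
  also have "\<dots> = (\<Sum>h\<in>Q. \<Phi> h)"
    using finQ nonsurj by (intro sum.mono_neutral_right) (auto simp: Q_def PiE_def Pi_def)
  also have "\<dots> = (\<Sum>h\<in>{h\<in>Q. \<iota> h = h}. \<Phi> h)"
    using finQ by (intro sum_bit_involution \<iota>Q \<iota>\<iota> \<Phi>\<iota>) (auto simp: Q_def)
  also have "\<dots> = (\<Sum>h\<in>{restrict id L}. \<Phi> h)"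
  proof (intro sum.mono_neutral_right ballI)
    show "finite {h\<in>Q. \<iota> h = h}" using finQ by (auto simp: Q_def)
    have "\<iota> (restrict id L) = restrict id L"
      using \<iota>1[OF idQ] by (intro PiE_ext[of _ L "\<lambda>_. L"]) (use \<iota>Q[OF idQ] in \<open>auto simp: Q_def\<close>)
    then show "{restrict id L} \<subseteq> {h\<in>Q. \<iota> h = h}" using idQ by auto
    fix h assume h: "h \<in> {h\<in>Q. \<iota> h = h} - {restrict id L}"
    have "\<exists>y0\<in>L. h y0 \<noteq> y0"
    proof (rule ccontr)
      assume "\<not> ?thesis"
      then have "h = restrict id L" using h by (intro PiE_ext[of _ L "\<lambda>_. L"]) (auto simp: Q_def)
      then show False using h by blast
    qed
    then obtain y0 where y0: "y0 \<in> L" "h y0 \<noteq> y0" by blast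
    have "h (h y0) = y0" using h \<iota>1(3)[of h y0] y0 by auto
    then show "\<Phi> h = 0" using twocycle[of h y0] Qinj h y0 by (auto simp: Q_def)
  qed
  also have "\<dots> = (\<Sum>M\<in>PiE L (\<lambda>_. {..<3::nat}). 1)"
    unfolding \<Phi>_def by (simp add: K_def)
  \<comment> \<open>Each transversal contributes 1 to the identity map, and their number is odd
    because the triples have an odd number of points.\<close>
  also have "\<dots> = of_nat (3 ^ card L)"
    using fin by (simp add: card_PiE)
  also have "\<dots> = (1 :: bit)"
  proof -
    have "(of_nat (3 ^ n) :: bit) = 1" for n
      by (induction n) (auto simp: numeral_3_eq_3)
    then show ?thesis .
  qed
  finally show ?thesis .
qed

section \<open>Sums weighted by a Vandermonde product\<close>

definition vand :: "int \<times> int \<times> int \<Rightarrow> int" where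
  "vand t = (case t of (p, q, r) \<Rightarrow> (q - p) * (r - p) * (r - q))"

definition comp3 :: "int \<times> int \<times> int \<Rightarrow> nat \<Rightarrow> int" where
  "comp3 t j = (case t of (p, q, r) \<Rightarrow> if j = 0 then p else if j = 1 then q else r)"

abbreviation triples :: "(int \<times> int \<times> int) set" where
  "triples \<equiv> {0, 1, 2} \<times> {0, 1, 2} \<times> {0, 1, 2}"

lemma lessThan_3: "{..<3::nat} = {0, 1, 2}"
  by auto

text \<open>Only the six orderings of 0, 1, 2 have a nonzero \<open>vand\<close>, namely 2 times
  their sign. So the sum is twice the determinant \<open>d\<close> of powers of 0, 1, 2, where
  \<open>0 ^ 0 = 1\<close>. For exponents at most 2 it is a Vandermonde determinant, 2 up to sign,
  if they are distinct, and 0 otherwise.\<close>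

lemma vandermonde_sum:
  assumes "\<And>j. j < 3 \<Longrightarrow> e j \<le> (2::nat)"
  shows "\<exists>\<delta>. (\<Sum>t\<in>triples. vand t * (\<Prod>j<3. comp3 t j ^ e j)) = 4 * \<delta>
           \<and> (of_int \<delta> :: bit) = of_bool (inj_on e {..<3})"
proof -
  define d where "d a b c = (0 ^ a * 2 ^ c - 0 ^ a * 2 ^ b - 0 ^ b * 2 ^ c + 2 ^ b * 0 ^ c + 2 ^ a * 0 ^ b - 2 ^ a * 0 ^ c :: int)" for a b c :: nat
  have "(\<Sum>t\<in>triples. vand t * (comp3 t 0 ^ a * comp3 t 1 ^ b * comp3 t 2 ^ c)) = 2 * d a b c" for a b c
    unfolding sum.cartesian_product' by (simp add: vand_def comp3_def d_def)
  moreover have "(\<Prod>j<3. comp3 t j ^ e j) = comp3 t 0 ^ e 0 * comp3 t 1 ^ e 1 * comp3 t 2 ^ e 2" for t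
    by (simp add: lessThan_3 mult.assoc)
  ultimately have eq: "(\<Sum>t\<in>triples. vand t * (\<Prod>j<3. comp3 t j ^ e j)) = 2 * d (e 0) (e 1) (e 2)"
    by (simp only:)
  have inj: "inj_on e {..<3} \<longleftrightarrow> e 0 \<noteq> e 1 \<and> e 0 \<noteq> e 2 \<and> e 1 \<noteq> e 2"
    by (auto simp: lessThan_3 inj_on_def)
  have "(a = 0 \<or> a = 1 \<or> a = 2) \<and> (b = 0 \<or> b = 1 \<or> b = 2) \<and> (c = 0 \<or> c = 1 \<or> c = 2) \<Longrightarrow>
      d a b c = 2 * (d a b c div 2) \<and> (of_int (d a b c div 2) :: bit) = of_bool (a \<noteq> b \<and> a \<noteq> c \<and> b \<noteq> c)" for a b c
    unfolding d_def by (elim conjE disjE; simp)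
  moreover have "e j = 0 \<or> e j = 1 \<or> e j = 2" if "j < 3" for j
    using assms[OF that] by linarith
  ultimately have *: "d (e 0) (e 1) (e 2) = 2 * (d (e 0) (e 1) (e 2) div 2) \<and>
      (of_int (d (e 0) (e 1) (e 2) div 2) :: bit) = of_bool (inj_on e {..<3})"
    unfolding inj by simp
  show ?thesis unfolding eq by (rule exI[of _ "d (e 0) (e 1) (e 2) div 2"]) (use * in linarith)
qed

text \<open>\<open>walk N r v\<close> says that the edge entering position \<open>v\<close> of the path \<open>0, \<dots>, N\<close> is assigned to \<open>v\<close>;
  virtual edges before \<open>0\<close> and after \<open>N\<close> are assigned to their right ends. Then \<open>walk_exp\<close> is the
  exponent of the variable at \<open>v\<close> in the corresponding monomial of the path polynomial.\<close>

definition walk :: "nat \<Rightarrow> (nat \<Rightarrow> bool) \<Rightarrow> nat \<Rightarrow> bool" where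
  "walk N r v \<longleftrightarrow> v = 0 \<or> N < v \<or> r (v - 1)"

definition walk_exp :: "nat \<Rightarrow> (nat \<Rightarrow> bool) \<Rightarrow> nat \<Rightarrow> nat" where
  "walk_exp N r v = of_bool (walk N r v) + of_bool (\<not> walk N r (Suc v))"

text \<open>Choosing a term from each factor assigns an edge to one of its ends, with sign -1 for
  the right end. The extra factor \<open>x 0\<close> raises the degree from \<open>N\<close> to
  \<open>Suc N\<close>, which will be \<open>3 * card L\<close>: the wanted exponents 0, 1, 2 of
  each triple have sum 3.\<close>

lemma path_product_expand:
  fixes x :: "nat \<Rightarrow> int"
  shows "x 0 * (\<Prod>v<N. x v - x (Suc v)) =
    (\<Sum>r\<in>PiE {..<N} (\<lambda>_. UNIV). (\<Prod>v<N. if r v then -1 else 1) * (\<Prod>v<Suc N. x v ^ walk_exp N r v))"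
proof -
  have "(\<Prod>v<N. x v - x (Suc v)) = (\<Prod>v<N. \<Sum>b\<in>UNIV. if b then - x (Suc v) else x v)"
    by (intro prod.cong) (auto simp: UNIV_bool)
  also have "\<dots> = (\<Sum>r\<in>PiE {..<N} (\<lambda>_. UNIV). \<Prod>v<N. if r v then - x (Suc v) else x v)"
    by (rule prod_sum_PiE) auto
  finally have "x 0 * (\<Prod>v<N. x v - x (Suc v)) = (\<Sum>r\<in>PiE {..<N} (\<lambda>_. UNIV). x 0 * (\<Prod>v<N. if r v then - x (Suc v) else x v))"
    by (simp add: sum_distrib_left)
  also have "\<dots> = (\<Sum>r\<in>PiE {..<N} (\<lambda>_. UNIV). (\<Prod>v<N. if r v then -1 else 1) * (\<Prod>v<Suc N. x v ^ walk_exp N r v))"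
  proof (intro sum.cong refl)
    fix r :: "nat \<Rightarrow> bool"
    have "(\<Prod>v<N. if r v then - x (Suc v) else x v) =
        (\<Prod>v<N. (if r v then -1 else 1) * (x (Suc v) ^ of_bool (r v) * x v ^ of_bool (\<not> r v)))"
      by (intro prod.cong) auto
    moreover have "x 0 * (\<Prod>v<N. x (Suc v) ^ of_bool (r v)) = (\<Prod>v<Suc N. x v ^ of_bool (walk N r v))"
      unfolding prod.lessThan_Suc_shift by (simp add: walk_def)
    moreover have "(\<Prod>v<N. x v ^ of_bool (\<not> r v)) = (\<Prod>v<Suc N. x v ^ of_bool (\<not> walk N r (Suc v)))"
      by (simp add: walk_def)
    ultimately show "x 0 * (\<Prod>v<N. if r v then - x (Suc v) else x v) =
        (\<Prod>v<N. if r v then -1 else 1) * (\<Prod>v<Suc N. x v ^ walk_exp N r v)"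
      by (simp only: walk_exp_def power_add prod.distrib) (simp add: mult_ac)
  qed
  finally show ?thesis .
qed

section \<open>Counting walks modulo 2\<close>

lemma of_bool_All_prod:
  assumes "finite L"
  shows "(of_bool (\<forall>y\<in>L. P y) :: bit) = (\<Prod>y\<in>L. of_bool (P y))"
  using assms by (induction L rule: finite_induct) auto

text \<open>Here \<open>a\<close> and \<open>b\<close> stand for the walk at a position and at the
  next one: the exponent is 1 if they agree, 2 if only \<open>a\<close> holds and 0 if only
  \<open>b\<close> does. At most one \<open>i\<close> meets the condition on the right, so the sum
  modulo 2 acts as an existential quantifier.\<close>

lemma inj_on_walk_exp_iff:
  "(of_bool (inj_on (\<lambda>j. of_bool (a j) + of_bool (\<not> b j) :: nat) {..<3::nat}) :: bit) =
    (\<Sum>i<3. of_bool ((\<forall>j<3. a j = b j \<longleftrightarrow> j = i) \<and> (\<forall>j<3. \<forall>k<3. j \<noteq> i \<longrightarrow> k \<noteq> i \<longrightarrow> j \<noteq> k \<longrightarrow> a j \<noteq> a k)))"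
proof -
  have A: "(\<forall>j<3. P j) \<longleftrightarrow> P 0 \<and> P 1 \<and> P (2::nat)" for P
    by (auto simp: numeral_3_eq_3 less_Suc_eq numeral_2_eq_2)
  show ?thesis
    unfolding lessThan_3 A inj_on_def
    by (cases "a 0"; cases "b 0"; cases "a 1"; cases "b 1"; cases "a 2"; cases "b 2"; simp)
qed

lemma walk_determined:
  assumes "r \<in> PiE {..<N} (\<lambda>_. UNIV)" "walk N r (Suc N)"
    "\<And>v. v \<le> N \<Longrightarrow> (walk N r v = walk N r (Suc v)) \<longleftrightarrow> v \<in> D"
  shows "v \<le> Suc N \<Longrightarrow> walk N r v \<longleftrightarrow> even (card {u. u < v \<and> u \<notin> D})"
proof (induction v)
  case 0
  then show ?case by (simp add: walk_def)
next
  case (Suc v)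
  have "{u. u < Suc v \<and> u \<notin> D} = {u. u < v \<and> u \<notin> D} \<union> (if v \<in> D then {} else {v})"
    by (auto simp: less_Suc_eq)
  then have "card {u. u < Suc v \<and> u \<notin> D} = card {u. u < v \<and> u \<notin> D} + (if v \<in> D then 0 else 1)"
    by (auto simp: card_insert_if)
  then show ?case using Suc assms(3)[of v] by auto
qed

text \<open>With \<open>a\<close> selected in \<open>y\<close> and \<open>b\<close> in
  \<open>z\<close>, this is the parity of the pairs in which an unselected position of
  \<open>z\<close> lies before one of \<open>y\<close>. A walk that changes exactly at the
  unselected positions takes different values at the two unselected positions of \<open>y\<close> if
  and only if these parities, summed over all \<open>z\<close>, give 1.\<close>

definition cross :: "('b \<times> nat \<Rightarrow> nat) \<Rightarrow> 'b \<Rightarrow> 'b \<Rightarrow> nat \<Rightarrow> nat \<Rightarrow> bit" where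
  "cross pos y z a b = (\<Sum>j\<in>{..<3} - {a}. \<Sum>i\<in>{..<3} - {b}. of_bool (pos (z, i) < pos (y, j)))"

text \<open>Each \<open>j\<close> is unselected for two of the three values of \<open>a\<close>, so
  everything is counted twice.\<close>

lemma cross_zero:
  assumes "b < 3"
  shows "(\<Sum>a<3. cross pos y z a b) = 0"
  unfolding cross_def by (simp add: lessThan_3 insert_Diff_if sum.distrib[symmetric])

lemma of_bool_less_swap: "u \<noteq> v \<Longrightarrow> (of_bool (u < (v::nat)) :: bit) = 1 + of_bool (v < u)"
  by (cases u v rule: linorder_cases) auto

text \<open>Exchanging the roles complements each of the 2 * 2 comparisons, and four complements
  change nothing modulo 2.\<close>

lemma cross_sym:
  assumes inj: "inj_on pos (L \<times> {..<3::nat})" and yz: "y \<in> L" "z \<in> L" "y \<noteq> z" and ab: "a < 3" "b < 3"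
  shows "cross pos y z a b = cross pos z y b a"
proof -
  have ne: "pos (z, i) \<noteq> pos (y, j)" if "i < 3" "j < 3" for i j
    using inj_onD[OF inj, of "(z, i)" "(y, j)"] yz that by auto
  have "cross pos y z a b = (\<Sum>j\<in>{..<3} - {a}. \<Sum>i\<in>{..<3} - {b}. 1 + of_bool (pos (y, j) < pos (z, i)))"
    unfolding cross_def using ne by (intro sum.cong refl of_bool_less_swap) auto
  also have "\<dots> = (\<Sum>j\<in>{..<3} - {a}. \<Sum>i\<in>{..<3} - {b}. 1) + (\<Sum>j\<in>{..<3} - {a}. \<Sum>i\<in>{..<3} - {b}. of_bool (pos (y, j) < pos (z, i)))"
    by (simp add: sum.distrib)
  also have "(\<Sum>j\<in>{..<3} - {a}. \<Sum>i\<in>{..<3} - {b}. 1 :: bit) = 0"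
    using ab by (simp add: card_Diff_singleton)
  also have "(\<Sum>j\<in>{..<3} - {a}. \<Sum>i\<in>{..<3} - {b}. of_bool (pos (y, j) < pos (z, i)) :: bit) = cross pos z y b a"
    unfolding cross_def by (rule sum.swap)
  finally show ?thesis by simp
qed

text \<open>Of the two unselected positions of \<open>y\<close> exactly one precedes the other. This
  yields the summand 1 in the factors of \<open>transversal_parity\<close>.\<close>

lemma cross_self:
  assumes inj: "inj_on pos (L \<times> {..<3::nat})" and y: "y \<in> L" and a: "a < 3"
  shows "cross pos y y a a = 1"
proof -
  have ne: "pos (y, i) \<noteq> pos (y, j)" if "i < 3" "j < 3" "i \<noteq> j" for i j
    using inj_onD[OF inj, of "(y, i)" "(y, j)"] y that by auto
  have "a = 0 \<or> a = 1 \<or> a = 2" using a by auto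
  then show ?thesis
    using of_bool_less_swap[OF ne[of 0 1]] of_bool_less_swap[OF ne[of 0 2]] of_bool_less_swap[OF ne[of 1 2]]
    by (elim disjE) (simp_all add: cross_def lessThan_3 insert_Diff_if add.assoc del: sum_of_bool_eq)
qed

lemma of_bool_pair_differ:
  fixes a :: nat
  assumes "a < 3"
  shows "(of_bool (\<forall>j<3. \<forall>k<3. j \<noteq> a \<longrightarrow> k \<noteq> a \<longrightarrow> j \<noteq> k \<longrightarrow> p j \<noteq> p k) :: bit) = (\<Sum>j\<in>{..<3} - {a}. of_bool (\<not> p j))"
proof -
  have A: "(\<forall>j<3. P j) \<longleftrightarrow> P 0 \<and> P 1 \<and> P (2::nat)" for P
    by (auto simp: numeral_3_eq_3 less_Suc_eq numeral_2_eq_2)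
  have "a = 0 \<or> a = 1 \<or> a = 2" using assms by auto
  then show ?thesis
    unfolding A by (elim disjE; cases "p 0"; cases "p 1"; cases "p 2"; simp add: lessThan_3 insert_Diff_if del: sum_of_bool_eq)
qed

lemma of_nat_bit: "(of_nat n :: bit) = of_bool (odd n)"
  by (induction n) auto

text \<open>The exponents on a triple are \<open>0, 1, 2\<close> exactly if one of its positions (the one with exponent 1)
  does not change the walk, and the walk takes different values at the other two. The walk is
  determined by the set of positions that do not change it, so we are counting transversals.\<close>

lemma walk_parity:
  assumes fin: "finite L" and bij: "bij_betw pos (L \<times> {..<3::nat}) {..<Suc N}"
  shows "(\<Sum>r\<in>PiE {..<N} (\<lambda>_. UNIV). \<Prod>y\<in>L. of_bool (inj_on (\<lambda>j. walk_exp N r (pos (y, j))) {..<3}) :: bit) = 1"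
proof -
  have inj: "inj_on pos (L \<times> {..<3})" using bij by (rule bij_betw_imp_inj_on)
  have card: "Suc N = 3 * card L" using bij_betw_same_card[OF bij] by (simp add: card_cartesian_product)
  have pos: "pos (y, j) \<le> N" if "y \<in> L" "j < 3" for y j
    using bij_betw_apply[OF bij, of "(y, j)"] that by auto
  have surj: "\<exists>y\<in>L. \<exists>j<3. v = pos (y, j)" if "v \<le> N" for v
    using bij that unfolding bij_betw_def by (metis (no_types, lifting) imageE lessThan_iff less_Suc_eq_le mem_Sigma_iff old.prod.exhaust)
  have pos_eq: "pos (y, j) = pos (z, i) \<longleftrightarrow> y = z \<and> j = i" if "y \<in> L" "z \<in> L" "j < 3" "i < 3" for y z i j
    using inj_onD[OF inj, of "(y, j)" "(z, i)"] that by auto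
  define A where "A r y i \<longleftrightarrow> (\<forall>j<3. walk N r (pos (y, j)) = walk N r (Suc (pos (y, j))) \<longleftrightarrow> j = i) \<and>
      (\<forall>j<3. \<forall>k<3. j \<noteq> i \<longrightarrow> k \<noteq> i \<longrightarrow> j \<noteq> k \<longrightarrow> walk N r (pos (y, j)) \<noteq> walk N r (pos (y, k)))" for r y i
  have inner: "(\<Sum>r\<in>PiE {..<N} (\<lambda>_. UNIV). (of_bool (\<forall>y\<in>L. A r y (M y)) :: bit)) =
      (\<Prod>y\<in>L. 1 + (\<Sum>z\<in>L - {y}. cross pos y z (M y) (M z)))" if M: "M \<in> PiE L (\<lambda>_. {..<3})" for M
  proof -
    have M3: "M y < 3" if "y \<in> L" for y using M that by auto
    define D where "D = (\<lambda>y. pos (y, M y)) ` L"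
    have D: "pos (y, j) \<in> D \<longleftrightarrow> j = M y" if "y \<in> L" "j < 3" for y j
      using that pos_eq M3 by (auto simp: D_def)
    \<comment> \<open>The only candidate for a walk that stays unchanged exactly at the positions
      selected by \<open>M\<close>.\<close>
    define p where "p v \<longleftrightarrow> even (card {u. u < v \<and> u \<notin> D})" for v :: nat
    have p_Suc: "p (Suc v) \<longleftrightarrow> (p v = (v \<in> D))" for v
    proof -
      have "{u. u < Suc v \<and> u \<notin> D} = {u. u < v \<and> u \<notin> D} \<union> (if v \<in> D then {} else {v})"
        by (auto simp: less_Suc_eq)
      then have "card {u. u < Suc v \<and> u \<notin> D} = card {u. u < v \<and> u \<notin> D} + (if v \<in> D then 0 else 1)"
        by (auto simp: card_insert_if)
      then show ?thesis by (auto simp: p_def)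
    qed
    \<comment> \<open>The candidate has to end with \<open>True\<close>, because of the virtual edge
      after \<open>N\<close>. It does, as the number of its changes is
      \<open>3 * card L - card L\<close>, which is even.\<close>
    have pN: "p (Suc N)"
    proof -
      have "D \<subseteq> {..<Suc N}" using pos M3 by (fastforce simp: D_def)
      moreover have "card D = card L" unfolding D_def
        using pos_eq M3 by (intro card_image) (auto simp: inj_on_def)
      moreover have "{u. u < Suc N \<and> u \<notin> D} = {..<Suc N} - D" by auto
      ultimately have "card {u. u < Suc N \<and> u \<notin> D} = 2 * card L"
        using card fin by (simp add: card_Diff_subset D_def)
      then show ?thesis by (simp add: p_def)
    qed
    define r0 where "r0 = restrict (\<lambda>v. p (Suc v)) {..<N}"
    have r0: "walk N r0 v = p v" if "v \<le> Suc N" for v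
      using that pN by (cases "v = 0") (auto simp: walk_def r0_def p_def le_Suc_eq)
    define Q where "Q y \<longleftrightarrow> (\<forall>j<3. \<forall>k<3. j \<noteq> M y \<longrightarrow> k \<noteq> M y \<longrightarrow> j \<noteq> k \<longrightarrow> p (pos (y, j)) \<noteq> p (pos (y, k)))" for y
    have iff: "(\<forall>y\<in>L. A r y (M y)) \<longleftrightarrow> r = r0 \<and> (\<forall>y\<in>L. Q y)" if r: "r \<in> PiE {..<N} (\<lambda>_. UNIV)" for r
    proof
      assume A: "\<forall>y\<in>L. A r y (M y)"
      have "(walk N r v = walk N r (Suc v)) \<longleftrightarrow> v \<in> D" if "v \<le> N" for v
        using surj[OF that] A D unfolding A_def by blast
      then have wp: "walk N r v = p v" if "v \<le> Suc N" for v
        using walk_determined[OF r, of D v] that by (simp add: walk_def p_def)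
      have "r = r0"
      proof (rule PiE_ext[OF r])
        show "r0 \<in> PiE {..<N} (\<lambda>_. UNIV)" by (simp add: r0_def)
        show "r v = r0 v" if "v \<in> {..<N}" for v
          using wp[of "Suc v"] that by (simp add: walk_def r0_def)
      qed
      moreover have "Q y" if "y \<in> L" for y
      proof -
        have "walk N r (pos (y, j)) = p (pos (y, j))" if "j < 3" for j
          using wp pos[OF \<open>y \<in> L\<close> that] by simp
        moreover have "walk N r (pos (y, j)) \<noteq> walk N r (pos (y, k))"
          if "j < 3" "k < 3" "j \<noteq> M y" "k \<noteq> M y" "j \<noteq> k" for j k
          using A \<open>y \<in> L\<close> that unfolding A_def by blast
        ultimately show ?thesis unfolding Q_def by blast
      qed
      ultimately show "r = r0 \<and> (\<forall>y\<in>L. Q y)" by blast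
    next
      assume *: "r = r0 \<and> (\<forall>y\<in>L. Q y)"
      show "\<forall>y\<in>L. A r y (M y)"
      proof
        fix y assume y: "y \<in> L"
        have "walk N r (pos (y, j)) = p (pos (y, j))" "walk N r (Suc (pos (y, j))) = p (Suc (pos (y, j)))" if "j < 3" for j
          using * r0 pos[OF y that] by auto
        moreover have "p (pos (y, j)) \<noteq> p (pos (y, k))"
          if "j < 3" "k < 3" "j \<noteq> M y" "k \<noteq> M y" "j \<noteq> k" for j k
          using * y that unfolding Q_def by blast
        ultimately show "A r y (M y)"
          unfolding A_def using D[OF y] p_Suc by metis
      qed
    qed
    have "(\<Sum>r\<in>PiE {..<N} (\<lambda>_. UNIV). (of_bool (\<forall>y\<in>L. A r y (M y)) :: bit)) =
        (\<Sum>r\<in>PiE {..<N} (\<lambda>_. UNIV). if r = r0 then of_bool (\<forall>y\<in>L. Q y) else 0)"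
      using iff by (intro sum.cong) auto
    also have "\<dots> = of_bool (\<forall>y\<in>L. Q y)"
      by (subst sum.delta) (auto simp: r0_def finite_PiE)
    also have "\<dots> = (\<Prod>y\<in>L. of_bool (Q y))"
      by (rule of_bool_All_prod[OF fin])
    also have "\<dots> = (\<Prod>y\<in>L. 1 + (\<Sum>z\<in>L - {y}. cross pos y z (M y) (M z)))"
    proof (intro prod.cong refl)
      fix y assume y: "y \<in> L"
      have np: "(of_bool (\<not> p v) :: bit) = (\<Sum>z\<in>L. \<Sum>i\<in>{..<3} - {M z}. of_bool (pos (z, i) < v))" if "v \<le> N" for v
      proof -
        have "(of_bool (\<not> p v) :: bit) = of_nat (card {u. u < v \<and> u \<notin> D})"
          by (simp add: p_def of_nat_bit)
        also have "\<dots> = (\<Sum>u\<in>{u. u < v \<and> u \<notin> D}. 1)" by simp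
        also have "\<dots> = (\<Sum>u\<in>pos ` Sigma L (\<lambda>z. {..<3} - {M z}). of_bool (u < v))"
        proof (rule sum.mono_neutral_cong_left)
          show "finite (pos ` Sigma L (\<lambda>z. {..<3} - {M z}))" using fin by auto
          show "{u. u < v \<and> u \<notin> D} \<subseteq> pos ` Sigma L (\<lambda>z. {..<3} - {M z})"
          proof
            fix u assume u: "u \<in> {u. u < v \<and> u \<notin> D}"
            then obtain z i where "z \<in> L" "i < 3" "u = pos (z, i)" using surj[of u] \<open>v \<le> N\<close> by auto
            then show "u \<in> pos ` Sigma L (\<lambda>z. {..<3} - {M z})" using u D by auto
          qed
        qed (use D in auto)
        also have "\<dots> = (\<Sum>(z, i)\<in>Sigma L (\<lambda>z. {..<3} - {M z}). of_bool (pos (z, i) < v))"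
          by (subst sum.reindex) (auto intro!: inj_on_subset[OF inj] sum.cong)
        also have "\<dots> = (\<Sum>z\<in>L. \<Sum>i\<in>{..<3} - {M z}. of_bool (pos (z, i) < v))"
          using fin by (subst sum.Sigma) auto
        finally show ?thesis .
      qed
      have "(of_bool (Q y) :: bit) = (\<Sum>j\<in>{..<3} - {M y}. of_bool (\<not> p (pos (y, j))))"
        unfolding Q_def by (rule of_bool_pair_differ[OF M3[OF y]])
      also have "\<dots> = (\<Sum>j\<in>{..<3} - {M y}. \<Sum>z\<in>L. \<Sum>i\<in>{..<3} - {M z}. of_bool (pos (z, i) < pos (y, j)))"
        using pos[OF y] by (intro sum.cong refl np) auto
      also have "\<dots> = (\<Sum>z\<in>L. cross pos y z (M y) (M z))"
        unfolding cross_def by (rule sum.swap)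
      also have "\<dots> = 1 + (\<Sum>z\<in>L - {y}. cross pos y z (M y) (M z))"
        by (simp add: sum.remove[OF fin y] cross_self[OF inj y M3[OF y]])
      finally show "of_bool (Q y) = 1 + (\<Sum>z\<in>L - {y}. cross pos y z (M y) (M z))" .
    qed
    finally show ?thesis .
  qed
  have "(\<Sum>r\<in>PiE {..<N} (\<lambda>_. UNIV). \<Prod>y\<in>L. of_bool (inj_on (\<lambda>j. walk_exp N r (pos (y, j))) {..<3}) :: bit) =
      (\<Sum>r\<in>PiE {..<N} (\<lambda>_. UNIV). \<Prod>y\<in>L. \<Sum>i<3. of_bool (A r y i))"
    unfolding walk_exp_def inj_on_walk_exp_iff A_def by simp
  also have "\<dots> = (\<Sum>r\<in>PiE {..<N} (\<lambda>_. UNIV). \<Sum>M\<in>PiE L (\<lambda>_. {..<3}). \<Prod>y\<in>L. of_bool (A r y (M y)))"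
    using fin by (intro sum.cong refl prod_sum_PiE) auto
  also have "\<dots> = (\<Sum>M\<in>PiE L (\<lambda>_. {..<3}). \<Sum>r\<in>PiE {..<N} (\<lambda>_. UNIV). of_bool (\<forall>y\<in>L. A r y (M y)))"
    by (subst sum.swap) (simp add: of_bool_All_prod[OF fin])
  also have "\<dots> = (\<Sum>M\<in>PiE L (\<lambda>_. {..<3}). \<Prod>y\<in>L. 1 + (\<Sum>z\<in>L - {y}. cross pos y z (M y) (M z)))"
    by (intro sum.cong refl inner)
  also have "\<dots> = 1"
    by (rule transversal_parity[OF fin]) (use cross_sym[OF inj] cross_zero in auto)
  finally show ?thesis .
qed

lemma comp3_mem: "t \<in> A \<times> A \<times> A \<Longrightarrow> comp3 t j \<in> A"
  by (auto simp: comp3_def)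

text \<open>If no colouring were proper, summing the graph polynomial over all colourings would give 0;
  but only the walks counted in \<open>walk_parity\<close> survive, and the sum is \<open>4 ^ card L\<close> times an odd number.\<close>

lemma path_triples_colouring_exact:
  assumes fin: "finite L" and bij: "bij_betw pos (L \<times> {..<3::nat}) {..<n}"
  shows "\<exists>c :: nat \<Rightarrow> int. (\<forall>v<n. c v \<in> {0, 1, 2}) \<and> (\<forall>v. Suc v < n \<longrightarrow> c v \<noteq> c (Suc v))
          \<and> (\<forall>y\<in>L. inj_on (\<lambda>j. c (pos (y, j))) {..<3})"
proof (cases n)
  case 0
  then have "L = {}" using bij_betw_same_card[OF bij] fin by (simp add: card_cartesian_product)
  then show ?thesis using 0 by auto
next
  case (Suc N)
  note bij = bij[unfolded Suc]
  define ip where "ip = inv_into (L \<times> {..<3}) pos"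
  have ip: "ip (pos (y, j)) = (y, j)" if "y \<in> L" "j < 3" for y j
    unfolding ip_def using that bij by (intro inv_into_f_f) (auto simp: bij_betw_def)
  have ip_mem: "fst (ip v) \<in> L" if "v < Suc N" for v
    using inv_into_into[of v pos "L \<times> {..<3}"] that bij unfolding ip_def bij_betw_def by (auto simp: mem_Times_iff)
  define val where "val g v = comp3 (g (fst (ip v))) (snd (ip v))" for g v
  have val_pos: "val g (pos (y, j)) = comp3 (g y) j" if "y \<in> L" "j < 3" for g y j
    using ip[OF that] by (simp add: val_def)
  \<comment> \<open>Nonzero only if the values inside each triple are distinct and consecutive
    positions differ; the factor \<open>val g 0\<close> merely forbids the value 0 at the
    start.\<close>
  define P where "P g = (\<Prod>y\<in>L. vand (g y)) * (val g 0 * (\<Prod>v<N. val g v - val g (Suc v)))" for g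
  have "\<exists>g\<in>PiE L (\<lambda>_. triples). P g \<noteq> 0"
  proof (rule ccontr)
    assume "\<not> ?thesis"
    then have "(\<Sum>g\<in>PiE L (\<lambda>_. triples). P g) = 0" by (intro sum.neutral) auto
    moreover have "\<exists>\<delta>. \<forall>r y. (\<Sum>t\<in>triples. vand t * (\<Prod>j<3. comp3 t j ^ walk_exp N r (pos (y, j)))) = 4 * \<delta> r y
        \<and> (of_int (\<delta> r y) :: bit) = of_bool (inj_on (\<lambda>j. walk_exp N r (pos (y, j))) {..<3})"
      by (intro choice allI vandermonde_sum) (simp add: walk_exp_def)
    then obtain \<delta> where \<delta>: "\<And>r y. (\<Sum>t\<in>triples. vand t * (\<Prod>j<3. comp3 t j ^ walk_exp N r (pos (y, j)))) = 4 * \<delta> r y"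
        "\<And>r y. (of_int (\<delta> r y) :: bit) = of_bool (inj_on (\<lambda>j. walk_exp N r (pos (y, j))) {..<3})"
      by blast
    define sg where "sg r = (\<Prod>v<N. if r v then -1 else 1 :: int)" for r :: "nat \<Rightarrow> bool"
    have sg: "(of_int (sg r) :: bit) = 1" for r
      unfolding sg_def of_int_prod by (intro prod.neutral) auto
    have "(\<Sum>g\<in>PiE L (\<lambda>_. triples). P g) =
        (\<Sum>g\<in>PiE L (\<lambda>_. triples). \<Sum>r\<in>PiE {..<N} (\<lambda>_. UNIV). sg r *
            (\<Prod>y\<in>L. vand (g y) * (\<Prod>j<3. comp3 (g y) j ^ walk_exp N r (pos (y, j)))))"
    proof (intro sum.cong refl)
      fix g
      have "(\<Prod>v<Suc N. val g v ^ walk_exp N r v) = (\<Prod>y\<in>L. \<Prod>j<3. comp3 (g y) j ^ walk_exp N r (pos (y, j)))" for r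
      proof -
        have "(\<Prod>v<Suc N. val g v ^ walk_exp N r v) = (\<Prod>z\<in>L \<times> {..<3}. val g (pos z) ^ walk_exp N r (pos z))"
          by (rule prod.reindex_bij_betw[OF bij, symmetric])
        also have "\<dots> = (\<Prod>y\<in>L. \<Prod>j<3. val g (pos (y, j)) ^ walk_exp N r (pos (y, j)))"
          by (simp add: prod.cartesian_product case_prod_unfold)
        also have "\<dots> = (\<Prod>y\<in>L. \<Prod>j<3. comp3 (g y) j ^ walk_exp N r (pos (y, j)))"
          by (intro prod.cong refl) (simp add: val_pos)
        finally show ?thesis .
      qed
      then show "P g = (\<Sum>r\<in>PiE {..<N} (\<lambda>_. UNIV). sg r * (\<Prod>y\<in>L. vand (g y) * (\<Prod>j<3. comp3 (g y) j ^ walk_exp N r (pos (y, j)))))"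
        unfolding P_def path_product_expand sg_def by (simp add: sum_distrib_left prod.distrib mult_ac)
    qed
    also have "\<dots> = (\<Sum>r\<in>PiE {..<N} (\<lambda>_. UNIV). sg r * (\<Sum>g\<in>PiE L (\<lambda>_. triples).
            (\<Prod>y\<in>L. vand (g y) * (\<Prod>j<3. comp3 (g y) j ^ walk_exp N r (pos (y, j))))))"
      by (subst sum.swap) (simp add: sum_distrib_left)
    also have "\<dots> = (\<Sum>r\<in>PiE {..<N} (\<lambda>_. UNIV). sg r * (\<Prod>y\<in>L. 4 * \<delta> r y))"
      unfolding \<delta>(1)[symmetric] using fin by (subst prod_sum_PiE) auto
    also have "\<dots> = 4 ^ card L * (\<Sum>r\<in>PiE {..<N} (\<lambda>_. UNIV). sg r * (\<Prod>y\<in>L. \<delta> r y))"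
      by (simp add: prod.distrib sum_distrib_left mult_ac)
    \<comment> \<open>The power of 4 is cancelled over the integers; reduction modulo 2 before that
      would hide the odd factor.\<close>
    finally have "(\<Sum>r\<in>PiE {..<N} (\<lambda>_. UNIV). sg r * (\<Prod>y\<in>L. \<delta> r y)) = 0"
      using \<open>(\<Sum>g\<in>PiE L (\<lambda>_. triples). P g) = 0\<close> by simp
    then have "of_int (\<Sum>r\<in>PiE {..<N} (\<lambda>_. UNIV). sg r * (\<Prod>y\<in>L. \<delta> r y)) = (0 :: bit)" by simp
    then show False using walk_parity[OF fin bij] by (simp add: sg \<delta>(2))
  qed
  then obtain g where g: "g \<in> PiE L (\<lambda>_. triples)" "P g \<noteq> 0" by blast
  have vand: "vand (g y) \<noteq> 0" if "y \<in> L" for y using g(2) fin that by (auto simp: P_def)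
  have diff: "val g v \<noteq> val g (Suc v)" if "v < N" for v using g(2) that by (auto simp: P_def)
  show ?thesis
  proof (intro exI[of _ "val g"] conjI allI ballI impI)
    fix v assume "v < n"
    then have "g (fst (ip v)) \<in> triples" using ip_mem[of v] PiE_mem[OF g(1)] Suc by blast
    then show "val g v \<in> {0, 1, 2}" unfolding val_def by (rule comp3_mem)
  next
    fix v assume "Suc v < n" then show "val g v \<noteq> val g (Suc v)" using diff Suc by simp
  next
    fix y assume y: "y \<in> L"
    show "inj_on (\<lambda>j. val g (pos (y, j))) {..<3}"
      using vand[OF y] val_pos[OF y, of _ g] by (auto simp: inj_on_def lessThan_3 vand_def comp3_def split: prod.splits)
  qed
qed

text \<open>Positions are appended behind the path with the label of a deficient fibre until every
  fibre has size 3; the measure is the number of missing points. A colouring of the longer path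
  restricts to the old one.\<close>

lemma pad_fibers:
  fixes f :: "nat \<Rightarrow> 'b"
  assumes "\<And>y. card {u. u < n \<and> f u = y} \<le> 3"
  shows "\<exists>n' f'. n \<le> n' \<and> (\<forall>u<n. f' u = f u) \<and> (\<forall>v<n'. card {u. u < n' \<and> f' u = f' v} = 3)"
  using assms
proof (induction "3 * card (f ` {..<n}) - n" arbitrary: n f rule: less_induct)
  case less
  show ?case
  proof (cases "\<forall>v<n. card {u. u < n \<and> f u = f v} = 3")
    case True then show ?thesis by blast
  next
    case False
    then obtain v where v: "v < n" "card {u. u < n \<and> f u = f v} < 3"
      using less.prems by (metis le_neq_implies_less)
    define f1 where "f1 = f(n := f v)"
    have "{u. u < Suc n \<and> f1 u = y} = {u. u < n \<and> f u = y} \<union> (if y = f v then {n} else {})" for y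
      by (auto simp: f1_def less_Suc_eq)
    then have le: "card {u. u < Suc n \<and> f1 u = y} \<le> 3" for y
      using v(2) less.prems[of y] by (auto simp: card_insert_if)
    have im: "f1 ` {..<Suc n} = f ` {..<n}" using v(1) by (auto simp: f1_def lessThan_Suc)
    have "{..<Suc n} = (\<Union>y\<in>f ` {..<n}. {u. u < Suc n \<and> f1 u = y})" using im by auto
    then have "Suc n \<le> (\<Sum>y\<in>f ` {..<n}. card {u. u < Suc n \<and> f1 u = y})"
      using card_UN_le[of "f ` {..<n}" "\<lambda>y. {u. u < Suc n \<and> f1 u = y}"] by (metis card_lessThan finite_imageI finite_lessThan)
    also have "\<dots> \<le> (\<Sum>y\<in>f ` {..<n}. 3)" using le by (intro sum_mono) auto
    finally have "3 * card (f1 ` {..<Suc n}) - Suc n < 3 * card (f ` {..<n}) - n" unfolding im by simp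
    from less.hyps[OF this le] obtain n' f' where *: "Suc n \<le> n'" "\<forall>u<Suc n. f' u = f1 u"
      "\<forall>v<n'. card {u. u < n' \<and> f' u = f' v} = 3" by blast
    then show ?thesis by (intro exI[of _ n'] exI[of _ f']) (auto simp: f1_def)
  qed
qed

lemma path_triples_colouring:
  fixes f :: "nat \<Rightarrow> 'b"
  assumes "\<And>y. card {u. u < n \<and> f u = y} \<le> 3"
  shows "\<exists>c :: nat \<Rightarrow> nat. (\<forall>v. c v < 3) \<and> (\<forall>v. Suc v < n \<longrightarrow> c v \<noteq> c (Suc v))
          \<and> (\<forall>u<n. \<forall>v<n. f u = f v \<longrightarrow> u \<noteq> v \<longrightarrow> c u \<noteq> c v)"
proof -
  obtain n' f' where n': "n \<le> n'" "\<And>u. u < n \<Longrightarrow> f' u = f u"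
      "\<And>v. v < n' \<Longrightarrow> card {u. u < n' \<and> f' u = f' v} = 3"
    using pad_fibers[OF assms] by blast
  define L where "L = f' ` {..<n'}"
  have "\<exists>e. bij_betw e {..<3::nat} {u. u < n' \<and> f' u = y}" if "y \<in> L" for y
    using that n'(3) finite_same_card_bij[of "{..<3::nat}" "{u. u < n' \<and> f' u = y}"] by (auto simp: L_def)
  then obtain e where e: "\<And>y. y \<in> L \<Longrightarrow> bij_betw (e y) {..<3::nat} {u. u < n' \<and> f' u = y}" by metis
  define pos where "pos = (\<lambda>(y, j). e y j)"
  have mem: "e y j < n'" "f' (e y j) = y" if "y \<in> L" "j < 3" for y j
    using bij_betw_apply[OF e[OF that(1)], of j] that by auto
  have bij: "bij_betw pos (L \<times> {..<3}) {..<n'}"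
    unfolding bij_betw_def
  proof
    show "inj_on pos (L \<times> {..<3})"
    proof (rule inj_onI)
      fix a b assume ab: "a \<in> L \<times> {..<3}" "b \<in> L \<times> {..<3}" "pos a = pos b"
      obtain y j z i where [simp]: "a = (y, j)" "b = (z, i)" by fastforce
      have "y = z" using ab mem[of y j] mem[of z i] by (auto simp: pos_def)
      then show "a = b" using ab bij_betw_imp_inj_on[OF e[of y]] by (auto simp: pos_def inj_on_def)
    qed
    show "pos ` (L \<times> {..<3}) = {..<n'}"
    proof (intro equalityI subsetI)
      fix u assume u: "u \<in> {..<n'}"
      then have "f' u \<in> L" by (simp add: L_def)
      then have "u \<in> e (f' u) ` {..<3}" using bij_betw_imp_surj_on[OF e] u by simp
      then obtain j where "j < 3" "e (f' u) j = u" by auto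
      then show "u \<in> pos ` (L \<times> {..<3})" using \<open>f' u \<in> L\<close> by (force simp: pos_def)
    qed (use mem in \<open>auto simp: pos_def\<close>)
  qed
  have "finite L" by (simp add: L_def)
  then obtain c :: "nat \<Rightarrow> int" where c: "\<And>v. v < n' \<Longrightarrow> c v \<in> {0, 1, 2}" "\<And>v. Suc v < n' \<Longrightarrow> c v \<noteq> c (Suc v)"
      "\<And>y. y \<in> L \<Longrightarrow> inj_on (\<lambda>j. c (pos (y, j))) {..<3}"
    using path_triples_colouring_exact[OF _ bij] by blast
  define d where "d v = (if v < n' then nat (c v) else 0)" for v
  have d_eq: "d u = d v \<longleftrightarrow> c u = c v" if "u < n'" "v < n'" for u v
    using c(1)[of u] c(1)[of v] that by (auto simp: d_def)
  show ?thesis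
  proof (intro exI[of _ d] conjI allI impI)
    show "d v < 3" for v using c(1)[of v] by (auto simp: d_def)
    show "d v \<noteq> d (Suc v)" if "Suc v < n" for v using c(2)[of v] d_eq[of v "Suc v"] n'(1) that by auto
    fix u v assume uv: "u < n" "v < n" "f u = f v" "u \<noteq> v"
    then have "u < n'" "v < n'" "f' u = f' v" using n' by simp_all
    moreover from this have "f' u \<in> L" unfolding L_def by blast
    ultimately have y: "u < n'" "v < n'" "f' u = f' v" "f' u \<in> L" by blast+
    have im: "u \<in> e (f' u) ` {..<3}" "v \<in> e (f' u) ` {..<3}"
      using bij_betw_imp_surj_on[OF e[OF y(4)]] y by simp_all
    obtain j where j: "u = e (f' u) j" "j \<in> {..<3}" using im(1) by (rule imageE)
    obtain i where i: "v = e (f' u) i" "i \<in> {..<3}" using im(2) by (rule imageE)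
    have "j \<noteq> i" using uv(4) j(1) i(1) by metis
    then have "c (e (f' u) j) \<noteq> c (e (f' u) i)"
      using inj_onD[OF c(3)[OF y(4)] _ j(2) i(2)] by (auto simp: pos_def)
    then have "c u \<noteq> c v" using j(1) i(1) by metis
    then show "d u \<noteq> d v" using d_eq y by simp
  qed
qed

section \<open>Cycles of a permutation, laid out along a line\<close>

lemma orbit_self: "finite V \<Longrightarrow> s permutes V \<Longrightarrow> x \<in> orbit s x"
  by (rule permutation_self_in_orbit) (auto simp: permutation_permutes)

lemma orbit_eq_of_mem:
  assumes "finite V" "s permutes V" "y \<in> orbit s x"
  shows "orbit s y = orbit s x"
  using orbit_cyclic_eq3[OF cyclic_on_orbit[OF assms(2,1)] assms(3)] .

lemma orbit_subset_carrier: "s permutes V \<Longrightarrow> x \<in> V \<Longrightarrow> orbit s x \<subseteq> V"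
  by (rule permutes_orbit_subset)

text \<open>Every cycle is cut open in front of a representative \<open>r x\<close>, taken from
  \<open>K\<close> if possible, and \<open>d x\<close> counts the steps from there to
  \<open>x\<close>.\<close>

lemma orbit_coordinates:
  assumes fin: "finite V" and s: "s permutes V"
  obtains r :: "'a \<Rightarrow> 'a" and d :: "'a \<Rightarrow> nat" where
    "\<And>x. r x \<in> orbit s x" "\<And>x. K \<inter> orbit s x \<noteq> {} \<Longrightarrow> r x \<in> K"
    "\<And>x y. y \<in> orbit s x \<Longrightarrow> r y = r x" "\<And>x. (s ^^ d x) (r x) = x"
    "\<And>x. s x \<noteq> r x \<Longrightarrow> d (s x) = Suc (d x)" "\<And>x. x = r x \<Longrightarrow> d x = 0" "\<And>x. x \<in> V \<Longrightarrow> d x < card V"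
proof -
  note self = orbit_self[OF fin s] and eq = orbit_eq_of_mem[OF fin s]
  define r where "r x = (SOME y. y \<in> orbit s x \<and> (K \<inter> orbit s x \<noteq> {} \<longrightarrow> y \<in> K))" for x
  define d where "d x = (LEAST j. (s ^^ j) (r x) = x)" for x
  have "\<exists>y. y \<in> orbit s x \<and> (K \<inter> orbit s x \<noteq> {} \<longrightarrow> y \<in> K)" for x using self[of x] by blast
  then have r: "r x \<in> orbit s x \<and> (K \<inter> orbit s x \<noteq> {} \<longrightarrow> r x \<in> K)" for x
    unfolding r_def by (rule someI_ex)
  have r_eq: "r y = r x" if "y \<in> orbit s x" for x y using eq[OF that] by (simp add: r_def)
  have "\<exists>j. (s ^^ j) (r x) = x" for x
  proof -
    have "x \<in> orbit s (r x)" using r[of x] eq[of "r x" x] self[of x] by simp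
    then obtain n where "x = (s ^^ n) (r x)" unfolding orbit_altdef by blast
    then show ?thesis by metis
  qed
  then have d: "(s ^^ d x) (r x) = x" for x unfolding d_def by (rule LeastI_ex)
  have d_le: "d x \<le> j" if "(s ^^ j) (r x) = x" for x j using that unfolding d_def by (rule Least_le)
  have inj: "inj s" using s by (rule permutes_inj)
  show ?thesis
  proof
    show "r x \<in> orbit s x" for x using r by blast
    show "K \<inter> orbit s x \<noteq> {} \<Longrightarrow> r x \<in> K" for x using r by blast
    show "r y = r x" if "y \<in> orbit s x" for x y using r_eq that .
    show "(s ^^ d x) (r x) = x" for x by (rule d)
    show "x = r x \<Longrightarrow> d x = 0" for x using d_le[of 0 x] by simp
    show "d (s x) = Suc (d x)" if "s x \<noteq> r x" for x
    proof (rule antisym)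
      have rs: "r (s x) = r x" by (rule r_eq[OF orbit.base])
      show "d (s x) \<le> Suc (d x)" by (rule d_le) (simp add: rs d)
      have "d (s x) \<noteq> 0"
      proof
        assume "d (s x) = 0"
        then have "r (s x) = s x" using d[of "s x"] by simp
        then show False using that rs by simp
      qed
      then obtain k where k: "d (s x) = Suc k" using not0_implies_Suc by blast
      have "s ((s ^^ k) (r x)) = s x" using d[of "s x"] by (simp add: k rs)
      then have "(s ^^ k) (r x) = x" by (rule injD[OF inj])
      then have "d x \<le> k" by (rule d_le)
      then show "Suc (d x) \<le> d (s x)" using k by simp
    qed
    show "d x < card V" if x: "x \<in> V" for x
    proof -
      have "inj_on (\<lambda>i. (s ^^ i) (r x)) {..d x}"
      proof (rule linorder_inj_onI)
        fix i j assume ij: "i < j" "i \<in> {..d x}" "j \<in> {..d x}"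
        show "(s ^^ i) (r x) \<noteq> (s ^^ j) (r x)"
        proof
          assume "(s ^^ i) (r x) = (s ^^ j) (r x)"
          moreover have "(s ^^ (d x - j + i)) (r x) = (s ^^ (d x - j)) ((s ^^ i) (r x))"
            "(s ^^ (d x - j + j)) (r x) = (s ^^ (d x - j)) ((s ^^ j) (r x))"
            by (simp_all only: funpow_add comp_apply)
          moreover have "d x - j + j = d x" using ij by simp
          ultimately have "(s ^^ (d x - j + i)) (r x) = x" using d[of x] by (simp only:)
          then have "d x \<le> d x - j + i" by (rule d_le)
          then show False using ij by simp
        qed
      qed auto
      then have "card ((\<lambda>i. (s ^^ i) (r x)) ` {..d x}) = Suc (d x)" by (simp add: card_image)
      moreover have "r x \<in> V" using r[of x] orbit_subset_carrier[OF s x] by blast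
      then have "(s ^^ i) (r x) \<in> V" for i using s by (induction i) (auto simp: permutes_in_image)
      then have "(\<lambda>i. (s ^^ i) (r x)) ` {..d x} \<subseteq> V" by blast
      then have "card ((\<lambda>i. (s ^^ i) (r x)) ` {..d x}) \<le> card V" by (rule card_mono[OF fin])
      ultimately show ?thesis by simp
    qed
  qed
qed

text \<open>The cycles, cut open at their representatives, occupy disjoint blocks of
  \<open>card V\<close> numbers. Only the step back to a representative leaves the order. Either
  that representative lies in \<open>K\<close>, or the cycle has at most two points and its step
  back is the step forward read in reverse.\<close>

lemma permutation_order:
  assumes fin: "finite V" and s: "s permutes V"
    and K: "\<And>x. x \<in> V \<Longrightarrow> 3 \<le> card (orbit s x) \<Longrightarrow> K \<inter> orbit s x \<noteq> {}"
  obtains h :: "'a \<Rightarrow> nat" where "inj_on h V"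
    "\<And>x. x \<in> V \<Longrightarrow> x \<notin> K \<Longrightarrow> s x \<notin> K \<Longrightarrow> s x \<noteq> x \<Longrightarrow> h (s x) = Suc (h x) \<or> h x = Suc (h (s x))"
proof -
  show ?thesis
  proof (rule orbit_coordinates[OF fin s, of K])
    fix r :: "'a \<Rightarrow> 'a" and d :: "'a \<Rightarrow> nat"
    assume r: "\<And>x. r x \<in> orbit s x" "\<And>x. K \<inter> orbit s x \<noteq> {} \<Longrightarrow> r x \<in> K" "\<And>x y. y \<in> orbit s x \<Longrightarrow> r y = r x"
      and d: "\<And>x. (s ^^ d x) (r x) = x" "\<And>x. s x \<noteq> r x \<Longrightarrow> d (s x) = Suc (d x)" "\<And>x. x = r x \<Longrightarrow> d x = 0" "\<And>x. x \<in> V \<Longrightarrow> d x < card V"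
    obtain e :: "'a \<Rightarrow> nat" where e: "inj_on e V" using finite_imp_inj_to_nat_seg[OF fin] by blast
    have rV: "r x \<in> V" if "x \<in> V" for x using r(1)[of x] orbit_subset_carrier[OF s that] by blast
    show ?thesis
    proof (rule that[of "\<lambda>x. card V * e (r x) + d x"])
      show "inj_on (\<lambda>x. card V * e (r x) + d x) V"
      proof (rule inj_onI)
        fix x y assume xy: "x \<in> V" "y \<in> V" "card V * e (r x) + d x = card V * e (r y) + d y"
        have "(card V * e (r x) + d x) div card V = e (r x)" "(card V * e (r x) + d x) mod card V = d x"
          "(card V * e (r y) + d y) div card V = e (r y)" "(card V * e (r y) + d y) mod card V = d y"
          using d(4)[OF xy(1)] d(4)[OF xy(2)] by (simp_all add: div_add1_eq)
        then have "e (r x) = e (r y)" "d x = d y" using xy(3) by simp_all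
        then show "x = y" using d(1) e rV xy(1,2) by (metis inj_onD)
      qed
      fix x assume x: "x \<in> V" "x \<notin> K" "s x \<notin> K" "s x \<noteq> x"
      have rs: "r (s x) = r x" by (rule r(3)[OF orbit.base])
      show "card V * e (r (s x)) + d (s x) = Suc (card V * e (r x) + d x) \<or>
          card V * e (r x) + d x = Suc (card V * e (r (s x)) + d (s x))"
      proof (cases "s x = r x")
        case False then show ?thesis using d(2) rs by simp
      next
        case True
        then have "K \<inter> orbit s x = {}" using r(2) x(3) by force
        then have small: "card (orbit s x) < 3" using K[OF x(1)] by (meson not_le)
        have "s (s x) = x"
        proof (rule ccontr)
          assume ne: "s (s x) \<noteq> x"
          have "{x, s x, s (s x)} \<subseteq> orbit s x"
            using orbit_self[OF fin s, of x] orbit.base[of s x] orbit.step[OF orbit.base, of s x] by auto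
          moreover have "card {x, s x, s (s x)} = 3"
            using ne x(4) permutes_inj[OF s] by (auto simp: card_insert_if inj_eq)
          moreover have "finite (orbit s x)" using orbit_subset_carrier[OF s x(1)] fin by (rule finite_subset)
          ultimately show False using small by (metis card_mono not_le)
        qed
        then have "d x = Suc (d (s x))" using d(2)[of "s x"] rs True x(4) by simp
        then show ?thesis using rs by simp
      qed
    qed
  qed
qed

text \<open>As \<open>W\<close> contains no whole cycle of length at least 3, its points can be
  numbered so that all links of \<open>s\<close> inside \<open>W\<close> join consecutive numbers;
  the fibres of \<open>f\<close> become the triples of the path.\<close>

lemma permutation_triples_colouring:
  fixes f :: "'a \<Rightarrow> 'b"
  assumes fin: "finite V" and s: "s permutes V" and W: "W \<subseteq> V"
    and hit: "\<And>x. x \<in> V \<Longrightarrow> 3 \<le> card (orbit s x) \<Longrightarrow> \<not> orbit s x \<subseteq> W"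
    and f: "\<And>y. card {x\<in>W. f x = y} \<le> 3"
  obtains c :: "'a \<Rightarrow> nat" where "\<And>x. c x < 3" "\<And>x. x \<in> W \<Longrightarrow> s x \<in> W \<Longrightarrow> s x \<noteq> x \<Longrightarrow> c x \<noteq> c (s x)"
    "\<And>x y. x \<in> W \<Longrightarrow> y \<in> W \<Longrightarrow> f x = f y \<Longrightarrow> x \<noteq> y \<Longrightarrow> c x \<noteq> c y"
proof -
  have "(V - W) \<inter> orbit s x \<noteq> {}" if "x \<in> V" "3 \<le> card (orbit s x)" for x
    using hit[OF that] orbit_subset_carrier[OF s that(1)] by blast
  then obtain h :: "'a \<Rightarrow> nat" where h: "inj_on h V"
    "\<And>x. x \<in> V \<Longrightarrow> x \<notin> V - W \<Longrightarrow> s x \<notin> V - W \<Longrightarrow> s x \<noteq> x \<Longrightarrow> h (s x) = Suc (h x) \<or> h x = Suc (h (s x))"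
    using permutation_order[OF fin s, of "V - W"] by blast
  define n where "n = Suc (Max (h ` V))"
  have hn: "h x < n" if "x \<in> V" for x using fin that by (simp add: n_def less_Suc_eq_le)
  \<comment> \<open>Numbers that belong to no point of \<open>W\<close>, such as the gaps in the
    numbering, get labels of their own and so cause no clique condition.\<close>
  define F where "F u = (if u \<in> h ` W then Inl (f (inv_into W h u)) else Inr u)" for u
  have injW: "inj_on h W" using h(1) W by (rule inj_on_subset)
  have F_h: "F (h x) = Inl (f x)" if "x \<in> W" for x using that injW by (simp add: F_def)
  have "card {u. u < n \<and> F u = y} \<le> 3" for y
  proof (cases y)
    case (Inl z)
    have "{u. u < n \<and> F u = y} \<subseteq> h ` {x\<in>W. f x = z}"
    proof
      fix u assume u: "u \<in> {u. u < n \<and> F u = y}"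
      then have "u \<in> h ` W" using Inl by (simp add: F_def split: if_splits)
      then obtain x where x: "u = h x" "x \<in> W" by (rule imageE)
      then have "f x = z" using F_h[OF x(2)] u Inl by simp
      then show "u \<in> h ` {x\<in>W. f x = z}" using x by blast
    qed
    then have "card {u. u < n \<and> F u = y} \<le> card {x\<in>W. f x = z}"
      using finite_subset[OF W fin] by (intro surj_card_le) auto
    then show ?thesis using f[of z] by simp
  next
    case (Inr z)
    then have "{u. u < n \<and> F u = y} \<subseteq> {z}" by (auto simp: F_def split: if_splits)
    then have "card {u. u < n \<and> F u = y} \<le> card {z}" by (intro card_mono) auto
    then show ?thesis by simp
  qed
  then obtain c :: "nat \<Rightarrow> nat" where c: "\<And>v. c v < 3" "\<And>v. Suc v < n \<Longrightarrow> c v \<noteq> c (Suc v)"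
      "\<And>u v. u < n \<Longrightarrow> v < n \<Longrightarrow> F u = F v \<Longrightarrow> u \<noteq> v \<Longrightarrow> c u \<noteq> c v"
    using path_triples_colouring[of n F] by blast
  show ?thesis
  proof (rule that[of "c \<circ> h"])
    show "(c \<circ> h) x < 3" for x by (simp add: c(1))
    show "(c \<circ> h) x \<noteq> (c \<circ> h) (s x)" if "x \<in> W" "s x \<in> W" "s x \<noteq> x" for x
    proof -
      have V: "x \<in> V" "s x \<in> V" using that W by auto
      have "h (s x) = Suc (h x) \<or> h x = Suc (h (s x))" using h(2)[of x] that V by simp
      then show ?thesis
      proof
        assume "h (s x) = Suc (h x)"
        then show ?thesis using c(2)[of "h x"] hn[OF V(2)] by simp
      next
        assume "h x = Suc (h (s x))"
        then show ?thesis using c(2)[of "h (s x)"] hn[OF V(1)] by simp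
      qed
    qed
    show "(c \<circ> h) x \<noteq> (c \<circ> h) y" if "x \<in> W" "y \<in> W" "f x = f y" "x \<noteq> y" for x y
      using c(3)[of "h x" "h y"] hn F_h injW that W by (auto simp: inj_on_eq_iff)
  qed
qed

section \<open>Deleting a quarter of the triangles\<close>

text \<open>The graph enters only through \<open>s\<close>, whose links cover the edges of
  \<open>H\<close>, and through \<open>f\<close>, whose fibres contain the cliques.\<close>

definition good_colouring :: "('a \<Rightarrow> 'a) \<Rightarrow> ('a \<Rightarrow> 'b) \<Rightarrow> 'a set \<Rightarrow> ('a \<Rightarrow> nat) \<Rightarrow> bool" where
  "good_colouring s f W c \<longleftrightarrow> (\<forall>x\<in>W. c x < 4) \<and> (\<forall>x\<in>W. s x \<in> W \<longrightarrow> s x \<noteq> x \<longrightarrow> c x \<noteq> c (s x))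
     \<and> (\<forall>x\<in>W. \<forall>y\<in>W. f x = f y \<longrightarrow> x \<noteq> y \<longrightarrow> c x \<noteq> c y)"

text \<open>Thin every cycle of length at least 3 to at most 4 points and 4-colour these so that
  fibres and cycles are coloured injectively; each colour class is then a common transversal. A
  cycle of length at least 4 meets all four classes, a triangle misses exactly one, and some class
  does no worse than the average.\<close>

lemma common_transversal:
  fixes f :: "'a \<Rightarrow> 'b"
  assumes fin: "finite V" and s: "s permutes V" and f: "\<And>y. card {x\<in>V. f x = y} \<le> 4"
  obtains S where "S \<subseteq> V" "inj_on f S" "inj_on (orbit s) S"
    "4 * card {C \<in> orbit s ` V. 3 \<le> card C \<and> C \<inter> S = {}} \<le> card {C \<in> orbit s ` V. card C = 3}"
proof -
  define \<O> where "\<O> = {C \<in> orbit s ` V. 3 \<le> card C}"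
  have fin\<O>: "finite \<O>" using fin by (simp add: \<O>_def)
  have sub: "C \<subseteq> V" if "C \<in> \<O>" for C using that orbit_subset_carrier[OF s] by (auto simp: \<O>_def)
  have eq: "orbit s x = C" if "C \<in> \<O>" "x \<in> C" for x C
    using that orbit_eq_of_mem[OF fin s] by (auto simp: \<O>_def)
  have "\<exists>T. T \<subseteq> C \<and> card T = min 4 (card C)" for C :: "'a set"
    using obtain_subset_with_card_n[of "min 4 (card C)" C] by (metis min.cobounded2)
  then obtain T :: "'a set \<Rightarrow> 'a set" where T: "\<And>C. T C \<subseteq> C" "\<And>C. card (T C) = min 4 (card C)" by metis
  define U where "U = (\<Union>C\<in>\<O>. T C)"
  have UV: "U \<subseteq> V" using sub T(1) by (auto simp: U_def)
  then have finU: "finite U" using fin by (rule finite_subset)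
  have fib: "{x\<in>U. orbit s x = C} = (if C \<in> \<O> then T C else {})" for C
    using eq T(1) by (auto simp: U_def)
  have "card {x\<in>U. f x = y} \<le> 4" for y
    using card_mono[of "{x\<in>V. f x = y}" "{x\<in>U. f x = y}"] f[of y] UV fin by fastforce
  moreover have "card {x\<in>U. orbit s x = C} \<le> 4" for C
    using T(2)[of C] by (simp add: fib)
  ultimately obtain \<kappa> :: "'a \<Rightarrow> nat" where \<kappa>: "\<And>x. \<kappa> x < 4"
    "\<And>x y. x \<in> U \<Longrightarrow> y \<in> U \<Longrightarrow> x \<noteq> y \<Longrightarrow> f x = f y \<or> orbit s x = orbit s y \<Longrightarrow> \<kappa> x \<noteq> \<kappa> y"
    using common_four_colouring[OF finU, of f "orbit s"] by blast
  define S where "S j = {x\<in>U. \<kappa> x = j}" for j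
  have miss: "card {j. j < 4 \<and> C \<inter> S j = {}} = of_bool (card C = 3)" if C: "C \<in> \<O>" for C
  proof -
    have CU: "C \<inter> U = T C" using fib[of C] eq[OF C] C T(1)[of C] by auto
    have "{j. j < 4 \<and> C \<inter> S j = {}} = {..<4} - \<kappa> ` T C"
      using CU by (auto simp: S_def)
    moreover have "inj_on \<kappa> (T C)"
    proof (rule inj_onI)
      fix x y assume xy: "x \<in> T C" "y \<in> T C" "\<kappa> x = \<kappa> y"
      then have "x \<in> U" "y \<in> U" using C by (auto simp: U_def)
      moreover have "orbit s x = orbit s y" using eq[OF C] T(1)[of C] xy by blast
      ultimately show "x = y" using \<kappa>(2) xy(3) by blast
    qed
    moreover have "\<kappa> ` T C \<subseteq> {..<4}" using \<kappa>(1) by auto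
    moreover have "finite (T C)" using CU finU by (metis finite_Int)
    ultimately have "card {j. j < 4 \<and> C \<inter> S j = {}} = 4 - min 4 (card C)"
      by (simp add: card_Diff_subset card_image T(2))
    then show ?thesis using C by (auto simp: \<O>_def)
  qed
  have "(\<Sum>j<4. card {C\<in>\<O>. C \<inter> S j = {}}) = (\<Sum>j<4. \<Sum>C\<in>\<O>. of_bool (C \<inter> S j = {}))"
    using fin\<O> by (simp add: Collect_conj_eq Int_commute)
  also have "\<dots> = (\<Sum>C\<in>\<O>. \<Sum>j<4. of_bool (C \<inter> S j = {}))" by (rule sum.swap)
  also have "\<dots> = (\<Sum>C\<in>\<O>. card {j. j < 4 \<and> C \<inter> S j = {}})"
    by (simp add: Collect_conj_eq lessThan_def)
  also have "\<dots> = (\<Sum>C\<in>\<O>. of_bool (card C = 3))" using miss by (rule sum.cong[OF refl])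
  also have "\<dots> = card {C\<in>\<O>. card C = 3}"
    using fin\<O> by (simp add: Collect_conj_eq Int_commute)
  finally have total: "(\<Sum>j<4. card {C\<in>\<O>. C \<inter> S j = {}}) = card {C\<in>\<O>. card C = 3}" .
  have "\<exists>j<4. 4 * card {C\<in>\<O>. C \<inter> S j = {}} \<le> card {C\<in>\<O>. card C = 3}"
  proof (rule ccontr)
    assume "\<not> ?thesis"
    then have "card {C\<in>\<O>. card C = 3} < 4 * card {C\<in>\<O>. C \<inter> S j = {}}" if "j < 4" for j
      using that by (meson not_le)
    then have "(\<Sum>j<4::nat. card {C\<in>\<O>. card C = 3}) < (\<Sum>j<4. 4 * card {C\<in>\<O>. C \<inter> S j = {}})"
      by (intro sum_strict_mono) (auto simp: lessThan_empty_iff)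
    then show False using total by (simp add: sum_distrib_left[symmetric])
  qed
  then obtain j where j: "4 * card {C\<in>\<O>. C \<inter> S j = {}} \<le> card {C\<in>\<O>. card C = 3}" by blast
  show ?thesis
  proof (rule that[of "S j"])
    show "S j \<subseteq> V" using UV by (auto simp: S_def)
    show "inj_on f (S j)" "inj_on (orbit s) (S j)" using \<kappa>(2) unfolding S_def inj_on_def by blast+
    have "{C \<in> \<O>. card C = 3} = {C \<in> orbit s ` V. card C = 3}" by (auto simp: \<O>_def)
    moreover have "{C \<in> \<O>. C \<inter> S j = {}} = {C \<in> orbit s ` V. 3 \<le> card C \<and> C \<inter> S j = {}}" by (auto simp: \<O>_def)
    ultimately show "4 * card {C \<in> orbit s ` V. 3 \<le> card C \<and> C \<inter> S j = {}} \<le> card {C \<in> orbit s ` V. card C = 3}"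
      using j by simp
  qed
qed

lemma four_colouring_few_triangles:
  fixes f :: "'a \<Rightarrow> 'b"
  assumes fin: "finite V" and s: "s permutes V" and f: "\<And>y. card {x\<in>V. f x = y} \<le> 4"
  obtains Z c where "Z \<subseteq> V" "4 * card Z \<le> card {C \<in> orbit s ` V. card C = 3}" "good_colouring s f (V - Z) c"
proof -
  note self = orbit_self[OF fin s] and eq = orbit_eq_of_mem[OF fin s]
  obtain S where S: "S \<subseteq> V" "inj_on f S" "inj_on (orbit s) S"
    "4 * card {C \<in> orbit s ` V. 3 \<le> card C \<and> C \<inter> S = {}} \<le> card {C \<in> orbit s ` V. card C = 3}"
    by (rule common_transversal[OF fin s f])
  define \<M> where "\<M> = {C \<in> orbit s ` V. 3 \<le> card C \<and> C \<inter> S = {}}"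
  have fin\<M>: "finite \<M>" using fin by (simp add: \<M>_def)
  define z where "z C = (SOME x. x \<in> C)" for C :: "'a set"
  have z: "z C \<in> C" if "C \<in> \<M>" for C
    using that self unfolding z_def \<M>_def by (intro someI_ex[of "\<lambda>x. x \<in> C"]) auto
  define Z where "Z = z ` \<M>"
  have ZV: "Z \<subseteq> V" using z orbit_subset_carrier[OF s] unfolding Z_def \<M>_def by fastforce
  have SZ: "S \<inter> Z = {}" using z by (auto simp: Z_def \<M>_def)
  define W where "W = V - Z"
  have finW: "finite W" using fin by (simp add: W_def)
  have SW: "S \<subseteq> W" using S(1) SZ by (auto simp: W_def)
  have hit: "orbit s x \<inter> (Z \<union> S) \<noteq> {}" if "x \<in> V" "3 \<le> card (orbit s x)" for x
  proof (cases "orbit s x \<inter> S = {}")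
    case True
    then have "orbit s x \<in> \<M>" using that by (simp add: \<M>_def)
    then show ?thesis using z unfolding Z_def by blast
  qed auto
  have f3: "card {x\<in>W. f x = y} \<le> 4" for y
  proof -
    have "card {x\<in>W. f x = y} \<le> card {x\<in>V. f x = y}" using fin by (intro card_mono) (auto simp: W_def)
    then show ?thesis using f[of y] by simp
  qed
  \<comment> \<open>Only fibres that kept all four points must give one up before three colours can
    suffice.\<close>
  define full where "full y \<longleftrightarrow> card {x\<in>W. f x = y} = 4" for y
  define good where "good I \<longleftrightarrow> I \<subseteq> W \<and> (\<forall>x\<in>I. s x \<in> I \<longrightarrow> s x = x) \<and> inj_on f I \<and> (\<forall>y. full y \<longrightarrow> y \<in> f ` I)" for I
  have "\<exists>I. good I"
  proof -
    define j where "j y = (SOME x. x \<in> W \<and> f x = y)" for y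
    have j: "j y \<in> W" "f (j y) = y" if "full y" for y
    proof -
      have "{x\<in>W. f x = y} \<noteq> {}"
      proof
        assume "{x\<in>W. f x = y} = {}"
        then have "card {x\<in>W. f x = y} = 0" by (simp only: card.empty)
        then show False using that by (simp add: full_def)
      qed
      then have "\<exists>x. x \<in> W \<and> f x = y" by blast
      then have "j y \<in> W \<and> f (j y) = y" unfolding j_def by (rule someI_ex)
      then show "j y \<in> W" "f (j y) = y" by auto
    qed
    \<comment> \<open>\<open>S\<close> is enlarged by one point for every full fibre that it misses.
      Outside \<open>Z\<close> and \<open>J\<close>, full fibres have exactly 3 points, the others
      at most 3, and no cycle of length at least 3 is whole.\<close>
    define J where "J = S \<union> j ` {y. full y \<and> y \<notin> f ` S}"
    define W1 where "W1 = W - J"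
    have card1: "card {x\<in>W1. f x = y} \<le> 3 \<and> (full y \<longrightarrow> card {x\<in>W1. f x = y} = 3)" for y
    proof (cases "full y")
      case True
      obtain x0 where x0: "{x\<in>J. f x = y} = {x0}"
      proof (cases "y \<in> f ` S")
        case True
        then obtain x0 where "x0 \<in> S" "f x0 = y" by blast
        then have "{x\<in>J. f x = y} = {x0}" using S(2) j True by (auto simp: J_def inj_on_def)
        then show ?thesis by (rule that)
      next
        case False
        then have "{x\<in>J. f x = y} = {j y}" using j \<open>full y\<close> by (auto simp: J_def)
        then show ?thesis by (rule that)
      qed
      have "x0 \<in> W" "f x0 = y" using x0 SW j by (auto simp: J_def)
      have "{x\<in>W1. f x = y} = {x\<in>W. f x = y} - {x0}" using x0 by (auto simp: W1_def)
      then have "card {x\<in>W1. f x = y} = 3"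
        using True \<open>x0 \<in> W\<close> \<open>f x0 = y\<close> finW by (simp add: full_def)
      then show ?thesis by simp
    next
      case False
      have "card {x\<in>W1. f x = y} \<le> card {x\<in>W. f x = y}" using finW by (intro card_mono) (auto simp: W1_def)
      then show ?thesis using False f3[of y] by (simp add: full_def)
    qed
    have W1V: "W1 \<subseteq> V" by (auto simp: W1_def W_def)
    have "\<not> orbit s x \<subseteq> W1" if "x \<in> V" "3 \<le> card (orbit s x)" for x
      using hit[OF that] by (auto simp: W1_def W_def J_def)
    then obtain c :: "'a \<Rightarrow> nat" where c: "\<And>x. c x < 3" "\<And>x. x \<in> W1 \<Longrightarrow> s x \<in> W1 \<Longrightarrow> s x \<noteq> x \<Longrightarrow> c x \<noteq> c (s x)"
      "\<And>x y. x \<in> W1 \<Longrightarrow> y \<in> W1 \<Longrightarrow> f x = f y \<Longrightarrow> x \<noteq> y \<Longrightarrow> c x \<noteq> c y"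
      using permutation_triples_colouring[OF fin s W1V, of f] card1 by blast
    \<comment> \<open>One class of the 3-colouring. The three remaining points of a full fibre use
      all three colours, so the class meets the fibre.\<close>
    define I where "I = {x\<in>W1. c x = 0}"
    have "y \<in> f ` I" if "full y" for y
    proof -
      let ?F = "{x\<in>W1. f x = y}"
      have "inj_on c ?F" using c(3) unfolding inj_on_def by blast
      then have "card (c ` ?F) = 3" using card1[of y] that by (simp add: card_image)
      moreover have "c ` ?F \<subseteq> {..<3}" using c(1) by auto
      ultimately have "c ` ?F = {..<3}" by (intro card_subset_eq) auto
      then have "0 \<in> c ` ?F" by auto
      then obtain x where "x \<in> ?F" "0 = c x" by (rule imageE)
      then show ?thesis by (auto simp: I_def)
    qed
    moreover have "I \<subseteq> W" by (auto simp: I_def W1_def)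
    moreover have "\<forall>x\<in>I. s x \<in> I \<longrightarrow> s x = x"
    proof (intro ballI impI)
      fix x assume "x \<in> I" "s x \<in> I"
      then show "s x = x" using c(2)[of x] by (auto simp: I_def)
    qed
    moreover have "inj_on f I"
    proof (rule inj_onI, rule ccontr)
      fix x y assume "x \<in> I" "y \<in> I" "f x = f y" "x \<noteq> y"
      then show False using c(3)[of x y] by (simp add: I_def)
    qed
    ultimately show ?thesis unfolding good_def by blast
  qed
  moreover have "\<forall>I. good I \<longrightarrow> card (I \<inter> S) < Suc (card V)"
    using card_mono[OF fin] S(1) by (meson Int_lower2 le_imp_less_Suc order_trans)
  ultimately obtain I where I: "good I" "\<And>I'. good I' \<Longrightarrow> card (I' \<inter> S) \<le> card (I \<inter> S)"
    using ex_has_greatest_nat[of good _ "\<lambda>I. card (I \<inter> S)" "Suc (card V)"] by blast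
  have IW: "I \<subseteq> W" and Ii: "\<And>x. x \<in> I \<Longrightarrow> s x \<in> I \<Longrightarrow> s x = x" and If: "inj_on f I" and Ifull: "\<And>y. full y \<Longrightarrow> y \<in> f ` I"
    using I(1) by (auto simp: good_def)
  have hitI: "I \<inter> orbit s v \<noteq> {}" if v: "v \<in> S" for v
  proof
    assume empty: "I \<inter> orbit s v = {}"
    have vI: "v \<notin> I" using empty self by blast
    \<comment> \<open>The exchange: \<open>v\<close> replaces the point of \<open>I\<close> in its
      fibre, if there is one. The neighbours of \<open>v\<close> lie on its cycle, which
      \<open>I\<close> misses, so independence survives. The point given up is not in
      \<open>S\<close>, since \<open>f\<close> is injective on \<open>S\<close>, so
      \<open>I'\<close> meets \<open>S\<close> in one point more.\<close>
    define I' where "I' = insert v (I - {x. f x = f v})"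
    have "good I'"
      unfolding good_def
    proof (intro conjI ballI allI impI)
      show "I' \<subseteq> W" using IW SW v by (auto simp: I'_def)
      show "inj_on f I'" using If by (auto simp: I'_def inj_on_def)
      show "y \<in> f ` I'" if "full y" for y using Ifull[OF that] by (auto simp: I'_def)
      fix x assume x: "x \<in> I'" "s x \<in> I'"
      consider "x = v" "s x = v" | "x = v" "s x \<in> I" | "x \<in> I" "s x = v" | "x \<in> I" "s x \<in> I"
        using x by (auto simp: I'_def)
      then show "s x = x"
      proof cases
        case 2 then show ?thesis using empty orbit.base[of s v] by auto
      next
        case 3
        then have "orbit s v = orbit s x" using eq orbit.base[of s x] by metis
        then show ?thesis using 3 empty self[of x] by auto
      qed (use Ii in auto)
    qed
    then have "card (I' \<inter> S) \<le> card (I \<inter> S)" by (rule I(2))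
    moreover have "I' \<inter> S = insert v (I \<inter> S)"
    proof -
      have "f x \<noteq> f v" if "x \<in> I \<inter> S" for x using that vI v S(2) by (metis IntD1 IntD2 inj_onD)
      then show ?thesis using v by (auto simp: I'_def)
    qed
    moreover have "finite (I \<inter> S)" using IW finW finite_subset by blast
    ultimately show False using vI by simp
  qed
  \<comment> \<open>Cycles of length at least 3 that \<open>Z\<close> does not break contain a point
    of \<open>S\<close> and hence one of \<open>I\<close>; full fibres go down to 3 points. The
    points of \<open>I\<close> will form the fourth colour class.\<close>
  define W2 where "W2 = W - I"
  have W2V: "W2 \<subseteq> V" by (auto simp: W2_def W_def)
  have "\<not> orbit s x \<subseteq> W2" if x: "x \<in> V" "3 \<le> card (orbit s x)" for x
  proof -
    obtain v where v: "v \<in> orbit s x" "v \<in> Z \<union> S" using hit[OF x] by blast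
    show ?thesis
    proof (cases "v \<in> Z")
      case True then show ?thesis using v by (auto simp: W2_def W_def)
    next
      case False
      then have "I \<inter> orbit s x \<noteq> {}" using hitI[of v] v eq[OF v(1)] by auto
      then show ?thesis by (auto simp: W2_def)
    qed
  qed
  moreover have "card {x\<in>W2. f x = y} \<le> 3" for y
  proof (cases "full y")
    case True
    then obtain x where x: "x \<in> I" "f x = y" using Ifull by blast
    then have "{x\<in>W2. f x = y} \<subset> {x\<in>W. f x = y}" using IW by (auto simp: W2_def)
    then have "card {x\<in>W2. f x = y} < card {x\<in>W. f x = y}" using finW by (intro psubset_card_mono) auto
    then show ?thesis using True by (simp add: full_def)
  next
    case False
    have "card {x\<in>W2. f x = y} \<le> card {x\<in>W. f x = y}" using finW by (intro card_mono) (auto simp: W2_def)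
    then show ?thesis using False f3[of y] by (simp add: full_def)
  qed
  ultimately obtain c :: "'a \<Rightarrow> nat" where c: "\<And>x. c x < 3" "\<And>x. x \<in> W2 \<Longrightarrow> s x \<in> W2 \<Longrightarrow> s x \<noteq> x \<Longrightarrow> c x \<noteq> c (s x)"
    "\<And>x y. x \<in> W2 \<Longrightarrow> y \<in> W2 \<Longrightarrow> f x = f y \<Longrightarrow> x \<noteq> y \<Longrightarrow> c x \<noteq> c y"
    using permutation_triples_colouring[OF fin s W2V, of f] by blast
  define d where "d x = (if x \<in> I then 3 else c x)" for x
  have "good_colouring s f (V - Z) d"
    unfolding good_colouring_def W_def[symmetric]
  proof (intro conjI ballI impI)
    show "d x < 4" for x using c(1)[of x] by (simp add: d_def)
    show "d x \<noteq> d (s x)" if "x \<in> W" "s x \<in> W" "s x \<noteq> x" for x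
      using that c(1)[of x] c(1)[of "s x"] c(2)[of x] Ii[of x] by (auto simp: d_def W2_def)
    show "d x \<noteq> d y" if "x \<in> W" "y \<in> W" "f x = f y" "x \<noteq> y" for x y
      using that c(1)[of x] c(1)[of y] c(3)[of x y] inj_onD[OF If, of x y] by (auto simp: d_def W2_def)
  qed
  moreover have "card Z \<le> card \<M>" unfolding Z_def using fin\<M> by (rule card_image_le)
  then have "4 * card Z \<le> card {C \<in> orbit s ` V. card C = 3}" using S(4) by (simp add: \<M>_def)
  ultimately show ?thesis using that[OF ZV] by blast
qed

section \<open>Deleting half of the long odd cycles\<close>

definition near_matching :: "'a set \<Rightarrow> ('a \<Rightarrow> 'a) \<Rightarrow> ('a \<Rightarrow> 'a) \<Rightarrow> bool" where
  "near_matching V s \<beta> \<longleftrightarrow> pairing V \<beta> \<and> (\<forall>x\<in>V. \<beta> x = x \<or> \<beta> x = s x \<or> x = s (\<beta> x))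
     \<and> (\<forall>x\<in>V. \<forall>y\<in>orbit s x. \<beta> x = x \<longrightarrow> \<beta> y = y \<longrightarrow> y = x)"

text \<open>Unions of components of the graph formed by the pairings \<open>\<pi>\<close> and
  \<open>\<beta>\<close>. Two separating sets differ by an invariant set, and changing a separating
  set by an invariant one leaves it separating. So there are as many of these as there are
  2-colourings, and they are easier to compare when \<open>\<beta>\<close> varies.\<close>

definition invariant_sets :: "'a set \<Rightarrow> ('a \<Rightarrow> 'a) \<Rightarrow> ('a \<Rightarrow> 'a) \<Rightarrow> 'a set set" where
  "invariant_sets V \<pi> \<beta> = {X \<in> Pow V. \<forall>x\<in>V. (\<pi> x \<in> X \<longleftrightarrow> x \<in> X) \<and> (\<beta> x \<in> X \<longleftrightarrow> x \<in> X)}"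

definition separating_sets :: "'a set \<Rightarrow> ('a \<Rightarrow> 'a) \<Rightarrow> ('a \<Rightarrow> 'a) \<Rightarrow> 'a set set" where
  "separating_sets V \<pi> \<beta> = {X \<in> Pow V. separates V (\<lambda>x. x \<in> X) \<pi> \<and> separates V (\<lambda>x. x \<in> X) \<beta>}"

definition uniform_at :: "('a \<Rightarrow> 'a) \<Rightarrow> 'a set \<Rightarrow> 'a \<Rightarrow> bool" where
  "uniform_at s X m \<longleftrightarrow> (s m \<in> X \<longleftrightarrow> m \<in> X) \<and> (inv s m \<in> X \<longleftrightarrow> m \<in> X)"

definition free_points :: "'a set \<Rightarrow> ('a \<Rightarrow> 'a) \<Rightarrow> ('a \<Rightarrow> 'a) \<Rightarrow> 'a set" where
  "free_points V s \<beta> = {m \<in> V. \<beta> m = m \<and> 4 \<le> card (orbit s m)}"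

text \<open>Changing a 2-colouring by a set that is uniform at \<open>m\<close> does not affect
  whether the colouring is uniform at \<open>m\<close>. At a tied point all 2-colourings therefore
  agree in this respect.\<close>

definition tied_points :: "'a set \<Rightarrow> ('a \<Rightarrow> 'a) \<Rightarrow> ('a \<Rightarrow> 'a) \<Rightarrow> ('a \<Rightarrow> 'a) \<Rightarrow> 'a set" where
  "tied_points V s \<pi> \<beta> = {m \<in> free_points V s \<beta>. \<forall>X\<in>invariant_sets V \<pi> \<beta>. uniform_at s X m}"

text \<open>The gap moves two steps along its cycle: \<open>s m\<close>, hitherto matched to
  \<open>s (s m)\<close>, is matched to \<open>m\<close> instead.\<close>

definition shift :: "('a \<Rightarrow> 'a) \<Rightarrow> ('a \<Rightarrow> 'a) \<Rightarrow> 'a \<Rightarrow> 'a \<Rightarrow> 'a" where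
  "shift s \<beta> m = \<beta>(m := s m, s m := m, s (s m) := s (s m))"

lemma near_matchingD:
  assumes "near_matching V s \<beta>"
  shows "pairing V \<beta>" "x \<in> V \<Longrightarrow> \<beta> x = x \<or> \<beta> x = s x \<or> x = s (\<beta> x)"
    "x \<in> V \<Longrightarrow> y \<in> orbit s x \<Longrightarrow> \<beta> x = x \<Longrightarrow> \<beta> y = y \<Longrightarrow> y = x"
  using assms unfolding near_matching_def by blast+

context
  fixes V :: "'a set" and s :: "'a \<Rightarrow> 'a"
  assumes fin: "finite V" and s: "s permutes V"
begin

lemma near_matching_orbit:
  assumes "near_matching V s \<beta>" "x \<in> V"
  shows "\<beta> x \<in> orbit s x"
proof -
  have "x \<in> orbit s x" by (rule orbit_self[OF fin s])
  moreover have "s x \<in> orbit s x" by (rule orbit.base)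
  moreover have "y \<in> orbit s x" if "x = s y" for y
  proof -
    have "x \<in> orbit s y" using that by (simp add: orbit.base)
    then have "orbit s x = orbit s y" by (rule orbit_eq_of_mem[OF fin s])
    then show ?thesis using orbit_self[OF fin s, of y] by simp
  qed
  ultimately show ?thesis using near_matchingD(2)[OF assms] by metis
qed

text \<open>Number each cycle from a representative, starting with 0, and match even positions to
  their successors. The last position stays unmatched if its number is even, that is, if the cycle
  is odd.\<close>

lemma near_matching_exists: "\<exists>\<beta>. near_matching V s \<beta>"
proof (rule orbit_coordinates[OF fin s, of "{}"])
  fix r :: "'a \<Rightarrow> 'a" and d :: "'a \<Rightarrow> nat"
  assume r: "\<And>x. r x \<in> orbit s x" "\<And>x y. y \<in> orbit s x \<Longrightarrow> r y = r x"
    and d: "\<And>x. s x \<noteq> r x \<Longrightarrow> d (s x) = Suc (d x)" "\<And>x. x = r x \<Longrightarrow> d x = 0"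
  have inj: "s x = s y \<longleftrightarrow> x = y" for x y using permutes_inj[OF s] by (auto simp: inj_eq)
  have inv: "s (inv s x) = x" "inv s (s x) = x" for x using permutes_inverses[OF s] by auto
  have rs: "r (s x) = r x" for x by (rule r(2)[OF orbit.base])
  define \<beta> where "\<beta> x = (if even (d x) then (if s x = r x then x else s x) else inv s x)" for x
  have odd: "even (d (inv s x))" "s (inv s x) \<noteq> r (inv s x)" if "odd (d x)" for x
  proof -
    have "x \<noteq> r x" using d(2)[of x] that by auto
    then show *: "s (inv s x) \<noteq> r (inv s x)" using rs[of "inv s x"] by (simp add: inv)
    show "even (d (inv s x))" using d(1)[OF *] that by (simp add: inv)
  qed
  have "\<beta> (\<beta> x) = x" for x
  proof (cases "even (d x)")
    case True
    then show ?thesis using d(1)[of x] by (auto simp: \<beta>_def inv)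
  next
    case False
    then show ?thesis using odd[OF False] by (simp add: \<beta>_def inv)
  qed
  moreover have "\<beta> x \<in> V" if "x \<in> V" for x
    using that permutes_in_image[OF s] permutes_in_image[OF permutes_inv[OF s]] by (auto simp: \<beta>_def)
  moreover have "\<beta> x = x \<or> \<beta> x = s x \<or> x = s (\<beta> x)" for x by (auto simp: \<beta>_def inv)
  moreover have fixed: "s x = r x" if "\<beta> x = x" for x
  proof (rule ccontr)
    assume ne: "s x \<noteq> r x"
    have "s x = x"
    proof (cases "even (d x)")
      case True then show ?thesis using that ne by (simp add: \<beta>_def)
    next
      case False
      then have "inv s x = x" using that by (simp add: \<beta>_def)
      then show ?thesis using inv(1)[of x] by simp
    qed
    then have "orbit s x = {x}" by (simp add: orbit_eq_singleton_iff)
    then show False using r(1)[of x] ne \<open>s x = x\<close> by simp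
  qed
  have "y = x" if "y \<in> orbit s x" "\<beta> x = x" "\<beta> y = y" for x y
    using fixed[OF that(2)] fixed[OF that(3)] r(2)[OF that(1)] inj[of y x] by simp
  ultimately show ?thesis unfolding near_matching_def pairing_def by blast
qed

lemma finite_orbit_carrier: "x \<in> V \<Longrightarrow> finite (orbit s x)"
  using orbit_subset_carrier[OF s] fin finite_subset by metis

lemma orbit_three_distinct:
  assumes "3 \<le> card (orbit s m)"
  shows "s m \<noteq> m" "s (s m) \<noteq> m" "s (s m) \<noteq> s m"
proof -
  have "card (orbit s m) \<le> n" if "(s ^^ n) m = m" "0 < n" for n
  proof -
    have "orbit s m = (\<lambda>i. (s ^^ i) m) ` {..<n}" using orbit_altdef_bounded[OF that] by auto
    then show ?thesis using card_image_le[of "{..<n}" "\<lambda>i. (s ^^ i) m"] by simp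
  qed
  from this[of 1] this[of 2] show "s m \<noteq> m" "s (s m) \<noteq> m"
    using assms by (auto simp: numeral_2_eq_2)
  then show "s (s m) \<noteq> s m" using permutes_inj[OF s] by (simp add: inj_eq)
qed

lemma shift_near_matching:
  assumes \<beta>: "near_matching V s \<beta>" and m: "m \<in> V" "\<beta> m = m" "4 \<le> card (orbit s m)"
  shows "near_matching V s (shift s \<beta> m)"
proof -
  note D = near_matchingD[OF \<beta>]
  have ne: "s m \<noteq> m" "s (s m) \<noteq> m" "s (s m) \<noteq> s m" using orbit_three_distinct m(3) by auto
  have V: "s m \<in> V" "s (s m) \<in> V" using m permutes_in_image[OF s] by auto
  have o: "s m \<in> orbit s m" "s (s m) \<in> orbit s m" by (auto intro: orbit.intros)
  have "\<beta> (s m) \<noteq> s m" using D(3)[OF m(1) o(1) m(2)] ne by blast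
  moreover have "\<beta> (s m) \<noteq> m" using pairingD(2)[OF D(1) V(1)] m(2) ne by auto
  ultimately have b1: "\<beta> (s m) = s (s m)" using D(2)[OF V(1)] permutes_inj[OF s] by (auto simp: inj_eq)
  then have b2: "\<beta> (s (s m)) = s m" using pairingD(2)[OF D(1) V(1)] by simp
  have other: "\<beta> x \<notin> {m, s m, s (s m)}" if "x \<in> V" "x \<notin> {m, s m, s (s m)}" for x
    using pairingD(2)[OF D(1) that(1)] that(2) b1 b2 m(2) by auto
  have "pairing V (shift s \<beta> m)"
    unfolding pairing_def
  proof
    fix x assume x: "x \<in> V"
    show "shift s \<beta> m x \<in> V \<and> shift s \<beta> m (shift s \<beta> m x) = x"
    proof (cases "x \<in> {m, s m, s (s m)}")
      case True then show ?thesis using V m ne by (auto simp: shift_def)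
    next
      case False
      then show ?thesis using other[OF x False] pairingD[OF D(1) x] by (auto simp: shift_def)
    qed
  qed
  moreover have "shift s \<beta> m x = x \<or> shift s \<beta> m x = s x \<or> x = s (shift s \<beta> m x)" if "x \<in> V" for x
    using D(2)[OF that] by (auto simp: shift_def)
  moreover have "y = x" if xy: "x \<in> V" "y \<in> orbit s x" "shift s \<beta> m x = x" "shift s \<beta> m y = y" for x y
  proof -
    have vals: "shift s \<beta> m (s m) = m" "shift s \<beta> m m = s m"
      "z \<noteq> m \<Longrightarrow> z \<noteq> s m \<Longrightarrow> z \<noteq> s (s m) \<Longrightarrow> shift s \<beta> m z = \<beta> z" for z
      using ne by (auto simp: shift_def)
    have fixed: "z = s (s m) \<or> z \<noteq> m \<and> \<beta> z = z" if "shift s \<beta> m z = z" for z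
    proof -
      have "z \<noteq> m" "z \<noteq> s m" using that vals(1,2) ne(1) by force+
      then show ?thesis using vals(3)[of z] that by force
    qed
    note fx = fixed[OF xy(3)] fixed[OF xy(4)]
    have eq: "orbit s y = orbit s x" by (rule orbit_eq_of_mem[OF fin s xy(2)])
    have om: "z \<notin> orbit s m" if "\<beta> z = z" "z \<noteq> m" for z using D(3)[OF m(1) _ m(2) that(1)] that(2) by blast
    have o2: "orbit s (s (s m)) = orbit s m" by (rule orbit_eq_of_mem[OF fin s o(2)])
    show ?thesis
    proof (cases "x = s (s m)")
      case True
      then have "y \<in> orbit s m" using xy(2) o2 by simp
      then show ?thesis using fx(2) om True by auto
    next
      case False
      then have x: "\<beta> x = x" "x \<noteq> m" using fx by auto
      then have "x \<notin> orbit s m" by (rule om)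
      then have "y \<noteq> s (s m)" using eq o2 orbit_self[OF fin s, of x] by auto
      then show ?thesis using fx(2) D(3)[OF xy(1,2) x(1)] by auto
    qed
  qed
  ultimately show ?thesis unfolding near_matching_def by blast
qed

text \<open>The pair \<open>s m\<close>, \<open>s (s m)\<close> is given up, and the new pair
  \<open>m\<close>, \<open>s m\<close> is no constraint on a set that is uniform at
  \<open>m\<close>.\<close>

lemma shift_invariant_sets:
  assumes "m \<in> tied_points V s \<pi> \<beta>"
  shows "invariant_sets V \<pi> \<beta> \<subseteq> invariant_sets V \<pi> (shift s \<beta> m)"
proof
  fix X assume X: "X \<in> invariant_sets V \<pi> \<beta>"
  then have "uniform_at s X m" using assms by (auto simp: tied_points_def)
  then show "X \<in> invariant_sets V \<pi> (shift s \<beta> m)"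
    using X by (auto simp: invariant_sets_def shift_def uniform_at_def)
qed

end

section \<open>Optimal matchings have no tied points\<close>

definition optimal_matching :: "'a set \<Rightarrow> ('a \<Rightarrow> 'a) \<Rightarrow> ('a \<Rightarrow> 'a) \<Rightarrow> ('a \<Rightarrow> 'a) \<Rightarrow> bool" where
  "optimal_matching V s \<pi> \<beta> \<longleftrightarrow> near_matching V s \<beta> \<and> (\<forall>\<gamma>. near_matching V s \<gamma> \<longrightarrow>
     card (invariant_sets V \<pi> \<gamma>) \<le> card (invariant_sets V \<pi> \<beta>) \<and>
     (card (invariant_sets V \<pi> \<gamma>) = card (invariant_sets V \<pi> \<beta>) \<longrightarrow>
        card (tied_points V s \<pi> \<beta>) \<le> card (tied_points V s \<pi> \<gamma>)))"

context
  fixes V :: "'a set" and s \<pi> :: "'a \<Rightarrow> 'a"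
  assumes fin: "finite V" and s: "s permutes V" and \<pi>: "pairing V \<pi>"
begin

lemma finite_invariant_sets: "finite (invariant_sets V \<pi> \<beta>)"
  using fin by (simp add: invariant_sets_def)

lemma optimal_matching_exists: "\<exists>\<beta>. optimal_matching V s \<pi> \<beta>"
proof -
  obtain \<beta>0 where \<beta>0: "near_matching V s \<beta>0" using near_matching_exists[OF fin s] by blast
  have "\<forall>\<gamma>. near_matching V s \<gamma> \<longrightarrow> card (invariant_sets V \<pi> \<gamma>) < Suc (card (Pow V))"
    using fin by (auto simp: less_Suc_eq_le invariant_sets_def intro!: card_mono)
  from ex_has_greatest_nat[of "near_matching V s" \<beta>0 "\<lambda>\<gamma>. card (invariant_sets V \<pi> \<gamma>)", OF \<beta>0 this]
  obtain \<beta>1 where \<beta>1: "near_matching V s \<beta>1"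
    "\<And>\<gamma>. near_matching V s \<gamma> \<Longrightarrow> card (invariant_sets V \<pi> \<gamma>) \<le> card (invariant_sets V \<pi> \<beta>1)" by blast
  define P where "P \<gamma> \<longleftrightarrow> near_matching V s \<gamma> \<and> card (invariant_sets V \<pi> \<gamma>) = card (invariant_sets V \<pi> \<beta>1)" for \<gamma>
  have "P \<beta>1" using \<beta>1(1) by (simp add: P_def)
  from ex_has_least_nat[of P \<beta>1 "\<lambda>\<gamma>. card (tied_points V s \<pi> \<gamma>)", OF this] obtain \<beta> where \<beta>: "P \<beta>"
    "\<And>\<gamma>. P \<gamma> \<Longrightarrow> card (tied_points V s \<pi> \<beta>) \<le> card (tied_points V s \<pi> \<gamma>)" by blast
  have "optimal_matching V s \<pi> \<beta>"
    using \<beta> \<beta>1(2) unfolding optimal_matching_def P_def by simp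
  then show ?thesis by blast
qed

text \<open>The shift can only add invariant sets, so by maximality it adds none. A tied point of
  the shifted matching is the new gap \<open>s (s m)\<close> or an old tied point other than
  \<open>m\<close>; if \<open>s (s m)\<close> were not tied, there would be fewer than the
  minimum.\<close>

lemma optimal_matching_shift:
  assumes opt: "optimal_matching V s \<pi> \<beta>" and m: "m \<in> tied_points V s \<pi> \<beta>"
  shows "optimal_matching V s \<pi> (shift s \<beta> m)" "invariant_sets V \<pi> (shift s \<beta> m) = invariant_sets V \<pi> \<beta>"
    "s (s m) \<in> tied_points V s \<pi> (shift s \<beta> m)"
proof -
  let ?\<beta> = "shift s \<beta> m"
  have \<beta>: "near_matching V s \<beta>" and max: "\<And>\<gamma>. near_matching V s \<gamma> \<Longrightarrow> card (invariant_sets V \<pi> \<gamma>) \<le> card (invariant_sets V \<pi> \<beta>)"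
    and min: "\<And>\<gamma>. near_matching V s \<gamma> \<Longrightarrow> card (invariant_sets V \<pi> \<gamma>) = card (invariant_sets V \<pi> \<beta>) \<Longrightarrow>
        card (tied_points V s \<pi> \<beta>) \<le> card (tied_points V s \<pi> \<gamma>)"
    using opt by (simp_all add: optimal_matching_def)
  have mV: "m \<in> V" "\<beta> m = m" "4 \<le> card (orbit s m)" using m by (auto simp: tied_points_def free_points_def)
  have ne: "s m \<noteq> m" "s (s m) \<noteq> m" "s (s m) \<noteq> s m" using orbit_three_distinct[OF fin s] mV(3) by auto
  have near: "near_matching V s ?\<beta>" by (rule shift_near_matching[OF fin s \<beta> mV])
  show inv: "invariant_sets V \<pi> ?\<beta> = invariant_sets V \<pi> \<beta>"
    using card_seteq[OF finite_invariant_sets shift_invariant_sets[OF fin s m]] max[OF near] by simp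
  have finT: "finite (tied_points V s \<pi> \<gamma>)" for \<gamma> using fin by (simp add: tied_points_def free_points_def)
  have sub: "x \<in> tied_points V s \<pi> \<beta> - {m}" if "x \<in> tied_points V s \<pi> ?\<beta>" "x \<noteq> s (s m)" for x
  proof -
    have x: "x \<in> V" "?\<beta> x = x" "4 \<le> card (orbit s x)" "\<forall>X\<in>invariant_sets V \<pi> \<beta>. uniform_at s X x"
      using that(1) inv by (auto simp: tied_points_def free_points_def)
    have "?\<beta> m = s m" "?\<beta> (s m) = m" using ne by (auto simp: shift_def)
    then have "x \<noteq> m" "x \<noteq> s m" using x(2) ne by auto
    then show ?thesis using x that(2) by (auto simp: tied_points_def free_points_def shift_def)
  qed
  have cardm: "card (tied_points V s \<pi> \<beta> - {m}) < card (tied_points V s \<pi> \<beta>)"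
    using finT m by (rule card_Diff1_less)
  show ss: "s (s m) \<in> tied_points V s \<pi> ?\<beta>"
  proof (rule ccontr)
    assume "s (s m) \<notin> tied_points V s \<pi> ?\<beta>"
    then have "tied_points V s \<pi> ?\<beta> \<subseteq> tied_points V s \<pi> \<beta> - {m}"
    proof (intro subsetI)
      fix x assume x: "x \<in> tied_points V s \<pi> ?\<beta>"
      moreover have "x \<noteq> s (s m)" using x \<open>s (s m) \<notin> tied_points V s \<pi> ?\<beta>\<close> by metis
      ultimately show "x \<in> tied_points V s \<pi> \<beta> - {m}" by (rule sub)
    qed
    then have "card (tied_points V s \<pi> ?\<beta>) \<le> card (tied_points V s \<pi> \<beta> - {m})" using finT by (intro card_mono) auto
    then show False using min[OF near] inv cardm by simp
  qed
  have "tied_points V s \<pi> ?\<beta> \<subseteq> insert (s (s m)) (tied_points V s \<pi> \<beta> - {m})"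
  proof
    fix x assume "x \<in> tied_points V s \<pi> ?\<beta>"
    then show "x \<in> insert (s (s m)) (tied_points V s \<pi> \<beta> - {m})" using sub[of x] by (cases "x = s (s m)") simp_all
  qed
  then have "card (tied_points V s \<pi> ?\<beta>) \<le> card (insert (s (s m)) (tied_points V s \<pi> \<beta> - {m}))"
    using finT by (intro card_mono) auto
  also have "\<dots> \<le> Suc (card (tied_points V s \<pi> \<beta> - {m}))" by (rule card_insert_le_m1) auto
  finally have "card (tied_points V s \<pi> ?\<beta>) \<le> card (tied_points V s \<pi> \<beta>)" using cardm by simp
  then show "optimal_matching V s \<pi> ?\<beta>"
    using near max min inv unfolding optimal_matching_def by (metis order_trans)
qed

lemma optimal_matching_shift_iterated:
  assumes opt: "optimal_matching V s \<pi> \<beta>" and m: "m \<in> tied_points V s \<pi> \<beta>"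
  shows "\<exists>\<gamma>. optimal_matching V s \<pi> \<gamma> \<and> invariant_sets V \<pi> \<gamma> = invariant_sets V \<pi> \<beta> \<and>
     (s ^^ (2 * k)) m \<in> tied_points V s \<pi> \<gamma> \<and> (\<forall>x. x \<notin> orbit s m \<longrightarrow> \<gamma> x = \<beta> x)"
proof (induction k)
  case 0
  then show ?case using opt m by auto
next
  case (Suc k)
  then obtain \<gamma> where \<gamma>: "optimal_matching V s \<pi> \<gamma>" "invariant_sets V \<pi> \<gamma> = invariant_sets V \<pi> \<beta>"
     "(s ^^ (2 * k)) m \<in> tied_points V s \<pi> \<gamma>" "\<forall>x. x \<notin> orbit s m \<longrightarrow> \<gamma> x = \<beta> x" by blast
  let ?m = "(s ^^ (2 * k)) m"
  have o: "?m \<in> orbit s m" by (rule funpow_in_orbit[OF orbit_self[OF fin s]])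
  then have "s ?m \<in> orbit s m" "s (s ?m) \<in> orbit s m" by (auto intro: orbit.step)
  then have "\<forall>x. x \<notin> orbit s m \<longrightarrow> shift s \<gamma> ?m x = \<beta> x"
    using o \<gamma>(4) by (auto simp: shift_def)
  moreover have "(s ^^ (2 * Suc k)) m = s (s ?m)" by simp
  ultimately show ?case using optimal_matching_shift[OF \<gamma>(1,3)] \<gamma>(2) by metis
qed

text \<open>With the edge between \<open>p\<close> and \<open>q\<close> added to
  \<open>\<epsilon>\<close>, the union is still bipartite, by some \<open>\<tau>\<close>. The set
  where \<open>\<sigma>\<close> and \<open>\<tau>\<close> agree is invariant, so it contains both
  points or neither, and \<open>\<sigma>\<close> inherits
  \<open>\<tau> p \<noteq> \<tau> q\<close>.\<close>

lemma tied_fixed_points_separated: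
  assumes \<epsilon>: "pairing V \<epsilon>" and pq: "p \<in> V" "q \<in> V" "p \<noteq> q" "\<epsilon> p = p" "\<epsilon> q = q"
    and tied: "\<And>X. X \<in> invariant_sets V \<pi> \<epsilon> \<Longrightarrow> p \<in> X \<longleftrightarrow> q \<in> X"
    and \<sigma>: "separates V \<sigma> \<pi>" "separates V \<sigma> \<epsilon>"
  shows "\<sigma> p \<noteq> \<sigma> q"
proof -
  let ?\<epsilon> = "\<epsilon>(p := q, q := p)"
  have "pairing V ?\<epsilon>"
    unfolding pairing_def
  proof
    fix x assume x: "x \<in> V"
    show "?\<epsilon> x \<in> V \<and> ?\<epsilon> (?\<epsilon> x) = x"
    proof (cases "x = p \<or> x = q")
      case False
      then have "\<epsilon> x \<noteq> p" "\<epsilon> x \<noteq> q" using pairingD(2)[OF \<epsilon> x] pq(4,5) by auto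
      then show ?thesis using False pairingD[OF \<epsilon> x] by simp
    qed (use pq in auto)
  qed
  then obtain \<tau> where \<tau>: "separates V \<tau> \<pi>" "separates V \<tau> ?\<epsilon>"
    using two_pairings_separable[OF fin \<pi>] by blast
  have "?\<epsilon> q \<noteq> q" "?\<epsilon> q = p" using pq(3) by auto
  then have \<tau>pq: "\<tau> p \<noteq> \<tau> q" using \<tau>(2) pq(2) unfolding separates_def by metis
  have \<tau>\<epsilon>: "separates V \<tau> \<epsilon>"
    unfolding separates_def
  proof (intro ballI impI)
    fix x assume x: "x \<in> V" "\<epsilon> x \<noteq> x"
    then have "x \<noteq> p" "x \<noteq> q" using pq by auto
    then show "\<tau> (\<epsilon> x) \<noteq> \<tau> x" using \<tau>(2) x unfolding separates_def by (metis fun_upd_other)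
  qed
  have "{x \<in> V. \<sigma> x = \<tau> x} \<in> invariant_sets V \<pi> \<epsilon>"
  proof -
    have "\<sigma> (\<alpha> x) = \<tau> (\<alpha> x) \<longleftrightarrow> \<sigma> x = \<tau> x" if "x \<in> V" "separates V \<sigma> \<alpha>" "separates V \<tau> \<alpha>" for x \<alpha>
      using that unfolding separates_def by (cases "\<alpha> x = x") auto
    then show ?thesis using \<sigma> \<tau>(1) \<tau>\<epsilon> pairingD(1)[OF \<pi>] pairingD(1)[OF \<epsilon>] by (auto simp: invariant_sets_def)
  qed
  then have "\<sigma> p = \<tau> p \<longleftrightarrow> \<sigma> q = \<tau> q" using tied[of "{x \<in> V. \<sigma> x = \<tau> x}"] pq by simp
  then show ?thesis using \<tau>pq by auto
qed

text \<open>At a tied point the position of the gap of \<open>\<beta>\<close> can be moved all around its cycle \<open>C\<close>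
  without changing the invariant sets, so every invariant set is constant on \<open>C\<close>. With \<open>\<beta>\<close> erased
  on \<open>C\<close>, three mutually tied points of \<open>C\<close> would have pairwise different colours; as \<open>C\<close> is odd,
  some \<open>w \<in> C\<close> is then tied to no other point of \<open>C\<close>. Putting the gap at \<open>w\<close> gives a contradiction.\<close>

lemma optimal_no_tied:
  assumes opt: "optimal_matching V s \<pi> \<beta>"
  shows "tied_points V s \<pi> \<beta> = {}"
proof (rule ccontr)
  assume "tied_points V s \<pi> \<beta> \<noteq> {}"
  then obtain m where m: "m \<in> tied_points V s \<pi> \<beta>" by blast
  have \<beta>: "near_matching V s \<beta>" using opt by (simp add: optimal_matching_def)
  have mV: "m \<in> V" "\<beta> m = m" "4 \<le> card (orbit s m)" using m by (auto simp: tied_points_def free_points_def)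
  define C where "C = orbit s m"
  have CV: "C \<subseteq> V" unfolding C_def by (rule orbit_subset_carrier[OF s mV(1)])
  have finC: "finite C" using CV fin by (rule finite_subset)
  have mC: "m \<in> C" unfolding C_def by (rule orbit_self[OF fin s])
  have orb: "orbit s x = C" if "x \<in> C" for x using orbit_eq_of_mem[OF fin s] that by (simp add: C_def)
  have near_C: "\<gamma> x \<in> C" if "near_matching V s \<gamma>" "x \<in> C" for \<gamma> x
    using near_matching_orbit[OF fin s that(1), of x] that(2) CV orb by auto
  have "pairing C \<beta>" using near_C[OF \<beta>] pairingD(2)[OF near_matchingD(1)[OF \<beta>]] CV by (auto simp: pairing_def)
  moreover have "{x\<in>C. \<beta> x = x} = {m}"
    using near_matchingD(3)[OF \<beta> mV(1) _ mV(2)] mC mV(2) by (auto simp: C_def)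
  ultimately have odd: "odd (card C)" using pairing_parity[OF finC, of \<beta>] by simp
  have period: "(s ^^ card C) m = m"
  proof -
    have "card C = funpow_dist1 s m m"
      using orbit_conv_funpow_dist1[of m s] inj_on_funpow_dist1[of m s] mC
      by (simp add: C_def card_image)
    then show ?thesis using funpow_dist1_prop[of m s m] mC by (simp add: C_def)
  qed
  have all_tied: "\<exists>\<gamma>. optimal_matching V s \<pi> \<gamma> \<and> invariant_sets V \<pi> \<gamma> = invariant_sets V \<pi> \<beta> \<and>
     w \<in> tied_points V s \<pi> \<gamma> \<and> (\<forall>x. x \<notin> C \<longrightarrow> \<gamma> x = \<beta> x)" if w: "w \<in> C" for w
  proof -
    obtain i where i: "w = (s ^^ i) m" using w by (auto simp: C_def orbit_altdef)
    \<comment> \<open>Shifts go by two steps; an odd number of steps becomes even after one more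
      turn around \<open>C\<close>, whose length is odd.\<close>
    have "\<exists>k. w = (s ^^ (2 * k)) m"
    proof (cases "even i")
      case True then show ?thesis using i by (metis evenE)
    next
      case False
      have "w = (s ^^ (i + card C)) m" using period i by (simp add: funpow_add)
      moreover have "even (i + card C)" using False odd by simp
      ultimately show ?thesis by (metis evenE)
    qed
    then obtain k where "w = (s ^^ (2 * k)) m" by blast
    then show ?thesis using optimal_matching_shift_iterated[OF opt m, of k] by (simp add: C_def)
  qed
  have const: "w \<in> X \<longleftrightarrow> m \<in> X" if X: "X \<in> invariant_sets V \<pi> \<beta>" and w: "w \<in> C" for X w
  proof -
    have step: "s y \<in> X \<longleftrightarrow> y \<in> X" if y: "y \<in> C" for y
      using all_tied[OF y] X by (auto simp: tied_points_def uniform_at_def)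
    show ?thesis using w unfolding C_def
    proof induction
      case base then show ?case using step[OF mC] by simp
    next
      case (step y) then show ?case using \<open>\<And>y. y \<in> C \<Longrightarrow> s y \<in> X \<longleftrightarrow> y \<in> X\<close>[of y] by (simp add: C_def)
    qed
  qed
  define \<epsilon> where "\<epsilon> x = (if x \<in> C then x else \<beta> x)" for x
  have \<beta>C: "\<beta> x \<notin> C" if "x \<in> V" "x \<notin> C" for x
    using near_C[OF \<beta>, of "\<beta> x"] pairingD(2)[OF near_matchingD(1)[OF \<beta>] that(1)] that(2) by auto
  have \<epsilon>: "pairing V \<epsilon>"
    using \<beta>C pairingD[OF near_matchingD(1)[OF \<beta>]] by (auto simp: pairing_def \<epsilon>_def)
  \<comment> \<open>The component of \<open>w\<close> in the graph formed by \<open>\<pi>\<close>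
    and \<open>\<epsilon>\<close>.\<close>
  define cl where "cl w = {x \<in> V. \<forall>X\<in>invariant_sets V \<pi> \<epsilon>. x \<in> X \<longleftrightarrow> w \<in> X}" for w
  have cl_inv: "cl w \<in> invariant_sets V \<pi> \<epsilon>" for w
  proof -
    have "\<pi> x \<in> X \<longleftrightarrow> x \<in> X" "\<epsilon> x \<in> X \<longleftrightarrow> x \<in> X" if "X \<in> invariant_sets V \<pi> \<epsilon>" "x \<in> V" for x X
      using that by (auto simp: invariant_sets_def)
    moreover have "\<pi> x \<in> V" "\<epsilon> x \<in> V" if "x \<in> V" for x using that pairingD(1)[OF \<pi>] pairingD(1)[OF \<epsilon>] by auto
    ultimately have "\<pi> x \<in> cl w \<longleftrightarrow> x \<in> cl w" "\<epsilon> x \<in> cl w \<longleftrightarrow> x \<in> cl w" if "x \<in> V" for x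
      using that by (auto simp: cl_def)
    then show ?thesis unfolding invariant_sets_def by (auto simp: cl_def)
  qed
  obtain \<sigma> where \<sigma>: "separates V \<sigma> \<pi>" "separates V \<sigma> \<epsilon>" using two_pairings_separable[OF fin \<pi> \<epsilon>] by blast
  have differ: "\<sigma> p \<noteq> \<sigma> q" if "p \<in> C" "q \<in> C" "p \<noteq> q" "\<And>X. X \<in> invariant_sets V \<pi> \<epsilon> \<Longrightarrow> p \<in> X \<longleftrightarrow> q \<in> X" for p q
    by (rule tied_fixed_points_separated[OF \<epsilon> _ _ that(3) _ _ that(4) \<sigma>]) (use that CV in \<open>auto simp: \<epsilon>_def\<close>)
  have two: "card (cl w \<inter> C) \<le> 2" for w
  proof -
    have "inj_on \<sigma> (cl w \<inter> C)"
    proof (rule inj_onI, rule ccontr)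
      fix p q assume pq: "p \<in> cl w \<inter> C" "q \<in> cl w \<inter> C" "\<sigma> p = \<sigma> q" "p \<noteq> q"
      then have "p \<in> X \<longleftrightarrow> q \<in> X" if "X \<in> invariant_sets V \<pi> \<epsilon>" for X using that by (auto simp: cl_def)
      then show False using differ[of p q] pq by auto
    qed
    then have "card (cl w \<inter> C) \<le> card (UNIV :: bool set)" by (rule card_inj_on_le) auto
    then show ?thesis by simp
  qed
  have "\<exists>w\<in>C. cl w \<inter> C = {w}"
  proof (rule ccontr)
    assume no: "\<not> ?thesis"
    have wcl: "w \<in> cl w \<inter> C" if "w \<in> C" for w using that CV by (auto simp: cl_def)
    have card2: "card (cl w \<inter> C) = 2" if "w \<in> C" for w
    proof -
      have "cl w \<inter> C \<noteq> {w}" 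
      proof
        assume "cl w \<inter> C = {w}"
        with that have "\<exists>w\<in>C. cl w \<inter> C = {w}" by (rule bexI[rotated])
        with no show False by (rule notE)
      qed
      moreover have "w \<in> cl w \<inter> C" using wcl that .
      ultimately have "\<not> cl w \<inter> C \<subseteq> {w}" by (metis subset_singletonD empty_iff)
      then obtain x where "x \<in> cl w \<inter> C" "x \<noteq> w" unfolding subset_iff by (simp only: not_all not_imp singleton_iff) (elim exE conjE, rule that)
      then have "card {x, w} \<le> card (cl w \<inter> C)" using wcl[OF that] finC by (intro card_mono) auto
      then show ?thesis using two[of w] \<open>x \<noteq> w\<close> by simp
    qed
    have eq: "cl x = cl w" if "x \<in> cl w" for x w using that by (auto simp: cl_def)
    have "2 * card ((\<lambda>w. cl w \<inter> C) ` C) = card (\<Union>((\<lambda>w. cl w \<inter> C) ` C))"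
    proof (rule card_partition)
      show "finite ((\<lambda>w. cl w \<inter> C) ` C)" "finite (\<Union>((\<lambda>w. cl w \<inter> C) ` C))" using finC by auto
      show "card c = 2" if "c \<in> (\<lambda>w. cl w \<inter> C) ` C" for c using that card2 by auto
      show "c1 \<inter> c2 = {}" if c12: "c1 \<in> (\<lambda>w. cl w \<inter> C) ` C" "c2 \<in> (\<lambda>w. cl w \<inter> C) ` C" "c1 \<noteq> c2" for c1 c2
      proof (rule ccontr)
        assume "c1 \<inter> c2 \<noteq> {}"
        moreover obtain w1 w2 where c: "c1 = cl w1 \<inter> C" "c2 = cl w2 \<inter> C" using c12(1,2) by blast
        ultimately obtain x where "x \<in> cl w1" "x \<in> cl w2" by blast
        then have "cl w1 = cl w2" using eq[of x w1] eq[of x w2] by simp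
        then show False using c c12(3) by simp
      qed
    qed
    moreover have "\<Union>((\<lambda>w. cl w \<inter> C) ` C) = C" using wcl by blast
    ultimately have "card C = 2 * card ((\<lambda>w. cl w \<inter> C) ` C)" by simp
    then show False using odd by simp
  qed
  then obtain w where w: "w \<in> C" "cl w \<inter> C = {w}" by blast
  obtain \<gamma> where \<gamma>: "optimal_matching V s \<pi> \<gamma>" "invariant_sets V \<pi> \<gamma> = invariant_sets V \<pi> \<beta>"
    "w \<in> tied_points V s \<pi> \<gamma>" "\<forall>x. x \<notin> C \<longrightarrow> \<gamma> x = \<beta> x" using all_tied[OF w(1)] by blast
  have near\<gamma>: "near_matching V s \<gamma>" using \<gamma>(1) by (simp add: optimal_matching_def)
  have \<gamma>w: "\<gamma> w = w" using \<gamma>(3) by (simp add: tied_points_def free_points_def)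
  \<comment> \<open>With the gap at \<open>w\<close>, the matching \<open>\<gamma>\<close> fixes the
    only point of \<open>C\<close> in \<open>cl w\<close>, so \<open>cl w\<close> stays invariant
    when \<open>\<gamma>\<close> replaces \<open>\<epsilon>\<close>. But the sets invariant for
    \<open>\<gamma>\<close> are those for \<open>\<beta>\<close>, hence constant on
    \<open>C\<close>, which has several points.\<close>
  have "\<gamma> x \<in> cl w \<longleftrightarrow> x \<in> cl w" if x: "x \<in> V" for x
  proof (cases "x \<in> C")
    case False
    then have "\<gamma> x = \<epsilon> x" using \<gamma>(4) by (simp add: \<epsilon>_def)
    then show ?thesis using cl_inv[of w] x by (simp add: invariant_sets_def)
  next
    case True
    show ?thesis
    proof (cases "x = w")
      case False
      then have "\<gamma> x \<noteq> w" using pairingD(2)[OF near_matchingD(1)[OF near\<gamma>] x] \<gamma>w by auto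
      then show ?thesis using near_C[OF near\<gamma> True] True False w(2) by blast
    qed (use \<gamma>w in simp)
  qed
  then have clw: "cl w \<in> invariant_sets V \<pi> \<beta>"
    using cl_inv[of w] unfolding \<gamma>(2)[symmetric] by (auto simp: invariant_sets_def)
  have sm: "s m \<in> C" "s m \<noteq> m"
    using orbit_three_distinct(1)[OF fin s, of m] mV(3) by (auto simp: C_def orbit.base)
  have "w \<in> cl w" using w(2) by blast
  then have "m \<in> cl w" using const[OF clw w(1)] by simp
  then have "m \<in> cl w \<inter> C" "s m \<in> cl w \<inter> C" using const[OF clw sm(1)] sm(1) mC by simp_all
  then show False using sm(2) unfolding w(2) by simp
qed

end

section \<open>Averaging over the 2-colourings\<close>

context
  fixes V :: "'a set" and s \<pi> :: "'a \<Rightarrow> 'a"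
  assumes fin: "finite V" and s: "s permutes V" and \<pi>: "pairing V \<pi>"
begin

text \<open>A free point is not tied, so some invariant \<open>D\<close> is not uniform there.
  Changing by \<open>D\<close> maps the 2-colourings uniform at the point injectively to ones that
  are not, so at most half are bad there. Double counting yields a colouring no worse than the
  average.\<close>

lemma few_uniform_points:
  obtains \<beta> X where "near_matching V s \<beta>" "X \<in> separating_sets V \<pi> \<beta>"
    "2 * card {m \<in> free_points V s \<beta>. uniform_at s X m} \<le> card (free_points V s \<beta>)"
proof -
  obtain \<beta> where opt: "optimal_matching V s \<pi> \<beta>" using optimal_matching_exists[OF fin s \<pi>] by blast
  have \<beta>: "near_matching V s \<beta>" using opt by (simp add: optimal_matching_def)
  have p\<beta>: "pairing V \<beta>" by (rule near_matchingD(1)[OF \<beta>])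
  let ?S = "separating_sets V \<pi> \<beta>" and ?F = "free_points V s \<beta>"
  have finS: "finite ?S" using fin by (simp add: separating_sets_def)
  have finF: "finite ?F" using fin by (simp add: free_points_def)
  obtain \<sigma> where \<sigma>: "separates V \<sigma> \<pi>" "separates V \<sigma> \<beta>" using two_pairings_separable[OF fin \<pi> p\<beta>] by blast
  have sep_cong: "separates V (\<lambda>x. x \<in> {x\<in>V. \<sigma> x}) \<alpha>" if "pairing V \<alpha>" "separates V \<sigma> \<alpha>" for \<alpha>
    using that pairingD(1)[OF that(1)] by (simp add: separates_def)
  have "{x\<in>V. \<sigma> x} \<in> ?S" using sep_cong \<pi> p\<beta> \<sigma> by (auto simp: separating_sets_def)
  then have S0: "card ?S > 0" using finS by (auto simp: card_gt_0_iff)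
  have half: "2 * card {X\<in>?S. uniform_at s X m} \<le> card ?S" if m: "m \<in> ?F" for m
  proof -
    have "m \<notin> tied_points V s \<pi> \<beta>" using optimal_no_tied[OF fin s \<pi> opt] by simp
    then obtain D where D: "D \<in> invariant_sets V \<pi> \<beta>" "\<not> uniform_at s D m"
      using m by (auto simp: tied_points_def)
    define flip where "flip X = (X - D) \<union> (D - X)" for X
    have mem: "x \<in> flip X \<longleftrightarrow> (x \<in> X) \<noteq> (x \<in> D)" for x X by (auto simp: flip_def)
    have flipS: "flip X \<in> ?S" if "X \<in> ?S" for X
    proof -
      have "flip X \<subseteq> V" using that D by (auto simp: flip_def separating_sets_def invariant_sets_def)
      then show ?thesis using that D(1) unfolding separating_sets_def invariant_sets_def separates_def by (simp add: mem)
    qed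
    have "card {X\<in>?S. uniform_at s X m} \<le> card {X\<in>?S. \<not> uniform_at s X m}"
    proof (rule card_inj_on_le[of flip])
      show "inj_on flip {X\<in>?S. uniform_at s X m}"
        by (rule inj_on_inverseI[of _ flip]) (auto simp: flip_def)
      show "flip ` {X\<in>?S. uniform_at s X m} \<subseteq> {X\<in>?S. \<not> uniform_at s X m}"
        using flipS D(2) by (auto simp: uniform_at_def mem)
      show "finite {X\<in>?S. \<not> uniform_at s X m}" using finS by simp
    qed
    moreover have "card ?S = card {X\<in>?S. uniform_at s X m} + card {X\<in>?S. \<not> uniform_at s X m}"
    proof -
      have "card ({X\<in>?S. uniform_at s X m} \<union> {X\<in>?S. \<not> uniform_at s X m}) =
          card {X\<in>?S. uniform_at s X m} + card {X\<in>?S. \<not> uniform_at s X m}"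
        using finS by (intro card_Un_disjoint) auto
      moreover have "{X\<in>?S. uniform_at s X m} \<union> {X\<in>?S. \<not> uniform_at s X m} = ?S" by blast
      ultimately show ?thesis by simp
    qed
    ultimately show ?thesis by linarith
  qed
  have "\<exists>X\<in>?S. 2 * card {m\<in>?F. uniform_at s X m} \<le> card ?F"
  proof (rule ccontr)
    assume no: "\<not> ?thesis"
    have "card ?S * card ?F = (\<Sum>X\<in>?S. card ?F)" by simp
    also have "\<dots> < (\<Sum>X\<in>?S. 2 * card {m\<in>?F. uniform_at s X m})"
    proof (rule sum_strict_mono[OF finS])
      show "?S \<noteq> {}" using S0 by auto
      show "card ?F < 2 * card {m\<in>?F. uniform_at s X m}" if "X \<in> ?S" for X using no that not_le by blast
    qed
    also have "\<dots> = 2 * (\<Sum>X\<in>?S. \<Sum>m\<in>?F. of_bool (uniform_at s X m))"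
      using finF by (simp add: sum_distrib_left Collect_conj_eq Int_commute)
    also have "\<dots> = 2 * (\<Sum>m\<in>?F. \<Sum>X\<in>?S. of_bool (uniform_at s X m))"
      by (subst sum.swap) (rule refl)
    also have "\<dots> = (\<Sum>m\<in>?F. 2 * card {X\<in>?S. uniform_at s X m})"
      using finS by (simp add: sum_distrib_left Collect_conj_eq Int_commute)
    also have "\<dots> \<le> (\<Sum>m\<in>?F. card ?S)" using half by (rule sum_mono)
    also have "\<dots> = card ?S * card ?F" by simp
    finally show False by simp
  qed
  then show ?thesis using that \<beta> by blast
qed

text \<open>A cycle has at most one unmatched point, and if it has one, its length is odd, so at
  least 4 means at least 5.\<close>

lemma free_points_card:
  assumes \<beta>: "near_matching V s \<beta>"
  shows "card (free_points V s \<beta>) \<le> card {C \<in> orbit s ` V. 5 \<le> card C}"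
proof (rule card_inj_on_le[of "orbit s"])
  show "inj_on (orbit s) (free_points V s \<beta>)"
  proof (rule inj_onI)
    fix x y assume xy: "x \<in> free_points V s \<beta>" "y \<in> free_points V s \<beta>" "orbit s x = orbit s y"
    then have "x \<in> orbit s y" using orbit_self[OF fin s, of x] by simp
    then show "x = y" using near_matchingD(3)[OF \<beta>, of y x] xy by (simp add: free_points_def)
  qed
  show "orbit s ` free_points V s \<beta> \<subseteq> {C \<in> orbit s ` V. 5 \<le> card C}"
  proof
    fix C assume "C \<in> orbit s ` free_points V s \<beta>"
    then obtain m where m: "C = orbit s m" "m \<in> V" "\<beta> m = m" "4 \<le> card C" by (auto simp: free_points_def)
    have CV: "C \<subseteq> V" unfolding m(1) by (rule orbit_subset_carrier[OF s m(2)])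
    have "pairing C \<beta>"
      unfolding pairing_def
    proof
      fix x assume x: "x \<in> C"
      then have "orbit s x = C" using orbit_eq_of_mem[OF fin s] m(1) by simp
      then show "\<beta> x \<in> C \<and> \<beta> (\<beta> x) = x"
        using near_matching_orbit[OF fin s \<beta>, of x] pairingD(2)[OF near_matchingD(1)[OF \<beta>]] x CV by auto
    qed
    moreover have "{x\<in>C. \<beta> x = x} = {m}"
      using near_matchingD(3)[OF \<beta> m(2) _ m(3)] orbit_self[OF fin s, of m] m(3) by (auto simp: m(1))
    moreover have "finite C" using CV fin by (rule finite_subset)
    ultimately have "odd (card C)" using pairing_parity[of C \<beta>] by simp
    then have "card C \<noteq> 4" by auto
    then show "C \<in> {C \<in> orbit s ` V. 5 \<le> card C}" using m by auto
  qed
qed (use fin in simp)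

text \<open>A matched point differs in colour from its partner, which is one of its neighbours. On a
  triangle the neighbours of an unmatched point are matched to each other and differ, so they cannot
  both agree with it.\<close>

lemma uniform_neighbours:
  assumes \<beta>: "near_matching V s \<beta>" and X: "X \<in> separating_sets V \<pi> \<beta>" and x: "x \<in> V"
    and ne: "s x \<noteq> x" "inv s x \<noteq> x" "s x \<noteq> inv s x" and u: "uniform_at s X x"
  shows "x \<in> free_points V s \<beta>"
proof -
  note D = near_matchingD[OF \<beta>]
  have inv: "s (inv s y) = y" "inv s (s y) = y" for y using permutes_inverses[OF s] by auto
  have sep: "\<beta> y \<in> X \<longleftrightarrow> y \<notin> X" if "y \<in> V" "\<beta> y \<noteq> y" for y
    using X that by (auto simp: separating_sets_def separates_def)
  have bx: "\<beta> x = x"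
  proof (rule ccontr)
    assume b: "\<beta> x \<noteq> x"
    then have "\<beta> x = s x \<or> \<beta> x = inv s x" using D(2)[OF x] inv(2)[of "\<beta> x"] by auto
    then show False using sep[OF x b] u by (auto simp: uniform_at_def)
  qed
  have "inv s x \<in> orbit s x"
    using permutation_orbit_step[of s "inv s x"] orbit_self[OF fin s, of "inv s x"] fin s
    by (auto simp: inv permutation_permutes)
  then have sub: "{x, s x, inv s x} \<subseteq> orbit s x"
    using orbit_self[OF fin s, of x] orbit.base[of s x] by auto
  have card3: "card {x, s x, inv s x} = 3" using ne by auto
  have fo: "finite (orbit s x)" by (rule finite_orbit_carrier[OF fin s x])
  then have ge3: "3 \<le> card (orbit s x)" using card_mono[OF fo sub] card3 by simp
  have "card (orbit s x) \<noteq> 3"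
  proof
    assume c: "card (orbit s x) = 3"
    then have eq: "orbit s x = {x, s x, inv s x}" using card_subset_eq[OF fo sub] card3 by simp
    have sx: "s x \<in> V" using permutes_in_image[OF s] x by simp
    have "s (s x) \<in> {x, s x, inv s x}" unfolding eq[symmetric] by (auto intro: orbit.intros)
    then have ssx: "s (s x) = inv s x" using orbit_three_distinct[OF fin s ge3] by auto
    have b: "\<beta> (s x) \<noteq> s x" using D(3)[OF x orbit.base bx] ne(1) by blast
    have "\<beta> (s x) \<noteq> x" using pairingD(2)[OF D(1) sx] bx ne(1) by auto
    then have "\<beta> (s x) = s (s x)" using D(2)[OF sx] b inv(2)[of x] inv(2)[of "\<beta> (s x)"] by auto
    then show False using sep[OF sx b] u ssx by (auto simp: uniform_at_def)
  qed
  then show ?thesis using x bx ge3 by (simp add: free_points_def)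
qed

end

text \<open>\<open>X\<close> cuts each fibre of \<open>f\<close> into halves of at most two points,
  so inside a half the clique edges form a matching \<open>\<alpha>\<close>. Once \<open>Z\<close>
  is deleted, a point has at most one cycle neighbour on its own side of \<open>X\<close>, which
  gives a second matching \<open>\<gamma>\<close>. Separating both supplies the second bit of the
  colour.\<close>

lemma four_colouring_few_long_cycles:
  fixes f :: "'a \<Rightarrow> 'b"
  assumes fin: "finite V" and s: "s permutes V" and f: "\<And>y. card {x\<in>V. f x = y} \<le> 4"
  obtains Z c where "Z \<subseteq> V" "2 * card Z \<le> card {C \<in> orbit s ` V. 5 \<le> card C}" "good_colouring s f (V - Z) c"
proof -
  obtain \<pi> where \<pi>: "pairing V \<pi>" "\<forall>x\<in>V. f (\<pi> x) = f x" "inj_on f {x\<in>V. \<pi> x = x}"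
    using fiber_pairing[OF fin, of f] by blast
  obtain \<beta> X where \<beta>: "near_matching V s \<beta>" and X: "X \<in> separating_sets V \<pi> \<beta>"
    and few: "2 * card {m \<in> free_points V s \<beta>. uniform_at s X m} \<le> card (free_points V s \<beta>)"
    by (rule few_uniform_points[OF fin s \<pi>(1)])
  define Z where "Z = {m \<in> free_points V s \<beta>. uniform_at s X m}"
  define W where "W = V - Z"
  have finW: "finite W" using fin by (simp add: W_def)
  have inv: "s (inv s y) = y" "inv s (s y) = y" for y using permutes_inverses[OF s] by auto
  have cls: "card {x\<in>W. f x = y \<and> (x \<in> X) = b} \<le> 2" for y b
  proof -
    have "2 * card {x\<in>V. f x = y \<and> (x \<in> X) = b} \<le> card {x\<in>V. f x = y} + 1"
      by (rule separated_fiber_card[OF fin \<pi>(1) _ \<pi>(2,3)]) (use X in \<open>simp add: separating_sets_def\<close>)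
    moreover have "card {x\<in>W. f x = y \<and> (x \<in> X) = b} \<le> card {x\<in>V. f x = y \<and> (x \<in> X) = b}"
      using fin by (intro card_mono) (auto simp: W_def)
    ultimately show ?thesis using f[of y] by linarith
  qed
  obtain \<alpha> where \<alpha>: "pairing W \<alpha>" "\<forall>x\<in>W. (f (\<alpha> x), \<alpha> x \<in> X) = (f x, x \<in> X)" "inj_on (\<lambda>x. (f x, x \<in> X)) {x\<in>W. \<alpha> x = x}"
    using fiber_pairing[OF finW, of "\<lambda>x. (f x, x \<in> X)"] by blast
  have mate: "\<alpha> x = y" if xy: "x \<in> W" "y \<in> W" "x \<noteq> y" "f x = f y" "x \<in> X \<longleftrightarrow> y \<in> X" for x y
  proof -
    let ?F = "{z\<in>W. f z = f x \<and> (z \<in> X) = (x \<in> X)}"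
    have "{x, y} \<subseteq> ?F" using xy by auto
    moreover have "card ?F \<le> card {x, y}" using cls[of "f x" "x \<in> X"] xy(3) by simp
    moreover have "finite ?F" using finW by simp
    ultimately have eq: "?F = {x, y}" using card_seteq by metis
    have mem: "\<alpha> x \<in> ?F" "\<alpha> y \<in> ?F" using \<alpha>(2) xy pairingD(1)[OF \<alpha>(1)] by auto
    show ?thesis
    proof (rule ccontr)
      assume "\<alpha> x \<noteq> y"
      then have ax: "\<alpha> x = x" using mem(1) unfolding eq by blast
      have "\<alpha> y \<noteq> x" using pairingD(2)[OF \<alpha>(1) xy(2)] ax xy(3) by auto
      then have ay: "\<alpha> y = y" using mem(2) unfolding eq by blast
      have "x = y" by (rule inj_onD[OF \<alpha>(3)]) (use ax ay xy in auto)
      then show False using xy(3) by simp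
    qed
  qed
  define N where "N x = {y\<in>W. y \<noteq> x \<and> (y = s x \<or> x = s y) \<and> (y \<in> X \<longleftrightarrow> x \<in> X)}" for x
  have N_sym: "y \<in> N x \<longleftrightarrow> x \<in> N y" if "x \<in> W" "y \<in> W" for x y using that by (auto simp: N_def)
  have N_unique: "y = z" if x: "x \<in> W" and yz: "y \<in> N x" "z \<in> N x" for x y z
  proof (rule ccontr)
    assume "y \<noteq> z"
    have "w = s x \<or> w = inv s x" if "w \<in> N x" for w using that inv(2)[of w] by (auto simp: N_def)
    from this[OF yz(1)] this[OF yz(2)] have "s x \<in> N x" "inv s x \<in> N x" "s x \<noteq> inv s x" using yz \<open>y \<noteq> z\<close> by auto
    then have "s x \<noteq> x" "inv s x \<noteq> x" "s x \<noteq> inv s x" "uniform_at s X x" by (simp_all add: N_def uniform_at_def)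
    moreover have "x \<in> V" using x by (simp add: W_def)
    ultimately have "x \<in> Z" using uniform_neighbours[OF fin s \<pi>(1) \<beta> X] by (simp add: Z_def)
    then show False using x by (simp add: W_def)
  qed
  define \<gamma> where "\<gamma> x = (if N x = {} then x else (SOME y. y \<in> N x))" for x
  have \<gamma>N: "\<gamma> x \<in> N x" if "N x \<noteq> {}" for x
    using that someI_ex[of "\<lambda>y. y \<in> N x"] by (auto simp: \<gamma>_def)
  have \<gamma>_eq: "\<gamma> x = y" if "x \<in> W" "y \<in> N x" for x y
    using N_unique[OF that(1) _ that(2)] \<gamma>N[of x] that(2) by blast
  have "pairing W \<gamma>"
    unfolding pairing_def
  proof
    fix x assume x: "x \<in> W"
    show "\<gamma> x \<in> W \<and> \<gamma> (\<gamma> x) = x"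
    proof (cases "N x = {}")
      case True then show ?thesis using x by (simp add: \<gamma>_def)
    next
      case False
      then have g: "\<gamma> x \<in> N x" by (rule \<gamma>N)
      then have gW: "\<gamma> x \<in> W" by (simp add: N_def)
      then have "x \<in> N (\<gamma> x)" using N_sym[OF x gW] g by simp
      then show ?thesis using \<gamma>_eq[OF gW] gW by simp
    qed
  qed
  then obtain \<tau> where \<tau>: "separates W \<tau> \<alpha>" "separates W \<tau> \<gamma>" using two_pairings_separable[OF finW \<alpha>(1)] by blast
  define c where "c x = (if x \<in> X then 2 else 0) + (if \<tau> x then 1 else (0::nat))" for x
  have c_eq: "(x \<in> X \<longleftrightarrow> y \<in> X) \<and> \<tau> x = \<tau> y" if "c x = c y" for x y
    using that by (auto simp: c_def split: if_splits)
  have "good_colouring s f W c"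
    unfolding good_colouring_def
  proof (intro conjI ballI impI)
    show "c x < 4" for x by (simp add: c_def)
    show "c x \<noteq> c (s x)" if x: "x \<in> W" "s x \<in> W" "s x \<noteq> x" for x
    proof
      assume "c x = c (s x)"
      then have e: "x \<in> X \<longleftrightarrow> s x \<in> X" "\<tau> x = \<tau> (s x)" using c_eq by blast+
      then have "s x \<in> N x" using x by (simp add: N_def)
      then have "\<gamma> x = s x" by (rule \<gamma>_eq[OF x(1)])
      then show False using \<tau>(2) x e(2) by (auto simp: separates_def)
    qed
    show "c x \<noteq> c y" if xy: "x \<in> W" "y \<in> W" "f x = f y" "x \<noteq> y" for x y
    proof
      assume "c x = c y"
      then have e: "x \<in> X \<longleftrightarrow> y \<in> X" "\<tau> x = \<tau> y" using c_eq by blast+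
      then have "\<alpha> x = y" using mate[OF xy(1,2,4,3)] by simp
      then show False using \<tau>(1) xy e(2) by (auto simp: separates_def)
    qed
  qed
  moreover have "2 * card Z \<le> card {C \<in> orbit s ` V. 5 \<le> card C}"
    using few free_points_card[OF fin s \<pi>(1) \<beta>] by (simp add: Z_def)
  moreover have "Z \<subseteq> V" by (auto simp: Z_def free_points_def)
  ultimately show ?thesis using that by (simp add: W_def)
qed

section \<open>The deletion bound\<close>

lemma orbit_sizes:
  assumes fin: "finite V" and s: "s permutes V"
  shows "5 * card {C \<in> orbit s ` V. 5 \<le> card C} + 3 * card {C \<in> orbit s ` V. card C = 3} \<le> card V"
proof -
  let ?A = "{C \<in> orbit s ` V. 5 \<le> card C}" and ?B = "{C \<in> orbit s ` V. card C = 3}"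
  have finO: "finite (orbit s ` V)" using fin by simp
  have sub: "C \<subseteq> V" if "C \<in> orbit s ` V" for C using that orbit_subset_carrier[OF s] by auto
  have "5 * card ?A + 3 * card ?B = (\<Sum>C\<in>?A. 5) + (\<Sum>C\<in>?B. 3)" by simp
  also have "\<dots> \<le> (\<Sum>C\<in>?A. card C) + (\<Sum>C\<in>?B. card C)"
    by (intro add_mono sum_mono) auto
  also have "\<dots> = (\<Sum>C\<in>?A \<union> ?B. card C)"
    using finO by (intro sum.union_disjoint[symmetric]) auto
  also have "\<dots> = card (\<Union>(?A \<union> ?B))"
  proof (rule card_Union_disjoint[symmetric])
    show "pairwise disjnt (?A \<union> ?B)"
    proof (rule pairwiseI)
      fix C D assume CD: "C \<in> ?A \<union> ?B" "D \<in> ?A \<union> ?B" "C \<noteq> D"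
      have orb: "orbit s x = E" if "E \<in> ?A \<union> ?B" "x \<in> E" for x E
        using that orbit_eq_of_mem[OF fin s] by auto
      show "disjnt C D"
        unfolding disjnt_iff
      proof (intro allI notI)
        fix x assume x: "x \<in> C \<and> x \<in> D"
        show False using orb[OF CD(1) conjunct1[OF x]] orb[OF CD(2) conjunct2[OF x]] CD(3) by blast
      qed
    qed
    show "finite C" if "C \<in> ?A \<union> ?B" for C
      using that sub[of C] finite_subset[OF _ fin, of C] by auto
  qed
  also have "\<dots> \<le> card V" using sub fin by (intro card_mono) auto
  finally show ?thesis .
qed

lemma chromatic_number_le_of_good_colouring:
  assumes E: "\<And>v. \<not> E v v" "\<And>u v. u \<in> W \<Longrightarrow> v \<in> W \<Longrightarrow> E u v \<Longrightarrow> v = s u \<or> u = s v"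
    and f: "\<And>u v j. u \<in> W \<Longrightarrow> v \<in> W \<Longrightarrow> j < q \<Longrightarrow> u \<in> Y j \<Longrightarrow> v \<in> Y j \<Longrightarrow> f u = f v"
    and c: "good_colouring s f W c"
  shows "chromatic_number W (glue_cliques E q Y) \<le> 4"
proof -
  have c': "\<forall>x\<in>W. c x < 4" "\<And>x. x \<in> W \<Longrightarrow> s x \<in> W \<Longrightarrow> s x \<noteq> x \<Longrightarrow> c x \<noteq> c (s x)"
    "\<And>x y. x \<in> W \<Longrightarrow> y \<in> W \<Longrightarrow> f x = f y \<Longrightarrow> x \<noteq> y \<Longrightarrow> c x \<noteq> c y"
    using c unfolding good_colouring_def by blast+
  have "c u \<noteq> c v" if uv: "u \<in> W" "v \<in> W" "glue_cliques E q Y u v" for u v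
    using uv(3) unfolding glue_cliques_def
  proof
    assume e: "E u v"
    then have ne: "u \<noteq> v" using E(1) by auto
    from E(2)[OF uv(1,2) e] show ?thesis
    proof
      assume v: "v = s u"
      show ?thesis using c'(2)[of u] uv ne unfolding v by simp
    next
      assume u: "u = s v"
      show ?thesis using c'(2)[of v] uv ne unfolding u by simp
    qed
  next
    assume "u \<noteq> v \<and> (\<exists>j<q. u \<in> Y j \<and> v \<in> Y j)"
    then show ?thesis using c'(3)[OF uv(1,2)] f[OF uv(1,2)] by blast
  qed
  then have "colorable W (glue_cliques E q Y) 4" using c'(1) unfolding colorable_def by blast
  then show ?thesis unfolding chromatic_number_def by (rule Least_le)
qed

theorem theorem1p3:
  fixes V :: "'a set" and E :: "'a \<Rightarrow> 'a \<Rightarrow> bool"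
    and q :: nat and Y :: "nat \<Rightarrow> 'a set"
  assumes "simple_graph V E"
    and "max_degree_le V E 2"
    and "\<And>j. j < q \<Longrightarrow> Y j \<subseteq> V \<and> card (Y j) = 4"
    and "\<And>i j. i < q \<Longrightarrow> j < q \<Longrightarrow> i \<noteq> j \<Longrightarrow> Y i \<inter> Y j = {}"
  shows "\<exists>Z \<subseteq> V. real (card Z) \<le> real (card V) / 22
           \<and> chromatic_number (V - Z) (glue_cliques E q Y) \<le> 4"
proof -
  have fin: "finite V" and sym: "\<And>u v. E u v \<Longrightarrow> E v u" and irr: "\<And>v. \<not> E v v"
    using assms(1) unfolding simple_graph_def by blast+
  have "\<exists>s. s permutes V \<and> (\<forall>u\<in>V. \<forall>v\<in>V. E u v \<longrightarrow> v = s u \<or> u = s v)"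
    by (rule degree_two_permutation[OF fin sym])
      (use irr assms(2) in \<open>simp_all add: max_degree_le_def degree_def\<close>)
  then obtain s where s: "s permutes V" "\<forall>u\<in>V. \<forall>v\<in>V. E u v \<longrightarrow> v = s u \<or> u = s v" by blast
  \<comment> \<open>The label of a vertex is its clique, or its own singleton if it lies in none, so
    that unglued vertices are alone in their fibres.\<close>
  define f where "f v = insert v (\<Union>j\<in>{j. j < q \<and> v \<in> Y j}. Y j)" for v
  have fY: "f v = Y j" if "j < q" "v \<in> Y j" for v j
  proof -
    have "{i. i < q \<and> v \<in> Y i} = {j}" using that assms(4) by blast
    then show ?thesis using that by (auto simp: f_def)
  qed
  have f4: "card {x\<in>V. f x = y} \<le> 4" for y
  proof (cases "\<exists>j<q. y = Y j")
    case True
    then obtain j where j: "j < q" "y = Y j" by blast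
    have "finite (Y j)" using assms(3)[OF j(1)] by (simp add: card_ge_0_finite)
    then have "card {x\<in>V. f x = y} \<le> card (Y j)" using j by (intro card_mono) (auto simp: f_def)
    then show ?thesis using assms(3)[OF j(1)] by simp
  next
    case False
    have "{x\<in>V. f x = y} \<subseteq> {the_elem y}"
    proof
      fix x assume x: "x \<in> {x\<in>V. f x = y}"
      then have empty: "{j. j < q \<and> x \<in> Y j} = {}" using False fY by blast
      have "f x = {x}" unfolding f_def empty by simp
      then have "y = {x}" using x by simp
      then show "x \<in> {the_elem y}" by simp
    qed
    then have "card {x\<in>V. f x = y} \<le> card {the_elem y}" by (intro card_mono) auto
    then show ?thesis by simp
  qed
  have col: "chromatic_number (V - Z) (glue_cliques E q Y) \<le> 4" if "good_colouring s f (V - Z) c" for Z c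
    by (rule chromatic_number_le_of_good_colouring[OF irr _ _ that]) (use s(2) fY in auto)
  obtain Z1 c1 where Z1: "Z1 \<subseteq> V" "2 * card Z1 \<le> card {C \<in> orbit s ` V. 5 \<le> card C}" "good_colouring s f (V - Z1) c1"
    by (rule four_colouring_few_long_cycles[OF fin s(1) f4])
  obtain Z2 c2 where Z2: "Z2 \<subseteq> V" "4 * card Z2 \<le> card {C \<in> orbit s ` V. card C = 3}" "good_colouring s f (V - Z2) c2"
    by (rule four_colouring_few_triangles[OF fin s(1) f4])
  have "10 * card Z1 + 12 * card Z2 \<le> card V"
    using Z1(2) Z2(2) orbit_sizes[OF fin s(1)] by linarith
  then have "22 * card Z1 \<le> card V \<or> 22 * card Z2 \<le> card V" by linarith
  then show ?thesis
  proof
    assume "22 * card Z1 \<le> card V"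
    then have "real (22 * card Z1) \<le> real (card V)" by (rule of_nat_mono)
    then show ?thesis using Z1(1) col[OF Z1(3)] by (intro exI[of _ Z1]) simp
  next
    assume "22 * card Z2 \<le> card V"
    then have "real (22 * card Z2) \<le> real (card V)" by (rule of_nat_mono)
    then show ?thesis using Z2(1) col[OF Z2(3)] by (intro exI[of _ Z2]) simp
  qed
qed

end
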